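(* (Volume conservation and energy decay.) Let $(\vec X(\cdot,t),\mu(\cdot,t),\mu_{\mathcal S}(\cdot,t),\kappa(\cdot,t))$ be the solution of the variational formulation (V1)–(V4) given in the context, with initial curve $\Gamma_0$. Then $$\mathrm{vol}(\vec X(t))=\mathrm{vol}(\vec X(0)),\qquad W(t_2)\le W(t_1)\le W(0),\qquad t_2\ge t_1\ge 0 .$$
   Context: Notation. $\mathbb I=[0,1]$; subscripts $\rho,t$ denote partial derivatives; $(u,v)=\int_{\mathbb I}u\cdot v\,d\rho$ for scalar or $\mathbb R^2$-valued functions on $\mathbb I$; $\vec e_1=(1,0)$; $(\cdot)^\perp$ is clockwise rotation by $90$ degrees, $(a,b)^\perp=(b,-a)$. $L^2(\mathbb I)$ is the space of $u:\mathbb I\to\mathbb R$ that are square integrable over the curve $\Gamma(t)$ introduced below, i.e. $\int_{\mathbb I}|u|^2s_\rho\,d\rho<\infty$ with $s$ the arc length, $s_\rho=|\vec X_\rho|$. $H^1(\mathbb I)=\{u\in L^2(\mathbb I):u_\rho\in L^2(\mathbb I)\}$, $H^1_0(\mathbb I)=\{u\in H^1(\mathbb I):u(0)=u(1)=0\}$, $H^{(r)}_{a,b}(\mathbb I)=\{u\in H^1(\mathbb I):u(0)=a,\ u(1)=b\}$, $H^{(z)}_{a,b}(\mathbb I)=\{u\in H^1(\mathbb I):u(1)=0,\text{ and if }a>0,\ u(0)=0\}$, where $a$ and $b$ are the radii of the inner and outer contact lines. Data. $0<\varepsilon\ll1$ is a regularization parameter, $\eta\in(0,+\infty)$ the contact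 line mobility, $\sigma$ a real constant (dimensionless difference of the vapor/substrate and film/substrate surface energy densities), and $\gamma(\theta)$ a surface energy density with $\gamma(\theta)=\gamma(-\theta)$ for all $\theta\in[0,\pi]$ and $\gamma\in C^2([0,\pi])$. $\mathscr S(\theta)$ is a stability function, $q\in\{0,1\}$, and $$\boldsymbol B_q(\theta)=\begin{pmatrix}\gamma(\theta)&-\gamma'(\theta)\\ \gamma'(\theta)&\gamma(\theta)\end{pmatrix}\begin{pmatrix}\cos2\theta&\sin2\theta\\ \sin2\theta&-\cos2\theta\end{pmatrix}^{1-q}+\mathscr S(\theta)\left[\tfrac12\boldsymbol I-\tfrac12\begin{pmatrix}\cos2\theta&\sin2\theta\\ \sin2\theta&-\cos2\theta\end{pmatrix}\right],$$ where $\boldsymbol I$ is the $2\times2$ identity matrix. Curve. $\Gamma(t)=\vec X(\cdot,t)=(r(\cdot,t),z(\cdot,t))$ is the generating (radial) curve of an axisymmetric film surface; $\vec X_s=\vec X_\rho/|\vec X_\rho|=(r_s,z_s)$ is its unit tangent; $\theta=\arctan(z_s/r_s)$; $\vec n=-\vec X_s^\perp=(-z_s,r_s)$; $r_i=r(0,t)$ and $r_o=r(1,t)$ are the inner and outer contact line radii. Variational formulation. Given the initial open curve $\Gamma_0=\Gamma(0)=\vec X(\cdot,0)$, find $(\vec X(\cdot,t),\mu(\cdot,t),\mu_{\mathcal S}(\cdot,t),\kappa(\cdot,t))\in\big(H^{(r)}_{a,b}(\mathbb I)\times H^{(z)}_{a,b}(\mathbb I),\,H^1(\mathbb I),\,H^1_0(\mathbb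 I),\,L^2(\mathbb I)\big)$ such that (V1) for all $\phi\in H^1(\mathbb I)$: $(r\vec X_t\cdot\vec n,\phi|\vec X_\rho|)+(r\mu_\rho,\phi_\rho|\vec X_\rho|^{-1})=0$; (V2) for all $\vec\omega=(\omega_1,\omega_2)\in H^1(\mathbb I)\times H^1_0(\mathbb I)$: $$\begin{aligned}&(r\mu\vec n,\vec\omega|\vec X_\rho|)-(r\boldsymbol B_q(\theta)\vec X_\rho,\vec\omega_\rho|\vec X_\rho|^{-1})+\varepsilon^2\big(r(\mu_{\mathcal S})_\rho\vec n+\tfrac12r\mu_{\mathcal S}^2\vec X_\rho+(\vec n\cdot\vec e_1)\mu_{\mathcal S}\vec X_\rho,\ \vec\omega_\rho|\vec X_\rho|^{-1}\big)\\&-(\gamma(\theta)\vec e_1,\vec\omega|\vec X_\rho|)+\tfrac{\varepsilon^2}{2}(\mu_{\mathcal S}^2\vec e_1,\vec\omega|\vec X_\rho|)-\varepsilon^2(\mu_{\mathcal S}\kappa\vec e_1,\vec\omega|\vec X_\rho|)\\&+\tfrac1\eta\left[r_ir_t(0,t)\omega_1(0)+r_or_t(1,t)\omega_1(1)\right]-\sigma\left[r_o\omega_1(1)-r_i\omega_1(0)\right]=0;\end{aligned}$$ (V3) for all $\psi\in H^1_0(\mathbb I)$: $$\begin{aligned}&(r_t\mu_{\mathcal S},\psi|\vec X_\rho|)+(r(\mu_{\mathcal S})_t,\psi|\vec X_\rho|)+(r\,(\vec n\cdot(\vec X_t)_\rho),\psi_\rho|\vec X_\rho|^{-1})+(r(\vec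 X_\rho\cdot(\vec X_t)_\rho)\mu_{\mathcal S},\psi|\vec X_\rho|^{-1})\\&+((\vec n\cdot\vec e_1)(\vec X_\rho\cdot(\vec X_t)_\rho),\psi|\vec X_\rho|^{-1})-(r_t\kappa,\psi|\vec X_\rho|)=0;\end{aligned}$$ (V4) for all $\chi\in L^2(\mathbb I)$: $(r\mu_{\mathcal S},\chi|\vec X_\rho|)-(r\kappa,\chi|\vec X_\rho|)+(\vec n\cdot\vec e_1,\chi|\vec X_\rho|)=0$; with the initial conditions $\vec X(\cdot,0)=\vec X_0$ (the given parametrization of $\Gamma_0$) and $$\mu_{\mathcal S}(\rho,0)=2\kappa(\rho,0)\ \text{ for }\rho\in\{0,1\},\qquad \mu_{\mathcal S}(\rho,0)=\kappa(\rho,0)-\frac{\vec n\cdot\vec e_1}{r(\rho,0)}\ \text{ for }\rho\in(0,1).$$ Here $\mu$ represents the chemical potential, $\mu_{\mathcal S}$ the mean curvature of the surface and $\kappa$ the curvature of the generating curve. Volume and energy. With $s$ the arc length and $L(t)$ the length of $\Gamma(t)$, $$\mathrm{vol}(\vec X(t))=2\pi\int_0^{L(t)}r\,z\,r_s\,ds,\qquad W(t)=2\pi\int_0^{L(t)}r\gamma(\theta)\,ds+\varepsilon^2\pi\int_0^{L(t)}r\mu_{\mathcal S}^2\,ds-\sigma\pi(r_o^2-r_i^2).$$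
   Formalization: In (V2) the contact line terms are taken as −1/η[...] + σ[...], since with the printed signs a growing flat disc gains energy; solutions are assumed to have time derivatives, with X, X_t, μ_S bounded in H¹, (μ_S)_t in L², and |X_ρ| bounded below, locally in time. *)

theory Defs
  imports "HOL-Analysis.Analysis"
begin

section \<open>Calculus on the parameter interval\<close>

text \<open>
  Space-time fields are curried with time first: \<open>u t \<rho>\<close> is the value at parameter
  \<open>\<rho>\<close> and time \<open>t\<close>, so that \<open>u t\<close> is a function on the parameter interval.
  \<open>Dr u\<close> is \<open>u\<^sub>\<rho>\<close> (only used up to null sets) and \<open>Dt J u t\<close> is \<open>u\<^sub>t(\<cdot>,t)\<close>, one-sided
  at an end point of the time interval \<open>J\<close>.
\<close>

abbreviation leb_I :: "real measure" where
  "leb_I \<equiv> lebesgue_on {0..1}"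

definition Dr :: "(real \<Rightarrow> 'a::real_normed_vector) \<Rightarrow> real \<Rightarrow> 'a" where
  "Dr u \<rho> = vector_derivative u (at \<rho>)"

definition Dt :: "real set \<Rightarrow> (real \<Rightarrow> real \<Rightarrow> 'a::real_normed_vector) \<Rightarrow> real \<Rightarrow> real \<Rightarrow> 'a" where
  "Dt J u t \<rho> = vector_derivative (\<lambda>\<tau>. u \<tau> \<rho>) (at t within J)"

definition pairing :: "(real \<Rightarrow> 'a::euclidean_space) \<Rightarrow> (real \<Rightarrow> 'a) \<Rightarrow> real" where
  "pairing u v = (LINT \<rho>|leb_I. u \<rho> \<bullet> v \<rho>)"


section \<open>Geometry of a curve \<open>x = (r, z)\<close>\<close>

definition perp :: "real^2 \<Rightarrow> real^2" where
  "perp v = vector [v $ 2, - v $ 1]"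

definition e1 :: "real^2" where
  "e1 = vector [1, 0]"

definition speed :: "(real \<Rightarrow> real^2) \<Rightarrow> real \<Rightarrow> real" where
  "speed x \<rho> = norm (Dr x \<rho>)"

definition tangent :: "(real \<Rightarrow> real^2) \<Rightarrow> real \<Rightarrow> real^2" where
  "tangent x \<rho> = (1 / speed x \<rho>) *\<^sub>R Dr x \<rho>"

definition normal :: "(real \<Rightarrow> real^2) \<Rightarrow> real \<Rightarrow> real^2" where
  "normal x \<rho> = - perp (tangent x \<rho>)"

text \<open>
  The angle \<open>arctan (z\<^sub>s / r\<^sub>s)\<close> is the inclination angle of the unit tangent,
  \<open>(r\<^sub>s, z\<^sub>s) = (cos \<theta>, sin \<theta>)\<close>, with values in \<open>(-\<pi>, \<pi>]\<close>: the quadrant is taken into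
  account, and vertical tangents (\<open>r\<^sub>s = 0\<close>) and overhangs (\<open>r\<^sub>s < 0\<close>) are allowed.  This
  is why the surface energy density is a function on \<open>[0, \<pi>]\<close>, extended evenly.
\<close>

definition angle :: "(real \<Rightarrow> real^2) \<Rightarrow> real \<Rightarrow> real" where
  "angle x \<rho> = Arg (Complex (tangent x \<rho> $ 1) (tangent x \<rho> $ 2))"

text \<open>\<open>\<integral> f ds\<close> over the curve, with \<open>ds = |x\<^sub>\<rho>| d\<rho>\<close>.\<close>

definition arc_integral :: "(real \<Rightarrow> real^2) \<Rightarrow> (real \<Rightarrow> real) \<Rightarrow> real" where
  "arc_integral x f = (LINT \<rho>|leb_I. f \<rho> * speed x \<rho>)"

definition vol :: "(real \<Rightarrow> real^2) \<Rightarrow> real" where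
  "vol x = 2 * pi * arc_integral x (\<lambda>\<rho>. x \<rho> $ 1 * x \<rho> $ 2 * tangent x \<rho> $ 1)"

definition energy ::
  "real \<Rightarrow> real \<Rightarrow> (real \<Rightarrow> real) \<Rightarrow> (real \<Rightarrow> real^2) \<Rightarrow> (real \<Rightarrow> real) \<Rightarrow> real" where
  "energy \<epsilon> \<sigma> \<gamma> x \<mu>S =
     2 * pi * arc_integral x (\<lambda>\<rho>. x \<rho> $ 1 * \<gamma> (angle x \<rho>))
     + \<epsilon>\<^sup>2 * pi * arc_integral x (\<lambda>\<rho>. x \<rho> $ 1 * (\<mu>S \<rho>)\<^sup>2)
     - \<sigma> * pi * ((x 1 $ 1)\<^sup>2 - (x 0 $ 1)\<^sup>2)"


section \<open>Function spaces over a curve\<close>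

text \<open>
  Absolute continuity on \<open>[0,1]\<close>: in one dimension, a function with an integrable weak
  derivative is represented by the indefinite integral of its (almost everywhere) derivative.
  The members of \<open>H\<^sup>1\<close> below are these representatives; boundary values refer to them.
\<close>

definition abs_cont :: "(real \<Rightarrow> real) \<Rightarrow> bool" where
  "abs_cont u \<longleftrightarrow>
     (AE \<rho> in leb_I. u differentiable (at \<rho>)) \<and>
     integrable leb_I (Dr u) \<and>
     (\<forall>\<rho>\<in>{0..1}. u \<rho> = u 0 + (LINT y|lebesgue_on {0..\<rho>}. Dr u y))"

definition L2 :: "(real \<Rightarrow> real^2) \<Rightarrow> (real \<Rightarrow> real) set" where
  "L2 x = {u. u \<in> borel_measurable leb_I \<and> integrable leb_I (\<lambda>\<rho>. \<bar>u \<rho>\<bar>\<^sup>2 * speed x \<rho>)}"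

definition H1 :: "(real \<Rightarrow> real^2) \<Rightarrow> (real \<Rightarrow> real) set" where
  "H1 x = {u \<in> L2 x. abs_cont u \<and> Dr u \<in> L2 x}"

definition H1_0 :: "(real \<Rightarrow> real^2) \<Rightarrow> (real \<Rightarrow> real) set" where
  "H1_0 x = {u \<in> H1 x. u 0 = 0 \<and> u 1 = 0}"

definition H1_r :: "(real \<Rightarrow> real^2) \<Rightarrow> real \<Rightarrow> real \<Rightarrow> (real \<Rightarrow> real) set" where
  "H1_r x a b = {u \<in> H1 x. u 0 = a \<and> u 1 = b}"

definition H1_z :: "(real \<Rightarrow> real^2) \<Rightarrow> real \<Rightarrow> real \<Rightarrow> (real \<Rightarrow> real) set" where
  "H1_z x a b = {u \<in> H1 x. u 1 = 0 \<and> (a > 0 \<longrightarrow> u 0 = 0)}"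

definition normsq :: "(real \<Rightarrow> real^2) \<Rightarrow> (real \<Rightarrow> 'a::real_normed_vector) \<Rightarrow> real" where
  "normsq x u = (LINT \<rho>|leb_I. (norm (u \<rho>))\<^sup>2 * speed x \<rho>)"


section \<open>The anisotropy matrix\<close>

definition reflection :: "real \<Rightarrow> real^2^2" where
  "reflection \<theta> = vector [vector [cos (2 * \<theta>), sin (2 * \<theta>)],
                          vector [sin (2 * \<theta>), - cos (2 * \<theta>)]]"

text \<open>\<open>\<gamma>'\<close> is the derivative of \<open>\<gamma>\<close>; the conditional is the matrix power with exponent \<open>1 - q\<close>.\<close>

definition Bmat ::
  "(real \<Rightarrow> real) \<Rightarrow> (real \<Rightarrow> real) \<Rightarrow> (real \<Rightarrow> real) \<Rightarrow> nat \<Rightarrow> real \<Rightarrow> real^2^2" where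
  "Bmat \<gamma> \<gamma>' S q \<theta> =
     (vector [vector [\<gamma> \<theta>, - \<gamma>' \<theta>], vector [\<gamma>' \<theta>, \<gamma> \<theta>]] :: real^2^2)
       ** (if q = 1 then mat 1 else reflection \<theta>)
     + S \<theta> *\<^sub>R ((1/2) *\<^sub>R mat 1 - (1/2) *\<^sub>R reflection \<theta>)"


section \<open>The variational formulation\<close>

text \<open>
  The four equations at a fixed time, for the curve \<open>x = X(t)\<close>, its velocity
  \<open>v = X\<^sub>t(t)\<close>, and the fields \<open>m = \<mu>(t)\<close>, \<open>h = \<mu>\<^sub>S(t)\<close>, \<open>h' = (\<mu>\<^sub>S)\<^sub>t(t)\<close>, \<open>k = \<kappa>(t)\<close>.
\<close>

definition V1 :: "(real \<Rightarrow> real^2) \<Rightarrow> (real \<Rightarrow> real^2) \<Rightarrow> (real \<Rightarrow> real) \<Rightarrow> bool" where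
  "V1 x v m \<longleftrightarrow> (\<forall>\<phi>\<in>H1 x.
     pairing (\<lambda>\<rho>. x \<rho> $ 1 * (v \<rho> \<bullet> normal x \<rho>)) (\<lambda>\<rho>. \<phi> \<rho> * speed x \<rho>)
     + pairing (\<lambda>\<rho>. x \<rho> $ 1 * Dr m \<rho>) (\<lambda>\<rho>. Dr \<phi> \<rho> / speed x \<rho>) = 0)"

text \<open>
  Signs of the two contact line terms.  Apart from the \<open>\<mu>\<close> term, the other terms of
  the equation are \<open>- 1/(2 \<pi>)\<close> times the first variation of the bulk energy; the first variation of
  \<open>- \<sigma> \<pi> (r\<^sub>o\<^sup>2 - r\<^sub>i\<^sup>2)\<close> is \<open>- 2 \<pi> \<sigma> [r\<^sub>o \<omega>\<^sub>1(1) - r\<^sub>i \<omega>\<^sub>1(0)]\<close>, so consistency with the energy \<open>W\<close>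
  requires \<open>+ \<sigma> [r\<^sub>o \<omega>\<^sub>1(1) - r\<^sub>i \<omega>\<^sub>1(0)]\<close>, and dissipation at the contact lines requires
  \<open>- 1/\<eta> [r\<^sub>i r\<^sub>t(0) \<omega>\<^sub>1(0) + r\<^sub>o r\<^sub>t(1) \<omega>\<^sub>1(1)]\<close>.  Sources that print \<open>+ 1/\<eta> [...] - \<sigma> [...]\<close> next
  to these bulk terms contain a sign misprint: contact lines would then gain energy.  E.g. for
  \<open>\<gamma> = 1\<close>, \<open>|\<sigma>| < 1\<close> the flat disc \<open>r = \<rho> R(t)\<close>, \<open>z = \<mu> = \<mu>\<^sub>S = \<kappa> = 0\<close>, \<open>R' = \<eta> (1 + \<sigma>)\<close>, would
  be a solution, with increasing energy \<open>W = \<pi> (1 - \<sigma>) R\<^sup>2\<close>.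
\<close>

definition V2 ::
  "real \<Rightarrow> real \<Rightarrow> real \<Rightarrow> (real \<Rightarrow> real) \<Rightarrow> (real \<Rightarrow> real) \<Rightarrow> (real \<Rightarrow> real) \<Rightarrow> nat
   \<Rightarrow> (real \<Rightarrow> real^2) \<Rightarrow> (real \<Rightarrow> real^2) \<Rightarrow> (real \<Rightarrow> real) \<Rightarrow> (real \<Rightarrow> real) \<Rightarrow> (real \<Rightarrow> real) \<Rightarrow> bool"
where
  "V2 \<epsilon> \<eta> \<sigma> \<gamma> \<gamma>' S q x v m h k \<longleftrightarrow>
   (\<forall>\<omega> :: real \<Rightarrow> real^2. (\<lambda>\<rho>. \<omega> \<rho> $ 1) \<in> H1 x \<and> (\<lambda>\<rho>. \<omega> \<rho> $ 2) \<in> H1_0 x \<longrightarrow>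
     pairing (\<lambda>\<rho>. (x \<rho> $ 1 * m \<rho>) *\<^sub>R normal x \<rho>) (\<lambda>\<rho>. speed x \<rho> *\<^sub>R \<omega> \<rho>)
     - pairing (\<lambda>\<rho>. x \<rho> $ 1 *\<^sub>R (Bmat \<gamma> \<gamma>' S q (angle x \<rho>) *v Dr x \<rho>))
               (\<lambda>\<rho>. (1 / speed x \<rho>) *\<^sub>R Dr \<omega> \<rho>)
     + \<epsilon>\<^sup>2 * pairing (\<lambda>\<rho>. (x \<rho> $ 1 * Dr h \<rho>) *\<^sub>R normal x \<rho>
                        + (1/2 * x \<rho> $ 1 * (h \<rho>)\<^sup>2) *\<^sub>R Dr x \<rho>
                        + ((normal x \<rho> \<bullet> e1) * h \<rho>) *\<^sub>R Dr x \<rho>)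
                    (\<lambda>\<rho>. (1 / speed x \<rho>) *\<^sub>R Dr \<omega> \<rho>)
     - pairing (\<lambda>\<rho>. \<gamma> (angle x \<rho>) *\<^sub>R e1) (\<lambda>\<rho>. speed x \<rho> *\<^sub>R \<omega> \<rho>)
     + \<epsilon>\<^sup>2 / 2 * pairing (\<lambda>\<rho>. (h \<rho>)\<^sup>2 *\<^sub>R e1) (\<lambda>\<rho>. speed x \<rho> *\<^sub>R \<omega> \<rho>)
     - \<epsilon>\<^sup>2 * pairing (\<lambda>\<rho>. (h \<rho> * k \<rho>) *\<^sub>R e1) (\<lambda>\<rho>. speed x \<rho> *\<^sub>R \<omega> \<rho>)
     - 1 / \<eta> * (x 0 $ 1 * v 0 $ 1 * \<omega> 0 $ 1 + x 1 $ 1 * v 1 $ 1 * \<omega> 1 $ 1)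
     + \<sigma> * (x 1 $ 1 * \<omega> 1 $ 1 - x 0 $ 1 * \<omega> 0 $ 1) = 0)"

definition V3 ::
  "(real \<Rightarrow> real^2) \<Rightarrow> (real \<Rightarrow> real^2) \<Rightarrow> (real \<Rightarrow> real) \<Rightarrow> (real \<Rightarrow> real) \<Rightarrow> (real \<Rightarrow> real) \<Rightarrow> bool"
where
  "V3 x v h h' k \<longleftrightarrow> (\<forall>\<psi>\<in>H1_0 x.
     pairing (\<lambda>\<rho>. v \<rho> $ 1 * h \<rho>) (\<lambda>\<rho>. \<psi> \<rho> * speed x \<rho>)
     + pairing (\<lambda>\<rho>. x \<rho> $ 1 * h' \<rho>) (\<lambda>\<rho>. \<psi> \<rho> * speed x \<rho>)
     + pairing (\<lambda>\<rho>. x \<rho> $ 1 * (normal x \<rho> \<bullet> Dr v \<rho>)) (\<lambda>\<rho>. Dr \<psi> \<rho> / speed x \<rho>)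
     + pairing (\<lambda>\<rho>. x \<rho> $ 1 * (Dr x \<rho> \<bullet> Dr v \<rho>) * h \<rho>) (\<lambda>\<rho>. \<psi> \<rho> / speed x \<rho>)
     + pairing (\<lambda>\<rho>. (normal x \<rho> \<bullet> e1) * (Dr x \<rho> \<bullet> Dr v \<rho>)) (\<lambda>\<rho>. \<psi> \<rho> / speed x \<rho>)
     - pairing (\<lambda>\<rho>. v \<rho> $ 1 * k \<rho>) (\<lambda>\<rho>. \<psi> \<rho> * speed x \<rho>) = 0)"

definition V4 :: "(real \<Rightarrow> real^2) \<Rightarrow> (real \<Rightarrow> real) \<Rightarrow> (real \<Rightarrow> real) \<Rightarrow> bool" where
  "V4 x h k \<longleftrightarrow> (\<forall>\<xi>\<in>L2 x.
     pairing (\<lambda>\<rho>. x \<rho> $ 1 * h \<rho>) (\<lambda>\<rho>. \<xi> \<rho> * speed x \<rho>)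
     - pairing (\<lambda>\<rho>. x \<rho> $ 1 * k \<rho>) (\<lambda>\<rho>. \<xi> \<rho> * speed x \<rho>)
     + pairing (\<lambda>\<rho>. normal x \<rho> \<bullet> e1) (\<lambda>\<rho>. \<xi> \<rho> * speed x \<rho>) = 0)"

text \<open>
  Regularity under which the time derivatives and all pairings in the equations make sense:
  \<open>X\<close>, \<open>X\<^sub>\<rho>\<close> and \<open>\<mu>\<^sub>S\<close> are differentiable in time with \<open>(X\<^sub>\<rho>)\<^sub>t = (X\<^sub>t)\<^sub>\<rho>\<close>, \<open>X\<^sub>t\<close> is
  \<open>H\<^sup>1\<close>-valued and \<open>(\<mu>\<^sub>S)\<^sub>t\<close> is \<open>L\<^sup>2\<close>-valued; locally uniformly in time the parametrization is
  nondegenerate and \<open>X\<close>, \<open>X\<^sub>t\<close>, \<open>\<mu>\<^sub>S\<close> are bounded in \<open>H\<^sup>1\<close> and \<open>(\<mu>\<^sub>S)\<^sub>t\<close> is bounded in \<open>L\<^sup>2\<close>.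
\<close>

definition regular_in_time ::
  "real set \<Rightarrow> (real \<Rightarrow> real \<Rightarrow> real^2) \<Rightarrow> (real \<Rightarrow> real \<Rightarrow> real) \<Rightarrow> bool" where
  "regular_in_time J X \<mu>S \<longleftrightarrow>
     (\<forall>t\<in>J. \<forall>\<rho>\<in>{0..1}. (\<lambda>\<tau>. X \<tau> \<rho>) differentiable (at t within J)) \<and>
     (AE \<rho> in leb_I. \<forall>t\<in>J.
        ((\<lambda>\<tau>. Dr (X \<tau>) \<rho>) has_vector_derivative Dr (Dt J X t) \<rho>) (at t within J)) \<and>
     (AE \<rho> in leb_I. \<forall>t\<in>J. (\<lambda>\<tau>. \<mu>S \<tau> \<rho>) differentiable (at t within J)) \<and>
     (\<forall>t\<in>J. (\<lambda>\<rho>. Dt J X t \<rho> $ 1) \<in> H1 (X t) \<and> (\<lambda>\<rho>. Dt J X t \<rho> $ 2) \<in> H1 (X t)) \<and>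
     (\<forall>t\<in>J. Dt J \<mu>S t \<in> L2 (X t)) \<and>
     (\<forall>T\<in>J. \<exists>c>0. \<exists>C. \<forall>t\<in>{0..T}.
        (AE \<rho> in leb_I. c \<le> speed (X t) \<rho>) \<and>
        normsq (X t) (X t) \<le> C \<and> normsq (X t) (Dr (X t)) \<le> C \<and>
        normsq (X t) (Dt J X t) \<le> C \<and> normsq (X t) (Dr (Dt J X t)) \<le> C \<and>
        normsq (X t) (\<mu>S t) \<le> C \<and> normsq (X t) (Dr (\<mu>S t)) \<le> C \<and>
        normsq (X t) (Dt J \<mu>S t) \<le> C)"

text \<open>
  The radii \<open>a\<close>, \<open>b\<close> in the solution space are the current contact line radii
  \<open>r\<^sub>i(t)\<close>, \<open>r\<^sub>o(t)\<close>; \<open>r > 0\<close> away from the end points since \<open>r\<close> is the distance to the rotation axis,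
  and \<open>r\<^sub>i = 0\<close> (no inner contact line) is allowed.  In \<open>(0,1)\<close> the initial condition for \<open>\<mu>\<^sub>S\<close>
  is imposed almost everywhere, as \<open>n\<close> and \<open>\<kappa>\<close> are only defined up to null sets.
\<close>

definition solution ::
  "real \<Rightarrow> real \<Rightarrow> real \<Rightarrow> (real \<Rightarrow> real) \<Rightarrow> (real \<Rightarrow> real) \<Rightarrow> (real \<Rightarrow> real) \<Rightarrow> nat
   \<Rightarrow> real set \<Rightarrow> (real \<Rightarrow> real^2)
   \<Rightarrow> (real \<Rightarrow> real \<Rightarrow> real^2) \<Rightarrow> (real \<Rightarrow> real \<Rightarrow> real) \<Rightarrow> (real \<Rightarrow> real \<Rightarrow> real) \<Rightarrow> (real \<Rightarrow> real \<Rightarrow> real)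
   \<Rightarrow> bool"
where
  "solution \<epsilon> \<eta> \<sigma> \<gamma> \<gamma>' S q J X0 X \<mu> \<mu>S \<kappa> \<longleftrightarrow>
     (\<forall>t\<in>J. \<forall>\<rho>\<in>{0<..<1}. X t \<rho> $ 1 > 0) \<and>
     (\<forall>t\<in>J.
        (\<lambda>\<rho>. X t \<rho> $ 1) \<in> H1_r (X t) (X t 0 $ 1) (X t 1 $ 1) \<and>
        (\<lambda>\<rho>. X t \<rho> $ 2) \<in> H1_z (X t) (X t 0 $ 1) (X t 1 $ 1) \<and>
        \<mu> t \<in> H1 (X t) \<and> \<mu>S t \<in> H1_0 (X t) \<and> \<kappa> t \<in> L2 (X t)) \<and>
     regular_in_time J X \<mu>S \<and>
     (\<forall>t\<in>J.
        V1 (X t) (Dt J X t) (\<mu> t) \<and>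
        V2 \<epsilon> \<eta> \<sigma> \<gamma> \<gamma>' S q (X t) (Dt J X t) (\<mu> t) (\<mu>S t) (\<kappa> t) \<and>
        V3 (X t) (Dt J X t) (\<mu>S t) (Dt J \<mu>S t) (\<kappa> t) \<and>
        V4 (X t) (\<mu>S t) (\<kappa> t)) \<and>
     (\<forall>\<rho>\<in>{0..1}. X 0 \<rho> = X0 \<rho>) \<and>
     (\<forall>\<rho>\<in>{0, 1}. \<mu>S 0 \<rho> = 2 * \<kappa> 0 \<rho>) \<and>
     (AE \<rho> in leb_I. \<rho> \<in> {0<..<1} \<longrightarrow> \<mu>S 0 \<rho> = \<kappa> 0 \<rho> - (normal (X 0) \<rho> \<bullet> e1) / (X 0 \<rho> $ 1))"

end

theory Submission
  imports Defs
begin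

text \<open>
  For a fixed \<open>\<rho>\<close>, the energy density is differentiable in time except where the curve tangent
  crosses the horizontal direction transversally, since there the even extension of \<open>\<gamma>\<close> may have a
  kink.  Transversal crossings are isolated, hence countably many, so the fundamental theorem of
  calculus still holds, and by Fubini \<open>W\<close> is the time integral of the spatial integral of the
  formal rate of change.  At every single time that spatial integral is estimated by the
  equations: testing (V1) with \<open>\<mu>\<close>, (V2) with \<open>X\<^sub>t\<close> and (V3) with \<open>\<mu>\<^sub>S\<close> leaves only
  \<open>- \<integral> r \<mu>\<^sub>\<rho>\<^sup>2 / |X\<^sub>\<rho>|\<close> and the contact line dissipation.  The volume is treated in the same way,
  with \<open>\<phi> = 1\<close> in (V1).
\<close>


text \<open>Fubini works with such integral bounds, once joint measurability has been recovered from
  differentiability in time. The three tests fit together because (V2) and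
  \<open>\<epsilon>\<^sup>2\<close> times (V3) combine to the rate of the curvature energy; the
  terms with \<open>\<kappa>\<close> cancel in this combination. A further obstacle sits on the
  rotation axis: if the curve starts there, \<open>X\<^sub>t\<close> may violate the boundary
  condition on test functions in (V2). A cut-off near the axis restores it. Its slope is of size
  \<open>1 / d\<close> on an interval of length \<open>d\<close>, which is absorbed because
  \<open>r\<close> and \<open>\<mu>S\<close> both vanish at that end and have square integrable
  derivatives.\<close>

section \<open>Calculus with countably many exceptional times\<close>

text \<open>The error at a tag in the exceptional set is bounded by the increment of a jump function \<open>H\<close>
  over the tagged interval, and these increments telescope.\<close>

lemma has_integral_countable_exceptions:
  fixes f :: "real \<Rightarrow> real"
  assumes "a \<le> b" and "countable S" and cont: "continuous_on {a..b} f"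
    and vecd: "\<And>x. x \<in> {a..b} - S \<Longrightarrow> (f has_vector_derivative f' x) (at x within {a..b})"
  shows "(f' has_integral (f b - f a)) {a..b}"
proof (cases "S = {}")
  case True
  then show ?thesis using fundamental_theorem_of_calculus[of a b f f'] assms by simp
next
  case False
  define s where "s = from_nat_into S"
  have s: "range s = S" unfolding s_def using False \<open>countable S\<close> by (rule range_from_nat_into)
  \<comment> \<open>\<open>H\<close> gets two jumps per listed point, one counted from
    \<open>s n\<close> on and one only beyond it. So an interval gains at least
    \<open>(1/2)^n\<close> even if \<open>s n\<close> is merely one of its end points, as happens
    when the tag sits at an end.\<close>
  define j :: "real \<Rightarrow> nat \<Rightarrow> real" where
    "j x n = (1/2)^n * (of_bool (s n < x) + of_bool (s n \<le> x))" for x n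
  define H where "H x = (\<Sum>n. j x n)" for x
  have sum_j: "summable (j x)" for x
  proof (rule summable_comparison_test)
    show "summable (\<lambda>n. 2 * (1/2::real)^n)" by (intro summable_mult summable_geometric) simp
    show "\<exists>N. \<forall>n\<ge>N. norm (j x n) \<le> 2 * (1/2)^n" by (simp add: j_def)
  qed
  have j_mono: "j u n \<le> j v n" if "u \<le> v" for u v n
    using that unfolding j_def by (intro mult_left_mono add_mono) auto
  have H_mono: "H u \<le> H v" if "u \<le> v" for u v
    unfolding H_def using j_mono[OF that] sum_j by (intro suminf_le) auto
  have H_jump: "(1/2)^n \<le> H v - H u" if "u < v" "u \<le> s n" "s n \<le> v" for u v n
  proof -
    have "(1/2)^n \<le> j v n - j u n" using that unfolding j_def by auto
    also have "\<dots> = (\<Sum>k\<in>{n}. j v k - j u k)" by simp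
    also have "\<dots> \<le> (\<Sum>k. j v k - j u k)"
      using j_mono[of u v] \<open>u < v\<close> by (intro sum_le_suminf summable_diff sum_j) auto
    also have "\<dots> = H v - H u" unfolding H_def using sum_j by (simp add: suminf_diff)
    finally show ?thesis .
  qed
  \<comment> \<open>With the integrand set to 0 on \<open>S\<close>, an exceptional tag contributes
    only the increment of \<open>f\<close>. Since \<open>S\<close> is negligible, \<open>f'\<close>
    is put back at the end.\<close>
  define g where "g x = (if x \<in> S then 0 else f' x)" for x
  have "(g has_integral (f b - f a)) {a..b}"
    unfolding has_integral_factor_content_real
  proof safe
    fix e0 :: real assume "0 < e0"
    show "\<exists>d. gauge d \<and> (\<forall>p. p tagged_division_of {a..b} \<and> d fine p \<longrightarrow>
        norm ((\<Sum>(x, k)\<in>p. measure lborel k *\<^sub>R g x) - (f b - f a)) \<le> e0 * measure lborel {a..b})"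
    proof (cases "a = b")
      case True
      then have "(\<Sum>(x, k)\<in>p. measure lborel k *\<^sub>R g x) = 0" if "p tagged_division_of {a..b}" for p
        using sum_content_null[of a b p g] that by simp
      then show ?thesis using True by (intro exI[of _ "\<lambda>x. ball x 1"]) auto
    next
      case False
      then have "a < b" using \<open>a \<le> b\<close> by simp
      \<comment> \<open>The errors will be at most \<open>e\<close> times the increments of
        \<open>x + H x\<close>, which telescope to \<open>M\<close>; \<open>e\<close> is scaled so
        that \<open>e * M\<close> is the permitted total error.\<close>
      define M where "M = (b - a) + (H b - H a)"
      have "M > 0" using \<open>a < b\<close> H_mono[of a b] by (simp add: M_def)
      define e where "e = e0 * (b - a) / M"
      have "e > 0" using \<open>0 < e0\<close> \<open>a < b\<close> \<open>M > 0\<close> by (simp add: e_def)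
      \<comment> \<open>The enumeration \<open>s\<close> may repeat points, so the least index is
        taken. The factor 1/2 leaves room for the two pieces of the interval on either side of the
        tag.\<close>
      have "\<exists>d>0. x \<in> {a..b} \<longrightarrow> (if x \<in> S
          then (\<forall>y\<in>{a..b}. \<bar>y - x\<bar> < d \<longrightarrow> \<bar>f y - f x\<bar> \<le> e / 2 * (1/2)^(LEAST k. s k = x))
          else \<forall>y\<in>{a..b}. \<bar>y - x\<bar> < d \<longrightarrow> \<bar>f y - f x - (y-x) * f' x\<bar> \<le> e * \<bar>y-x\<bar>)" for x
      proof (cases "x \<in> {a..b}")
        case x: True
        show ?thesis
        proof (cases "x \<in> S")
          case True
          have "e / 2 * (1/2)^(LEAST k. s k = x) > 0" using \<open>e > 0\<close> by simp
          with cont x obtain d where "d > 0"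
            "\<And>y. y \<in> {a..b} \<Longrightarrow> \<bar>y - x\<bar> < d \<Longrightarrow> \<bar>f y - f x\<bar> < e / 2 * (1/2)^(LEAST k. s k = x)"
            unfolding continuous_on_iff dist_real_def by metis
          then show ?thesis using True by (intro exI[of _ d]) (auto intro!: less_imp_le)
        next
          case False
          then show ?thesis using vecd[of x] x \<open>e > 0\<close>
            unfolding has_vector_derivative_def has_derivative_within_alt by auto
        qed
      qed (auto intro: exI[of _ 1])
      then obtain d where "\<forall>x. 0 < d x \<and> (x \<in> {a..b} \<longrightarrow> (if x \<in> S
          then (\<forall>y\<in>{a..b}. \<bar>y - x\<bar> < d x \<longrightarrow> \<bar>f y - f x\<bar> \<le> e / 2 * (1/2)^(LEAST k. s k = x))
          else \<forall>y\<in>{a..b}. \<bar>y - x\<bar> < d x \<longrightarrow> \<bar>f y - f x - (y-x) * f' x\<bar> \<le> e * \<bar>y-x\<bar>))"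
        by metis
      then have d0: "\<And>x. 0 < d x" and
        d1: "\<And>x y. \<lbrakk>x \<in> {a..b}; x \<in> S; y \<in> {a..b}; \<bar>y - x\<bar> < d x\<rbrakk>
               \<Longrightarrow> \<bar>f y - f x\<bar> \<le> e / 2 * (1/2)^(LEAST k. s k = x)" and
        d2: "\<And>x y. \<lbrakk>x \<in> {a..b}; x \<notin> S; y \<in> {a..b}; \<bar>y - x\<bar> < d x\<rbrakk>
               \<Longrightarrow> \<bar>f y - f x - (y-x) * f' x\<bar> \<le> e * \<bar>y-x\<bar>"
        by meson+
      show ?thesis
      proof (rule exI, safe)
        show "gauge (\<lambda>x. ball x (d x))" using d0 gauge_ball_dependent by blast
      next
        fix p assume ptag: "p tagged_division_of {a..b}" and finep: "(\<lambda>x. ball x (d x)) fine p"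
        have tel: "(\<Sum>(x,K)\<in>p. h (Sup K) - h (Inf K)) = h b - h a" for h :: "real \<Rightarrow> real"
          using additive_tagged_division_1[OF \<open>a \<le> b\<close> ptag, of h] by simp
        have "norm (\<Sum>(x, K) \<in> p. (measure lborel K *\<^sub>R g x) - (f (Sup K) - f (Inf K)))
          \<le> (\<Sum>n\<in>p. e * (case n of (x, K) \<Rightarrow> (Sup K + H (Sup K)) - (Inf K + H (Inf K))))"
        proof (rule sum_norm_le, safe)
          fix x K assume xK: "(x, K) \<in> p"
          then have "x \<in> K" "K \<subseteq> {a..b}" using ptag by blast+
          moreover obtain u v where k: "K = cbox u v" using ptag xK by blast
          ultimately have "u \<le> v" "u \<le> x" "x \<le> v" "u \<in> {a..b}" "v \<in> {a..b}" "x \<in> {a..b}" by auto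
          have "K \<subseteq> ball x (d x)" using finep xK by blast
          then have "\<bar>u - x\<bar> < d x" "\<bar>v - x\<bar> < d x"
            using \<open>u \<le> v\<close> unfolding k by (auto simp: subset_iff dist_real_def)
          have "\<bar>(v - u) * g x - (f v - f u)\<bar> \<le> e * ((v + H v) - (u + H u))"
          proof (cases "x \<in> S")
            case True
            show ?thesis
            proof (cases "u = v")
              case False
              define n where "n = (LEAST k. s k = x)"
              have "\<exists>k. s k = x" using True s by auto
              then have "s n = x" unfolding n_def by (rule LeastI_ex)
              have "\<bar>f v - f u\<bar> \<le> \<bar>f v - f x\<bar> + \<bar>f u - f x\<bar>" by simp
              also have "\<dots> \<le> e / 2 * (1/2)^n + e / 2 * (1/2)^n"
                unfolding n_def by (intro add_mono d1) fact+
              also have "\<dots> = e * (1/2)^n" by simp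
              also have "\<dots> \<le> e * (H v - H u)"
                using H_jump[of u v n] False \<open>u \<le> v\<close> \<open>u \<le> x\<close> \<open>x \<le> v\<close> \<open>s n = x\<close> \<open>e > 0\<close>
                by (intro mult_left_mono) auto
              also have "\<dots> \<le> e * ((v + H v) - (u + H u))"
                using \<open>u \<le> v\<close> \<open>e > 0\<close> by (intro mult_left_mono) auto
              finally show ?thesis using True by (simp add: g_def abs_minus_commute)
            qed simp
          next
            case False
            have "\<bar>(v - u) * f' x - (f v - f u)\<bar>
                = \<bar>(f u - f x - (u - x) * f' x) - (f v - f x - (v - x) * f' x)\<bar>"
              by (simp add: algebra_simps)
            also have "\<dots> \<le> \<bar>f u - f x - (u - x) * f' x\<bar> + \<bar>f v - f x - (v - x) * f' x\<bar>" by simp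
            also have "\<dots> \<le> e * \<bar>u - x\<bar> + e * \<bar>v - x\<bar>"
              by (intro add_mono d2) fact+
            also have "\<dots> = e * (v - u)" using \<open>u \<le> x\<close> \<open>x \<le> v\<close> by (simp add: algebra_simps)
            also have "\<dots> \<le> e * ((v + H v) - (u + H u))"
              using H_mono[OF \<open>u \<le> v\<close>] \<open>e > 0\<close> by (intro mult_left_mono) auto
            finally show ?thesis using False by (simp add: g_def)
          qed
          then show "norm (measure lborel K *\<^sub>R g x - (f (Sup K) - f (Inf K)))
              \<le> e * (Sup K + H (Sup K) - (Inf K + H (Inf K)))"
            using \<open>u \<le> v\<close> by (simp add: k)
        qed
        also have "\<dots> = e * ((b + H b) - (a + H a))"
          using tel[of "\<lambda>x. x + H x"] by (simp add: sum_distrib_left[symmetric] split_def)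
        also have "\<dots> = e0 * measure lborel {a..b}"
          using \<open>M > 0\<close> \<open>a < b\<close> by (simp add: e_def M_def field_simps)
        finally show "norm ((\<Sum>(x, k)\<in>p. measure lborel k *\<^sub>R g x) - (f b - f a)) \<le> e0 * measure lborel {a..b}"
          using tel[of f] by (simp add: split_def sum_subtractf)
      qed
    qed
  qed
  moreover have "negligible S" using \<open>countable S\<close>
    by (simp add: negligible_iff_null_sets null_sets_completionI countable_imp_null_set_lborel)
  ultimately show ?thesis
    using has_integral_spike[of S "{a..b}" f' g] by (auto simp: g_def)
qed

text \<open>Each point selects a member of a countable basis that isolates it in \<open>S\<close>,
  and different points select different members.\<close>

lemma countable_isolated_points:
  fixes S :: "'a::second_countable_topology set"
  assumes "\<And>x. x \<in> S \<Longrightarrow> \<exists>U. open U \<and> U \<inter> S = {x}"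
  shows "countable S"
proof -
  obtain B :: "'a set set" where B: "countable B" "topological_basis B"
    using ex_countable_basis by blast
  have "\<exists>V\<in>B. V \<inter> S = {x}" if "x \<in> S" for x
  proof -
    from assms[OF that] obtain U where U: "open U" "U \<inter> S = {x}" by auto
    moreover from U have "x \<in> U" by auto
    ultimately obtain V where "V \<in> B" "x \<in> V" "V \<subseteq> U"
      using B(2) topological_basisE by metis
    then show ?thesis using U that by (intro bexI[of _ V]) auto
  qed
  then obtain V where V: "\<And>x. x \<in> S \<Longrightarrow> V x \<in> B \<and> V x \<inter> S = {x}" by metis
  have "inj_on V S" by (rule inj_onI) (metis V singleton_inject)
  moreover have "countable (V ` S)" using V by (intro countable_subset[OF _ B(1)]) auto
  ultimately show ?thesis by (metis countable_image_inj_on)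
qed

text \<open>Linear approximation with tolerance \<open>\<bar>f' t\<bar> / 2\<close> excludes further
  zeros near a zero of nonzero slope, so such zeros are isolated.\<close>

lemma countable_transversal_zeros:
  fixes f :: "real \<Rightarrow> real"
  assumes "\<And>t. t \<in> T \<Longrightarrow> (f has_vector_derivative f' t) (at t within T)"
  shows "countable {t \<in> T. f t = 0 \<and> f' t \<noteq> 0}" (is "countable ?Z")
proof (rule countable_isolated_points)
  fix t assume t: "t \<in> ?Z"
  then have "\<forall>e>0. \<exists>d>0. \<forall>y\<in>T. \<bar>y - t\<bar> < d \<longrightarrow> \<bar>f y - f t - (y - t) * f' t\<bar> \<le> e * \<bar>y - t\<bar>"
    using assms[of t] unfolding has_vector_derivative_def has_derivative_within_alt by auto
  moreover have "\<bar>f' t\<bar> / 2 > 0" using t by simp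
  ultimately obtain d where d: "d > 0"
    "\<And>y. y \<in> T \<Longrightarrow> \<bar>y - t\<bar> < d \<Longrightarrow> \<bar>f y - f t - (y - t) * f' t\<bar> \<le> \<bar>f' t\<bar> / 2 * \<bar>y - t\<bar>"
    by metis
  have "y = t" if "y \<in> ?Z" "\<bar>y - t\<bar> < d" for y
  proof -
    have "\<bar>(y - t) * f' t\<bar> \<le> \<bar>f' t\<bar> / 2 * \<bar>y - t\<bar>" using d(2)[of y] that t by simp
    then have "\<bar>f' t\<bar> * \<bar>y - t\<bar> \<le> 0" by (simp add: abs_mult)
    then show ?thesis using t by (simp add: mult_le_0_iff)
  qed
  then show "\<exists>U. open U \<and> U \<inter> ?Z = {t}"
    using t d(1) by (intro exI[of _ "ball t d"]) (auto simp: dist_real_def abs_minus_commute)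
qed


section \<open>Differentiation under the integral\<close>

text \<open>A Caratheodory function is jointly measurable: when time is rounded to a grid only
  countably many sections occur, and refining the grid converges by continuity in time.\<close>

lemma borel_measurable_pair_caratheodory:
  fixes f :: "real \<Rightarrow> 'b \<Rightarrow> real"
  assumes meas: "\<And>t. t \<in> {a..b} \<Longrightarrow> f t \<in> borel_measurable M"
    and cont: "\<And>x. x \<in> space M \<Longrightarrow> continuous_on {a..b} (\<lambda>t. f t x)"
    and T: "T \<subseteq> {a..b}"
  shows "(\<lambda>(t, x). f t x) \<in> borel_measurable (lebesgue_on T \<Otimes>\<^sub>M M)"
proof -
  let ?P = "lebesgue_on T \<Otimes>\<^sub>M M"
  \<comment> \<open>Rounding down never exceeds \<open>b\<close>; the maximum with \<open>a\<close>
    repairs grid points that fall out of the interval on the left.\<close>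
  define s where "s n t = max a (real_of_int \<lfloor>real (Suc n) * t\<rfloor> / real (Suc n))" for n t
  have s_le: "s n t \<in> {a..b}" if "t \<in> T" for n t
  proof -
    have "real_of_int \<lfloor>real (Suc n) * t\<rfloor> / real (Suc n) \<le> t"
      by (simp add: divide_le_eq mult.commute del: of_nat_Suc)
    then show ?thesis using that T unfolding s_def by auto
  qed
  have s_meas[measurable]: "s n \<in> borel_measurable borel" for n unfolding s_def by measurable
  show ?thesis
  proof (rule borel_measurable_LIMSEQ_metric[where f = "\<lambda>n (t, x). f (s n t) x"])
    fix n
    define I where "I = s n ` T"
    have "I \<subseteq> range (\<lambda>k. max a (real_of_int k / real (Suc n)))" unfolding I_def s_def by auto
    then have I: "countable I" by (rule countable_subset) simp
    have "(\<lambda>p. f (s n (fst p)) (snd p)) \<in> borel_measurable ?P"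
    proof (rule measurable_compose_countable'[where f = "\<lambda>i p. f i (snd p)" and g = "\<lambda>p. s n (fst p)", OF _ _ I])
      fix i assume "i \<in> I"
      then have [measurable]: "f i \<in> borel_measurable M" using s_le meas unfolding I_def by auto
      show "(\<lambda>p. f i (snd p)) \<in> borel_measurable ?P" by measurable
    next
      have "(\<lambda>p. s n (fst p)) \<in> borel_measurable ?P"
        by (rule measurable_compose[OF measurable_fst])
           (rule measurable_restrict_space1, simp add: measurable_completion)
      then have "(\<lambda>p. s n (fst p)) -` {i} \<inter> space ?P \<in> sets ?P" for i
        by (rule measurable_sets) simp
      then show "(\<lambda>p. s n (fst p)) \<in> ?P \<rightarrow>\<^sub>M count_space I"
        using measurable_count_space_eq_countable[OF I, of "\<lambda>p. s n (fst p)" ?P]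
        by (auto simp: space_pair_measure I_def)
    qed
    then show "(\<lambda>(t, x). f (s n t) x) \<in> borel_measurable ?P" by (simp add: case_prod_beta')
  next
    fix p assume p: "p \<in> space ?P"
    obtain t x where tx: "p = (t, x)" "t \<in> T" "x \<in> space M" using p by (auto simp: space_pair_measure)
    have lim: "(\<lambda>n. s n t) \<longlonglongrightarrow> max a t"
      unfolding s_def
    proof (intro tendsto_max tendsto_const)
      show "(\<lambda>n. real_of_int \<lfloor>real (Suc n) * t\<rfloor> / real (Suc n)) \<longlonglongrightarrow> t"
      proof (rule tendsto_sandwich)
        show "\<forall>\<^sub>F n in sequentially. t - 1 / real (Suc n) \<le> real_of_int \<lfloor>real (Suc n) * t\<rfloor> / real (Suc n)"
        proof (rule always_eventually, rule allI)
          fix n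
          have "real (Suc n) * t - 1 \<le> real_of_int \<lfloor>real (Suc n) * t\<rfloor>" by linarith
          then have "(real (Suc n) * t - 1) / real (Suc n) \<le> real_of_int \<lfloor>real (Suc n) * t\<rfloor> / real (Suc n)"
            by (rule divide_right_mono) simp
          then show "t - 1 / real (Suc n) \<le> real_of_int \<lfloor>real (Suc n) * t\<rfloor> / real (Suc n)"
            by (simp add: diff_divide_distrib del: of_nat_Suc)
        qed
        show "\<forall>\<^sub>F n in sequentially. real_of_int \<lfloor>real (Suc n) * t\<rfloor> / real (Suc n) \<le> t"
          by (rule always_eventually) (simp add: divide_le_eq mult.commute del: of_nat_Suc)
        show "(\<lambda>n. t - 1 / real (Suc n)) \<longlonglongrightarrow> t"
          using tendsto_diff[OF tendsto_const[of t] LIMSEQ_inverse_real_of_nat]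
          by (simp add: inverse_eq_divide)
      qed simp
    qed
    have "max a t = t" using tx T by auto
    have "(\<lambda>n. f (s n t) x) \<longlonglongrightarrow> f t x"
      using cont[OF tx(3)] lim s_le[OF tx(2)] tx(2) T unfolding \<open>max a t = t\<close> continuous_on_sequentially
      by (auto simp: o_def)
    then show "(\<lambda>n. (case p of (t, x) \<Rightarrow> f (s n t) x)) \<longlonglongrightarrow> (case p of (t, x) \<Rightarrow> f t x)"
      by (simp add: tx)
  qed
qed

text \<open>The derivative is a pointwise limit of difference quotients, each of which is a
  Caratheodory function up to a measurable factor. This is how time derivatives of the fields become
  jointly measurable.\<close>

lemma borel_measurable_pair_derivative:
  fixes f g :: "real \<Rightarrow> 'b \<Rightarrow> real"
  assumes meas: "\<And>t. t \<in> {a..b} \<Longrightarrow> f t \<in> borel_measurable M"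
    and der: "\<And>t x. t \<in> {a..b} \<Longrightarrow> x \<in> space M \<Longrightarrow>
      ((\<lambda>s. f s x) has_vector_derivative g t x) (at t within {a..b})"
  shows "(\<lambda>(t, x). g t x) \<in> borel_measurable (lebesgue_on {a<..<b} \<Otimes>\<^sub>M M)"
proof -
  let ?P = "lebesgue_on {a<..<b} \<Otimes>\<^sub>M M"
  have cont: "continuous_on {a..b} (\<lambda>t. f t x)" if "x \<in> space M" for x
    using der[OF _ that] has_vector_derivative_continuous
    by (fastforce simp: continuous_on_eq_continuous_within)
  \<comment> \<open>The step is a fraction of the remaining time \<open>b - t\<close>, so the
    shifted time stays in \<open>{a..b}\<close>, and the step is nonzero as long as
    \<open>t < b\<close>.\<close>
  define s where "s n t = t + (b - t) / real (n + 2)" for n t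
  have s_in: "s n t \<in> {a..b}" if "t \<in> {a..b}" for n t
  proof -
    have "(b - t) / real (n + 2) \<le> b - t" using that mult_right_mono[of t b "real n"]
      by (auto simp: field_simps)
    moreover have "0 \<le> (b - t) / real (n + 2)" using that by auto
    ultimately show ?thesis using that unfolding s_def by auto
  qed
  have s_cont: "continuous_on A (s n)" for A n unfolding s_def by (intro continuous_intros) auto
  have 0: "(\<lambda>(t, x). f t x) \<in> borel_measurable ?P"
    by (rule borel_measurable_pair_caratheodory[OF meas cont]) auto
  have 1: "(\<lambda>(t, x). f (s n t) x) \<in> borel_measurable ?P" for n
  proof (rule borel_measurable_pair_caratheodory[of a b])
    show "f (s n t) \<in> borel_measurable M" if "t \<in> {a..b}" for t using meas s_in that by blast
    show "continuous_on {a..b} (\<lambda>t. f (s n t) x)" if "x \<in> space M" for x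
      by (rule continuous_on_compose2[OF cont[OF that] s_cont]) (use s_in in auto)
  qed auto
  have id: "(\<lambda>(t, x). t) \<in> borel_measurable ?P"
    unfolding case_prod_beta' by (rule measurable_compose[OF measurable_fst]) (simp add: measurable_restrict_space1 measurable_completion)
  have 2: "(\<lambda>(t, x). (f (s n t) x - f t x) / ((b - t) / real (n + 2))) \<in> borel_measurable ?P" for n
    using 0 1[of n] id unfolding case_prod_beta' by measurable
  show ?thesis
  proof (rule borel_measurable_LIMSEQ_metric[OF 2])
    fix p assume p: "p \<in> space ?P"
    obtain t x where tx: "p = (t, x)" "t \<in> {a<..<b}" "x \<in> space M"
      using p by (auto simp: space_pair_measure)
    have "((\<lambda>y. (f y x - f t x) / (y - t)) \<longlongrightarrow> g t x) (at t within {a..b})"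
      using der[of t x] tx
      by (simp add: has_real_derivative_iff_has_vector_derivative[symmetric] has_field_derivative_iff)
    moreover have "filterlim (\<lambda>n. s n t) (at t within {a..b}) sequentially"
    proof -
      have "(\<lambda>n. s n t) \<longlonglongrightarrow> t + 0"
        unfolding s_def
      proof (intro tendsto_add tendsto_const)
        have "(\<lambda>n. (b - t) / real n) \<longlonglongrightarrow> 0" by (rule lim_const_over_n)
        then show "(\<lambda>n. (b - t) / real (n + 2)) \<longlonglongrightarrow> 0" by (rule LIMSEQ_ignore_initial_segment)
      qed
      moreover have "s n t \<noteq> t" for n using tx by (simp add: s_def)
      ultimately show ?thesis unfolding filterlim_at using s_in[of t] tx by auto
    qed
    ultimately have "(\<lambda>n. (f (s n t) x - f t x) / (s n t - t)) \<longlonglongrightarrow> g t x"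
      by (rule filterlim_compose)
    then show "(\<lambda>n. case p of (t, x) \<Rightarrow> (f (s n t) x - f t x) / ((b - t) / real (n + 2)))
        \<longlonglongrightarrow> (case p of (t, x) \<Rightarrow> g t x)"
      by (simp add: tx s_def)
  qed
qed

text \<open>The uniform bound \<open>C\<close> on the integrals of \<open>\<bar>G t\<bar>\<close>
  makes \<open>G\<close> integrable on the product. Swapping the two integrals then leaves the
  fundamental theorem of calculus in time for each single \<open>x\<close>.\<close>

lemma has_integral_integral_derivative:
  fixes F G :: "real \<Rightarrow> 'b \<Rightarrow> real"
  assumes "sigma_finite_measure M" and "a < b"
    and Fa: "integrable M (F a)" and Fb: "integrable M (F b)"
    and cont: "\<And>x. x \<in> space M \<Longrightarrow> continuous_on {a..b} (\<lambda>t. F t x)"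
    and ctbl: "\<And>x. x \<in> space M \<Longrightarrow> countable (S x)"
    and der: "\<And>x t. x \<in> space M \<Longrightarrow> t \<in> {a<..<b} - S x \<Longrightarrow>
      ((\<lambda>t. F t x) has_vector_derivative G t x) (at t within {a..b})"
    and meas: "(\<lambda>(t, x). G t x) \<in> borel_measurable (lebesgue_on {a<..<b} \<Otimes>\<^sub>M M)"
    and int: "\<And>t. t \<in> {a<..<b} \<Longrightarrow> integrable M (G t)"
    and bound: "\<And>t. t \<in> {a<..<b} \<Longrightarrow> (\<integral>x. \<bar>G t x\<bar> \<partial>M) \<le> C"
  shows "((\<lambda>t. \<integral>x. G t x \<partial>M) has_integral ((\<integral>x. F b x \<partial>M) - (\<integral>x. F a x \<partial>M))) {a..b}"
proof -
  let ?T = "lebesgue_on {a<..<b}"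
  interpret T: finite_measure ?T by (rule finite_measure_lebesgue_on) simp
  interpret M: sigma_finite_measure M by fact
  interpret P: pair_sigma_finite ?T M ..
  have P: "integrable (?T \<Otimes>\<^sub>M M) (\<lambda>(t, x). G t x)"
  proof (rule P.Fubini_integrable[OF meas])
    show "integrable ?T (\<lambda>t. \<integral>x. norm (case (t, x) of (t, x) \<Rightarrow> G t x) \<partial>M)"
    proof (rule T.integrable_const_bound[where B = C])
      show "AE t in ?T. norm (\<integral>x. norm (case (t, x) of (t, x) \<Rightarrow> G t x) \<partial>M) \<le> C"
        using bound by (intro AE_I2) auto
      show "(\<lambda>t. \<integral>x. norm (case (t, x) of (t, x) \<Rightarrow> G t x) \<partial>M) \<in> borel_measurable ?T"
        using meas by (intro M.borel_measurable_lebesgue_integral) (simp add: case_prod_beta')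
    qed
    show "AE t in ?T. integrable M (\<lambda>x. case (t, x) of (t, x) \<Rightarrow> G t x)"
      using int by (intro AE_I2) auto
  qed
  \<comment> \<open>Countably many exceptions lead to a gauge integral. It equals the Lebesgue
    integral where the section in time is integrable, which Fubini provides for almost every
    \<open>x\<close>.\<close>
  have ftc: "(\<integral>t. G t x \<partial>?T) = F b x - F a x" if x: "x \<in> space M" "integrable ?T (\<lambda>t. G t x)" for x
  proof -
    have "((\<lambda>t. G t x) has_integral (\<integral>t. G t x \<partial>?T)) {a<..<b}"
      by (rule has_integral_integral_lebesgue_on[OF x(2)]) simp
    then have "((\<lambda>t. G t x) has_integral (\<integral>t. G t x \<partial>?T)) {a..b}"
      using has_integral_Icc_iff_Ioo by blast
    moreover have "((\<lambda>t. G t x) has_integral (F b x - F a x)) {a..b}"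
      using \<open>a < b\<close> ctbl[OF x(1)] cont[OF x(1)] der[OF x(1)]
      by (intro has_integral_countable_exceptions[where S = "S x \<union> {a, b}"]) auto
    ultimately show ?thesis by (rule has_integral_unique)
  qed
  have "(\<integral>t. (\<integral>x. G t x \<partial>M) \<partial>?T) = (\<integral>x. (\<integral>t. G t x \<partial>?T) \<partial>M)"
    by (rule P.Fubini_integral[OF P, symmetric])
  also have "\<dots> = (\<integral>x. F b x - F a x \<partial>M)"
  proof (rule integral_cong_AE)
    show "(\<lambda>x. \<integral>t. G t x \<partial>?T) \<in> borel_measurable M"
      using P.integrable_snd[OF P] by auto
    show "(\<lambda>x. F b x - F a x) \<in> borel_measurable M" using Fa Fb by auto
    show "AE x in M. (\<integral>t. G t x \<partial>?T) = F b x - F a x"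
      using P.AE_integrable_snd[OF P] AE_space by eventually_elim (rule ftc)
  qed
  also have "\<dots> = (\<integral>x. F b x \<partial>M) - (\<integral>x. F a x \<partial>M)" using Fa Fb by simp
  finally have eq: "(\<integral>t. (\<integral>x. G t x \<partial>M) \<partial>?T) = (\<integral>x. F b x \<partial>M) - (\<integral>x. F a x \<partial>M)" .
  have "integrable ?T (\<lambda>t. \<integral>x. G t x \<partial>M)" by (rule P.integrable_fst[OF P])
  then have "((\<lambda>t. \<integral>x. G t x \<partial>M) has_integral (\<integral>t. (\<integral>x. G t x \<partial>M) \<partial>?T)) {a<..<b}"
    by (rule has_integral_integral_lebesgue_on) simp
  then show ?thesis unfolding eq using has_integral_Icc_iff_Ioo by blast
qed


section \<open>Anisotropic surface energy of a plane vector\<close>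

text \<open>At a zero the difference quotients of \<open>f\<close> and \<open>\<bar>f\<bar>\<close>
  have the same absolute value, and convergence to 0 ignores signs.\<close>

lemma has_real_derivative_abs_zero:
  fixes f :: "real \<Rightarrow> real"
  assumes "(f has_real_derivative 0) (at t within T)" and "f t = 0"
  shows "((\<lambda>s. \<bar>f s\<bar>) has_real_derivative 0) (at t within T)"
proof -
  have "((\<lambda>s. f s / (s - t)) \<longlongrightarrow> 0) (at t within T)"
    using assms by (simp add: has_field_derivative_iff)
  then have "((\<lambda>s. \<bar>f s\<bar> / (s - t)) \<longlongrightarrow> 0) (at t within T)"
    by (rule Lim_transform_bound[rotated]) (simp add: abs_divide)
  then show ?thesis using assms by (simp add: has_field_derivative_iff)
qed

text \<open>The angle is invariant under positive scaling, so it can be read off from the components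
  of \<open>Dr x\<close> instead of the unit tangent; these are the quantities whose time
  derivatives are given.\<close>

definition plane_angle :: "real \<Rightarrow> real \<Rightarrow> real" where
  "plane_angle a b = Arg (Complex a b)"

definition plane_norm :: "real \<Rightarrow> real \<Rightarrow> real" where
  "plane_norm a b = sqrt (a\<^sup>2 + b\<^sup>2)"

lemma plane_norm_nonneg [simp]: "0 \<le> plane_norm a b"
  by (simp add: plane_norm_def)

lemma plane_norm_eq_0_iff [simp]: "plane_norm a b = 0 \<longleftrightarrow> a = 0 \<and> b = 0"
  by (simp add: plane_norm_def sum_power2_eq_zero_iff)

lemma plane_norm_power2: "(plane_norm a b)\<^sup>2 = a\<^sup>2 + b\<^sup>2"
  by (simp add: plane_norm_def)

lemma abs_le_plane_norm: "\<bar>a\<bar> \<le> plane_norm a b" "\<bar>b\<bar> \<le> plane_norm a b"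
  unfolding plane_norm_def by (simp_all add: real_le_rsqrt)

lemma plane_angle_bounds: "- pi < plane_angle a b" "plane_angle a b \<le> pi"
  by (simp_all add: plane_angle_def mpi_less_Arg Arg_le_pi)

text \<open>\<open>Arg\<close> jumps across the negative real axis but its absolute value does not,
  and for an even \<open>\<gamma>\<close> the absolute value decides.\<close>

lemma abs_plane_angle:
  assumes "a \<noteq> 0 \<or> b \<noteq> 0"
  shows "\<bar>plane_angle a b\<bar> = arccos (a / plane_norm a b)"
proof -
  have "cos \<bar>plane_angle a b\<bar> = a / plane_norm a b"
    using assms by (simp add: plane_angle_def plane_norm_def cos_Arg cmod_def complex_eq_iff cos_abs_real)
  moreover have "\<bar>plane_angle a b\<bar> \<le> pi" using plane_angle_bounds[of a b] by linarith
  ultimately show ?thesis using arccos_cos[of "\<bar>plane_angle a b\<bar>"] by simp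
qed

lemma plane_angle_neg_iff: "plane_angle a b < 0 \<longleftrightarrow> b < 0"
  by (simp add: plane_angle_def Arg_neg_iff)

lemma cos_plane_angle: "a \<noteq> 0 \<or> b \<noteq> 0 \<Longrightarrow> cos (plane_angle a b) = a / plane_norm a b"
  by (simp add: plane_angle_def plane_norm_def cos_Arg cmod_def complex_eq_iff)

lemma sin_plane_angle: "a \<noteq> 0 \<or> b \<noteq> 0 \<Longrightarrow> sin (plane_angle a b) = b / plane_norm a b"
  by (simp add: plane_angle_def plane_norm_def sin_Arg cmod_def complex_eq_iff)

lemma divide_plane_norm_bounds: "- 1 \<le> a / plane_norm a b" "a / plane_norm a b \<le> 1"
  proof -
  have "\<bar>a / plane_norm a b\<bar> \<le> 1"
    using abs_le_plane_norm(1)[of a b] by (auto simp: abs_divide divide_le_eq_1 less_le)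
  then show "- 1 \<le> a / plane_norm a b" "a / plane_norm a b \<le> 1" by linarith+
qed

lemma sqrt_one_minus_cosine:
  assumes "a \<noteq> 0 \<or> b \<noteq> 0"
  shows "sqrt (1 - (a / plane_norm a b)\<^sup>2) = \<bar>b\<bar> / plane_norm a b"
proof (rule real_sqrt_unique)
  have "plane_norm a b \<noteq> 0" using assms by auto
  then show "(\<bar>b\<bar> / plane_norm a b)\<^sup>2 = 1 - (a / plane_norm a b)\<^sup>2"
    using plane_norm_power2[of a b] by (simp add: power_divide field_simps)
qed simp

lemma plane_norm_has_real_derivative:
  assumes "(u has_real_derivative u') (at t within T)" "(v has_real_derivative v') (at t within T)"
    and "u t \<noteq> 0 \<or> v t \<noteq> 0"
  shows "((\<lambda>s. plane_norm (u s) (v s)) has_real_derivative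
     (u t * u' + v t * v') / plane_norm (u t) (v t)) (at t within T)"
proof -
  have "0 < (u t)\<^sup>2 + (v t)\<^sup>2" using assms(3) by (simp add: sum_power2_gt_zero_iff)
  then have "((\<lambda>s. sqrt ((u s)\<^sup>2 + (v s)\<^sup>2)) has_real_derivative
     (2 * u t * u' + 2 * v t * v') * (inverse (sqrt ((u t)\<^sup>2 + (v t)\<^sup>2)) / 2)) (at t within T)"
    using assms(1,2) by (auto intro!: derivative_eq_intros)
  then show ?thesis unfolding plane_norm_def
    proof (rule DERIV_cong)
    have "(2 * A + 2 * B) * (inverse c / 2) = (A + B) / c" for A B c :: real
      by (simp add: divide_inverse[of _ c] algebra_simps)
    from this[of "u t * u'" "v t * v'"]
    show "(2 * u t * u' + 2 * v t * v') * (inverse (sqrt ((u t)\<^sup>2 + (v t)\<^sup>2)) / 2) =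
      (u t * u' + v t * v') / sqrt ((u t)\<^sup>2 + (v t)\<^sup>2)" by (simp only: mult.assoc)
  qed
qed

text \<open>At \<open>0\<close> and \<open>pi\<close> the slope \<open>\<gamma>'\<close> is
  one-sided, taken from inside \<open>{0..pi}\<close>, so kinks of the even extension are allowed
  there. For negative angles \<open>deriv_neg\<close> ties \<open>\<gamma>'\<close> to that
  extension.\<close>

locale surface_energy =
  fixes \<gamma> \<gamma>' :: "real \<Rightarrow> real"
  assumes even: "\<And>\<theta>. \<theta> \<in> {0..pi} \<Longrightarrow> \<gamma> \<theta> = \<gamma> (- \<theta>)"
    and deriv: "\<And>\<theta>. \<theta> \<in> {0..pi} \<Longrightarrow> (\<gamma> has_real_derivative \<gamma>' \<theta>) (at \<theta> within {0..pi})"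
    and cont': "continuous_on {0..pi} \<gamma>'"
    and deriv_neg: "\<And>\<theta>. \<theta> \<in> {-pi<..<0} \<Longrightarrow> (\<gamma> has_real_derivative \<gamma>' \<theta>) (at \<theta>)"
begin

lemma deriv_odd:
  assumes "\<theta> \<in> {-pi<..<0}"
  shows "\<gamma>' \<theta> = - \<gamma>' (- \<theta>)"
proof -
  have "(\<gamma> has_real_derivative \<gamma>' (- \<theta>)) (at (- \<theta>) within {0<..<pi})"
    by (rule DERIV_subset[OF deriv]) (use assms in auto)
  then have "(\<gamma> has_real_derivative \<gamma>' (- \<theta>)) (at (- \<theta>))"
    using assms by (simp add: at_within_open[OF _ open_greaterThanLessThan])
  then have "((\<lambda>x. \<gamma> (- x)) has_real_derivative \<gamma>' (- \<theta>) * - 1) (at \<theta>)"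
    by (intro DERIV_chain2[where f = \<gamma>]) (auto intro!: derivative_eq_intros)
  then have "(\<gamma> has_real_derivative \<gamma>' (- \<theta>) * - 1) (at \<theta>)"
  proof (rule has_field_derivative_transform_within_open)
    show "open {-pi<..<0::real}" by simp
    show "\<gamma> (- x) = \<gamma> x" if "x \<in> {-pi<..<0}" for x using even[of "- x"] that by auto
  qed fact
  then show ?thesis using DERIV_unique[OF deriv_neg[OF assms]] by simp
qed

lemma cont: "continuous_on {0..pi} \<gamma>"
  using deriv by (meson DERIV_continuous continuous_on_eq_continuous_within)

lemma energy_plane_angle:
  assumes "a \<noteq> 0 \<or> b \<noteq> 0"
  shows "\<gamma> (plane_angle a b) = \<gamma> (arccos (a / plane_norm a b))"
proof -
  have "\<gamma> (plane_angle a b) = \<gamma> \<bar>plane_angle a b\<bar>"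
    using even[of "- plane_angle a b"] plane_angle_bounds[of a b] by (auto simp: abs_if)
  then show ?thesis using abs_plane_angle[OF assms] by simp
qed

lemma deriv_plane_angle:
  assumes "a \<noteq> 0 \<or> b \<noteq> 0"
  shows "\<gamma>' (plane_angle a b) = (if b < 0 then - 1 else 1) * \<gamma>' (arccos (a / plane_norm a b))"
proof (cases "b < 0")
  case True
  then have "\<gamma>' (plane_angle a b) = - \<gamma>' \<bar>plane_angle a b\<bar>"
    using deriv_odd[of "plane_angle a b"] plane_angle_bounds[of a b] plane_angle_neg_iff[of a b] by (simp add: abs_if)
  then show ?thesis using True abs_plane_angle[OF assms] by simp
next
  case False
  then have "\<gamma>' (plane_angle a b) = \<gamma>' \<bar>plane_angle a b\<bar>"
    using plane_angle_neg_iff[of a b] by simp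
  then show ?thesis using False abs_plane_angle[OF assms] by simp
qed

lemma bounded_energy: "\<exists>\<Gamma>\<ge>0. \<forall>a b. \<bar>\<gamma> (plane_angle a b)\<bar> \<le> \<Gamma> \<and> \<bar>\<gamma>' (plane_angle a b)\<bar> \<le> \<Gamma>"
proof -
  obtain A where A: "\<And>x. x \<in> {0..pi} \<Longrightarrow> \<bar>\<gamma> x\<bar> \<le> A"
    using compact_imp_bounded[OF compact_continuous_image[OF cont]] unfolding bounded_iff
    by (metis compact_Icc imageI real_norm_def)
  obtain B where B: "\<And>x. x \<in> {0..pi} \<Longrightarrow> \<bar>\<gamma>' x\<bar> \<le> B"
    using compact_imp_bounded[OF compact_continuous_image[OF cont']] unfolding bounded_iff
    by (metis compact_Icc imageI real_norm_def)
  \<comment> \<open>\<open>Arg 0\<close> is 0 by convention, so the bound also covers the zero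
    vector, where the \<open>arccos\<close> formula would give \<open>pi / 2\<close>.\<close>
  have zero: "plane_angle 0 0 = 0" using Arg_zero by (simp add: plane_angle_def Complex_eq)
  have arc: "arccos (a / plane_norm a b) \<in> {0..pi}" for a b
    using divide_plane_norm_bounds[of a b] arccos_lbound arccos_ubound by auto
  have "\<bar>\<gamma> (plane_angle a b)\<bar> \<le> max A B \<and> \<bar>\<gamma>' (plane_angle a b)\<bar> \<le> max A B" for a b
  proof (cases "a \<noteq> 0 \<or> b \<noteq> 0")
    case True
    then show ?thesis using A[OF arc[of a b]] B[OF arc[of a b]]
      by (auto simp: energy_plane_angle deriv_plane_angle abs_mult)
  next
    case False
    then show ?thesis using A[of 0] B[of 0] zero by (auto simp: less_imp_le)
  qed
  moreover have "max A B \<ge> 0" using A[of 0] by force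
  ultimately show ?thesis by blast
qed

lemma borel_measurable_energy:
  assumes [measurable]: "f \<in> borel_measurable M" "g \<in> borel_measurable M"
  shows "(\<lambda>x. \<gamma> (plane_angle (f x) (g x))) \<in> borel_measurable M"
    and "(\<lambda>x. \<gamma>' (plane_angle (f x) (g x))) \<in> borel_measurable M"
proof -
  \<comment> \<open>\<open>h\<close> is continuous on \<open>{0..pi}\<close> only, and
    \<open>arccos\<close> on \<open>{-1..1}\<close> only. Clamping the argument yields a Borel
    function on the whole line, and the clamps are inactive at the values that occur.\<close>
  have clamp: "(\<lambda>x. h (max 0 (min pi x))) \<in> borel_measurable borel" if "continuous_on {0..pi} h" for h :: "real \<Rightarrow> real"
    by (rule borel_measurable_continuous_onI, rule continuous_on_compose2[OF that])
       (auto intro!: continuous_intros)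
  have arc: "(\<lambda>x. arccos (max (-1) (min 1 x))) \<in> borel_measurable borel"
    by (rule borel_measurable_continuous_onI, rule continuous_on_arccos)
       (auto intro!: continuous_intros)
  define al where "al x = arccos (max (-1) (min 1 (f x / plane_norm (f x) (g x))))" for x
  have [measurable]: "al \<in> borel_measurable M"
    unfolding al_def by (rule measurable_compose[OF _ arc]) (simp add: plane_norm_def)
  have al: "al x = arccos (f x / plane_norm (f x) (g x))" for x
    unfolding al_def using divide_plane_norm_bounds[of "f x" "g x"] by (simp add: min_def max_def)
  have alb: "max 0 (min pi (al x)) = al x" for x
    using arccos_lbound[OF divide_plane_norm_bounds[of "f x" "g x"]]
      arccos_ubound[OF divide_plane_norm_bounds[of "f x" "g x"]] unfolding al by simp
  have zero: "plane_angle 0 0 = 0" using Arg_zero by (simp add: plane_angle_def Complex_eq)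
  have [measurable]: "(\<lambda>x. \<gamma> (al x)) \<in> borel_measurable M" "(\<lambda>x. \<gamma>' (al x)) \<in> borel_measurable M"
    using measurable_compose[OF _ clamp[OF cont], of al M] measurable_compose[OF _ clamp[OF cont'], of al M]
    unfolding alb by auto
  have 1: "\<gamma> (plane_angle (f x) (g x)) = (if f x = 0 \<and> g x = 0 then \<gamma> 0 else \<gamma> (al x))" for x
    using energy_plane_angle[of "f x" "g x"] zero unfolding al by auto
  show "(\<lambda>x. \<gamma> (plane_angle (f x) (g x))) \<in> borel_measurable M" unfolding 1 by measurable
  have 2: "\<gamma>' (plane_angle (f x) (g x)) =
      (if f x = 0 \<and> g x = 0 then \<gamma>' 0 else (if g x < 0 then - 1 else 1) * \<gamma>' (al x))" for x
    using deriv_plane_angle[of "f x" "g x"] zero unfolding al by auto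
  show "(\<lambda>x. \<gamma>' (plane_angle (f x) (g x))) \<in> borel_measurable M" unfolding 2 by measurable
qed

text \<open>The kinks of the even extension of \<open>\<gamma>\<close> at \<open>0\<close> and \<open>\<pi>\<close> are why the curve \<open>(u, v)\<close> must
  not cross the first axis transversally.\<close>

lemma energy_has_real_derivative:
  assumes u: "(u has_real_derivative u') (at t within T)"
    and v: "(v has_real_derivative v') (at t within T)"
    and nz: "u t \<noteq> 0 \<or> v t \<noteq> 0"
    and tangential: "v t = 0 \<Longrightarrow> v' = 0"
  shows "((\<lambda>s. \<gamma> (plane_angle (u s) (v s)) * plane_norm (u s) (v s)) has_real_derivative
      (\<gamma> (plane_angle (u t) (v t)) * (u t * u' + v t * v')
       + \<gamma>' (plane_angle (u t) (v t)) * (u t * v' - v t * u')) / plane_norm (u t) (v t)) (at t within T)"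
proof -
  define w where "w s = plane_norm (u s) (v s)" for s
  define al where "al s = arccos (u s / w s)" for s
  have w0: "w t \<noteq> 0" using nz unfolding w_def by auto
  then have wpos: "w t > 0" using plane_norm_nonneg[of "u t" "v t"] unfolding w_def by linarith
  have w: "(w has_real_derivative (u t * u' + v t * v') / w t) (at t within T)"
    unfolding w_def by (rule plane_norm_has_real_derivative) fact+
  have bnd: "- 1 \<le> u s / w s" "u s / w s \<le> 1" for s unfolding w_def by (rule divide_plane_norm_bounds)+
  have al_in: "al s \<in> {0..pi}" for s unfolding al_def using arccos_lbound arccos_ubound bnd by auto
  have eq: "\<gamma> (plane_angle (u s) (v s)) * plane_norm (u s) (v s) = \<gamma> (al s) * w s" for s
    using energy_plane_angle[of "u s" "v s"] unfolding al_def w_def by (cases "u s = 0 \<and> v s = 0") auto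
  have cosine: "((\<lambda>s. u s / w s) has_real_derivative
      (u' * w t - u t * ((u t * u' + v t * v') / w t)) / (w t * w t)) (at t within T)"
    by (rule DERIV_divide) fact+
  \<comment> \<open>\<open>al\<close> is the absolute value of the angle, hence the sign factor. At
    \<open>v t = 0\<close> the sign does not matter, as \<open>v' = 0\<close> makes the remaining
    factor vanish.\<close>
  have al: "(al has_real_derivative (if v t < 0 then - 1 else 1) * (u t * v' - v t * u') / (w t)\<^sup>2) (at t within T)"
  proof (cases "v t = 0")
    case False
    have sq: "sqrt (1 - (u t / w t)\<^sup>2) = \<bar>v t\<bar> / w t"
      unfolding w_def by (rule sqrt_one_minus_cosine[OF nz])
    have "1 - (u t / w t)\<^sup>2 \<noteq> 0"
    proof
      assume "1 - (u t / w t)\<^sup>2 = 0"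
      then show False using sq False w0 by simp
    qed
    then have "u t / w t \<noteq> 1" "u t / w t \<noteq> - 1" by auto
    with bnd[of t] have "- 1 < u t / w t" "u t / w t < 1" by linarith+
    then have "(arccos has_real_derivative inverse (- sqrt (1 - (u t / w t)\<^sup>2))) (at (u t / w t))"
      by (rule DERIV_arccos)
    from DERIV_chain2[OF this cosine]
    have "(al has_real_derivative inverse (- (\<bar>v t\<bar> / w t)) *
      ((u' * w t - u t * ((u t * u' + v t * v') / w t)) / (w t * w t))) (at t within T)"
      unfolding sq al_def .
    moreover have "(u' * w t - u t * ((u t * u' + v t * v') / w t)) / (w t * w t)
        = v t * (v t * u' - u t * v') / (w t)^3"
    proof -
      have "u' * w t - u t * ((u t * u' + v t * v') / w t) = (u' * (w t)\<^sup>2 - u t * (u t * u' + v t * v')) / w t"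
        using w0 by (simp add: field_simps power2_eq_square)
      also have "u' * (w t)\<^sup>2 - u t * (u t * u' + v t * v') = v t * (v t * u' - u t * v')"
        unfolding w_def plane_norm_power2 by (simp add: algebra_simps power2_eq_square)
      finally show ?thesis using w0 by (simp add: field_simps power3_eq_cube)
    qed
    moreover have "inverse (- (\<bar>v t\<bar> / w t)) * (v t * (v t * u' - u t * v') / (w t)^3)
        = (if v t < 0 then - 1 else 1) * (u t * v' - v t * u') / (w t)\<^sup>2"
      using False w0 by (auto simp: field_simps power3_eq_cube power2_eq_square)
    ultimately show ?thesis by (simp only:)
  next
    \<comment> \<open>\<open>arccos\<close> is not differentiable at \<open>1\<close> and
      \<open>-1\<close>. Near such a point the angle is expressed by \<open>arcsin\<close> of the
      sine, which is smooth at 0, and the sine \<open>\<bar>v s\<bar> / w s\<close> has derivative 0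
      because \<open>v\<close> vanishes to first order.\<close>
    case True
    then have "v' = 0" using tangential by simp
    have u0: "u t \<noteq> 0" using nz True by simp
    have "((\<lambda>s. \<bar>v s\<bar>) has_real_derivative 0) (at t within T)"
      using has_real_derivative_abs_zero v True \<open>v' = 0\<close> by simp
    from DERIV_divide[OF this w w0]
    have sine: "((\<lambda>s. \<bar>v s\<bar> / w s) has_real_derivative 0) (at t within T)" using True by simp
    have "(arcsin has_real_derivative inverse (sqrt (1 - (\<bar>v t\<bar> / w t)\<^sup>2))) (at (\<bar>v t\<bar> / w t))"
      by (rule DERIV_arcsin) (use True in auto)
    from DERIV_chain2[OF this sine]
    have arc: "((\<lambda>s. arcsin (\<bar>v s\<bar> / w s)) has_real_derivative 0) (at t within T)" by simp
    have sq: "sqrt (1 - (u s / w s)\<^sup>2) = \<bar>v s\<bar> / w s" if "u s \<noteq> 0" for s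
      unfolding w_def by (rule sqrt_one_minus_cosine) (use that in simp)
    have ucont: "(u \<longlongrightarrow> u t) (at t within T)"
      using DERIV_continuous[OF u] by (simp add: continuous_within)
    have "(al has_real_derivative 0) (at t within T)"
    proof (cases "u t > 0")
      case True
      have "\<forall>\<^sub>F s in at t within T. u s > 0" using ucont True by (rule order_tendstoD)
      then have "\<forall>\<^sub>F s in at t within T. arcsin (\<bar>v s\<bar> / w s) = al s"
      proof eventually_elim
        fix s assume "u s > 0"
        then show "arcsin (\<bar>v s\<bar> / w s) = al s"
          unfolding al_def using arccos_arcsin_sqrt_pos[of "u s / w s"] bnd[of s] sq[of s]
          by (simp add: w_def)
      qed
      moreover have "arcsin (\<bar>v t\<bar> / w t) = al t"
        unfolding al_def using arccos_arcsin_sqrt_pos[of "u t / w t"] bnd[of t] sq[of t] True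
        by (simp add: w_def)
      ultimately show ?thesis
        using has_field_derivative_cong_eventually[of "\<lambda>s. arcsin (\<bar>v s\<bar> / w s)" al t T 0] arc by blast
    next
      case False
      then have "u t < 0" using u0 by simp
      have "\<forall>\<^sub>F s in at t within T. u s < 0" using ucont \<open>u t < 0\<close> by (rule order_tendstoD)
      then have "\<forall>\<^sub>F s in at t within T. pi - arcsin (\<bar>v s\<bar> / w s) = al s"
      proof eventually_elim
        fix s assume "u s < 0"
        then show "pi - arcsin (\<bar>v s\<bar> / w s) = al s"
          unfolding al_def using arccos_arcsin_sqrt_neg[of "u s / w s"] bnd[of s] sq[of s]
          by (simp add: w_def divide_nonpos_nonneg)
      qed
      moreover have "pi - arcsin (\<bar>v t\<bar> / w t) = al t"
        unfolding al_def using arccos_arcsin_sqrt_neg[of "u t / w t"] bnd[of t] sq[of t] \<open>u t < 0\<close>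
        by (simp add: w_def divide_nonpos_nonneg)
      moreover have "((\<lambda>s. pi - arcsin (\<bar>v s\<bar> / w s)) has_real_derivative 0) (at t within T)"
        using DERIV_diff[OF DERIV_const[of pi] arc] by simp
      ultimately show ?thesis
        using has_field_derivative_cong_eventually[of "\<lambda>s. pi - arcsin (\<bar>v s\<bar> / w s)" al t T 0] by blast
    qed
    then show ?thesis using True \<open>v' = 0\<close> by simp
  qed
  \<comment> \<open>Only one-sided derivatives exist at \<open>0\<close> and \<open>pi\<close>, so
    the chain rule is used within the image of \<open>al\<close>, which stays in
    \<open>{0..pi}\<close>.\<close>
  have "(\<gamma> has_real_derivative \<gamma>' (al t)) (at (al t) within al ` T)"
    by (rule DERIV_subset[OF deriv]) (use al_in in auto)
  from DERIV_image_chain[OF this al]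
  have "((\<lambda>s. \<gamma> (al s)) has_real_derivative
      \<gamma>' (al t) * ((if v t < 0 then - 1 else 1) * (u t * v' - v t * u') / (w t)\<^sup>2)) (at t within T)"
    by (simp add: o_def)
  from DERIV_mult[OF this w]
  show ?thesis unfolding eq
  proof (rule DERIV_cong)
    have "\<gamma> (plane_angle (u t) (v t)) = \<gamma> (al t)"
      "\<gamma>' (plane_angle (u t) (v t)) = (if v t < 0 then - 1 else 1) * \<gamma>' (al t)"
      using energy_plane_angle[OF nz] deriv_plane_angle[OF nz] unfolding al_def w_def by auto
    then show "\<gamma>' (al t) * ((if v t < 0 then - 1 else 1) * (u t * v' - v t * u') / (w t)\<^sup>2) * w t
        + (u t * u' + v t * v') / w t * \<gamma> (al t) =
      (\<gamma> (plane_angle (u t) (v t)) * (u t * u' + v t * v') +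
       \<gamma>' (plane_angle (u t) (v t)) * (u t * v' - v t * u')) / plane_norm (u t) (v t)"
      using w0 unfolding w_def[symmetric] by (auto simp: field_simps power2_eq_square)
  qed
qed

text \<open>Unlike differentiability, continuity persists when the vector crosses the first axis,
  since \<open>arccos\<close> of the cosine is continuous there.\<close>

lemma continuous_on_energy:
  assumes "continuous_on T u" "continuous_on T v" and nz: "\<And>t. t \<in> T \<Longrightarrow> u t \<noteq> 0 \<or> v t \<noteq> 0"
  shows "continuous_on T (\<lambda>s. \<gamma> (plane_angle (u s) (v s)))"
proof -
  have "continuous_on T (\<lambda>s. \<gamma> (arccos (u s / plane_norm (u s) (v s))))"
  proof (rule continuous_on_compose2[OF cont])
    have "continuous_on T (\<lambda>s. u s / plane_norm (u s) (v s))"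
      unfolding plane_norm_def using assms(1,2) nz
      by (intro continuous_intros) (auto simp: sum_power2_eq_zero_iff)
    then show "continuous_on T (\<lambda>s. arccos (u s / plane_norm (u s) (v s)))"
      by (rule continuous_on_arccos) (use divide_plane_norm_bounds in auto)
    show "(\<lambda>s. arccos (u s / plane_norm (u s) (v s))) ` T \<subseteq> {0..pi}"
      using divide_plane_norm_bounds arccos_lbound arccos_ubound by auto
  qed
  then show ?thesis
    by (rule continuous_on_cong[OF refl, THEN iffD1, rotated]) (rule energy_plane_angle[OF nz, symmetric])
qed

end


section \<open>Absolutely continuous functions on the unit interval\<close>

text \<open>Moving the upper limit from the domain into the integrand keeps the measure space fixed,
  as Fubini and dominated convergence require.\<close>

lemma integral_up_to:
  fixes f :: "real \<Rightarrow> real"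
  assumes "b \<in> {0..1}"
  shows "(LINT y|lebesgue_on {0..b}. f y) = (LINT y|leb_I. (if y \<le> b then f y else 0))"
proof -
  have "(LINT y|lebesgue_on {0..b}. f y) = (LINT y|leb_I. (if y \<in> {0..b} then f y else 0))"
    using assms by (intro Lebesgue_Measure.integral_restrict[symmetric]) auto
  also have "\<dots> = (LINT y|leb_I. (if y \<le> b then f y else 0))"
    by (rule Bochner_Integration.integral_cong) auto
  finally show ?thesis .
qed

lemma integrable_up_to:
  fixes f :: "real \<Rightarrow> real"
  assumes "integrable leb_I f" "b \<in> {0..1}"
  shows "integrable leb_I (\<lambda>y. if y \<le> b then f y else 0)"
proof (rule Bochner_Integration.integrable_bound[OF assms(1)])
    have [measurable]: "f \<in> borel_measurable leb_I" using assms(1) by auto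
    have [measurable]: "(\<lambda>y. y) \<in> borel_measurable leb_I" using id_borel_measurable_lebesgue_on[of "{0..1}"] by (simp add: id_def)
    show "(\<lambda>y. if y \<le> b then f y else 0) \<in> borel_measurable leb_I" by measurable
qed auto

lemma abs_cont_eq:
  assumes "abs_cont u" "b \<in> {0..1}"
  shows "u b = u 0 + (LINT y|leb_I. (if y \<le> b then Dr u y else 0))"
  using assms integral_up_to[of b "Dr u"] unfolding abs_cont_def by metis

lemma abs_cont_integrable: "abs_cont u \<Longrightarrow> integrable leb_I (Dr u)"
  by (simp add: abs_cont_def)

interpretation leb_I: finite_measure leb_I
  by (rule finite_measure_lebesgue_on) simp

interpretation leb_II: pair_sigma_finite leb_I leb_I ..

lemma measure_leb_I [simp]: "measure leb_I {0..1} = 1"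
  by (subst measure_restrict_space) auto

lemma measurable_leb_I_id [measurable]: "(\<lambda>y. y) \<in> borel_measurable leb_I"
  using id_borel_measurable_lebesgue_on[of "{0..1}"] by (simp add: id_def)

lemma AE_leb_I_neq: "AE y in leb_I. y \<noteq> (a::real)"
proof -
  have "AE y in lebesgue. y \<noteq> a"
    using AE_lborel_singleton[of a] by (intro AE_completion) simp
  then have "AE y in lebesgue. y \<in> {0..1} \<longrightarrow> y \<noteq> a" by eventually_elim simp
  then show ?thesis by (subst AE_restrict_space_iff) auto
qed

text \<open>By Fubini on the two triangles \<open>s \<le> t\<close> and \<open>t < s\<close>.\<close>

lemma integral_product_rule:
  fixes f g F G :: "real \<Rightarrow> real"
  assumes f: "integrable leb_I f" and g: "integrable leb_I g"
    and F: "\<And>b. b \<in> {0..1} \<Longrightarrow> F b = F 0 + (LINT y|leb_I. (if y \<le> b then f y else 0))"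
    and G: "\<And>b. b \<in> {0..1} \<Longrightarrow> G b = G 0 + (LINT y|leb_I. (if y \<le> b then g y else 0))"
  shows "integrable leb_I (\<lambda>y. f y * G y + F y * g y)"
    and "F 1 * G 1 = F 0 * G 0 + (LINT y|leb_I. f y * G y + F y * g y)"
proof -
  have [measurable]: "f \<in> borel_measurable leb_I" "g \<in> borel_measurable leb_I" using f g by auto
  have prod: "integrable (leb_I \<Otimes>\<^sub>M leb_I) (\<lambda>(s, t). f s * g t)"
  proof (rule leb_II.Fubini_integrable)
    show "integrable leb_I (\<lambda>s. LINT t|leb_I. norm (case (s, t) of (s, t) \<Rightarrow> f s * g t))"
      using f by (simp add: abs_mult)
  qed (use g in auto)
  have low: "integrable (leb_I \<Otimes>\<^sub>M leb_I) (\<lambda>(s, t). if s \<le> t then f s * g t else 0)"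
    by (rule Bochner_Integration.integrable_bound[OF prod]) auto
  have up: "integrable (leb_I \<Otimes>\<^sub>M leb_I) (\<lambda>(s, t). if t < s then f s * g t else 0)"
    by (rule Bochner_Integration.integrable_bound[OF prod]) auto
  have Ft: "(LINT s|leb_I. (if s \<le> t then f s * g t else 0)) = (F t - F 0) * g t" if "t \<in> {0..1}" for t
  proof -
    have "(LINT s|leb_I. (if s \<le> t then f s * g t else 0)) = (LINT s|leb_I. (if s \<le> t then f s else 0) * g t)"
      by (rule Bochner_Integration.integral_cong) auto
    also have "\<dots> = (LINT s|leb_I. (if s \<le> t then f s else 0)) * g t" by simp
    finally show ?thesis using F[OF that] by simp
  qed
  have Gs: "(LINT t|leb_I. (if t < s then f s * g t else 0)) = f s * (G s - G 0)" if "s \<in> {0..1}" for s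
  proof -
    have "(LINT t|leb_I. (if t < s then f s * g t else 0)) = (LINT t|leb_I. f s * (if t \<le> s then g t else 0))"
    proof (rule integral_cong_AE)
      show "AE t in leb_I. (if t < s then f s * g t else 0) = f s * (if t \<le> s then g t else 0)"
        using AE_leb_I_neq[of s] by eventually_elim auto
    qed auto
    also have "\<dots> = f s * (LINT t|leb_I. (if t \<le> s then g t else 0))" by simp
    finally show ?thesis using G[OF that] by simp
  qed
  have i1: "integrable leb_I (\<lambda>t. (F t - F 0) * g t)"
    using leb_II.integrable_snd[OF low] Ft
    by (subst Bochner_Integration.integrable_cong[OF refl, of _ _ "\<lambda>t. LINT s|leb_I. (if s \<le> t then f s * g t else 0)"]) auto
  have i2: "integrable leb_I (\<lambda>s. f s * (G s - G 0))"
    using leb_II.integrable_fst[OF up] Gs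
    by (subst Bochner_Integration.integrable_cong[OF refl, of _ _ "\<lambda>s. LINT t|leb_I. (if t < s then f s * g t else 0)"]) auto
  have "(LINT t|leb_I. (F t - F 0) * g t) + (LINT s|leb_I. f s * (G s - G 0))
      = (LINT t|leb_I. LINT s|leb_I. (if s \<le> t then f s * g t else 0))
        + (LINT s|leb_I. LINT t|leb_I. (if t < s then f s * g t else 0))"
    using Ft Gs by (intro arg_cong2[where f = "(+)"] Bochner_Integration.integral_cong) auto
  also have "\<dots> = (LINT p|(leb_I \<Otimes>\<^sub>M leb_I). (case p of (s, t) \<Rightarrow> if s \<le> t then f s * g t else 0))
        + (LINT p|(leb_I \<Otimes>\<^sub>M leb_I). (case p of (s, t) \<Rightarrow> if t < s then f s * g t else 0))"
    using leb_II.integral_snd[OF low] leb_II.integral_fst[OF up] by simp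
  also have "\<dots> = (LINT p|(leb_I \<Otimes>\<^sub>M leb_I). (case p of (s, t) \<Rightarrow> f s * g t))"
    by (subst Bochner_Integration.integral_add[OF low up, symmetric])
       (auto intro!: Bochner_Integration.integral_cong)
  also have "\<dots> = (LINT s|leb_I. LINT t|leb_I. f s * g t)"
    by (rule leb_II.integral_fst[OF prod, symmetric])
  also have "\<dots> = (LINT s|leb_I. f s) * (LINT t|leb_I. g t)" by simp
  also have "(LINT s|leb_I. f s) = F 1 - F 0"
    using F[of 1] by (auto intro!: Bochner_Integration.integral_cong)
  also have "(LINT s|leb_I. g s) = G 1 - G 0"
    using G[of 1] by (auto intro!: Bochner_Integration.integral_cong)
  finally have eq: "(LINT t|leb_I. (F t - F 0) * g t) + (LINT s|leb_I. f s * (G s - G 0))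
    = (F 1 - F 0) * (G 1 - G 0)" .
  have dec: "f y * G y + F y * g y = (F y - F 0) * g y + f y * (G y - G 0) + (F 0 * g y + G 0 * f y)" for y
    by (simp add: algebra_simps)
  show "integrable leb_I (\<lambda>y. f y * G y + F y * g y)" unfolding dec using i1 i2 f g by auto
  have "(LINT y|leb_I. f y * G y + F y * g y) = (F 1 - F 0) * (G 1 - G 0)
      + (F 0 * (LINT y|leb_I. g y) + G 0 * (LINT y|leb_I. f y))"
    unfolding dec eq[symmetric] using i1 i2 f g by simp
  also have "(LINT y|leb_I. f y) = F 1 - F 0"
    using F[of 1] by (auto intro!: Bochner_Integration.integral_cong)
  also have "(LINT s|leb_I. g s) = G 1 - G 0"
    using G[of 1] by (auto intro!: Bochner_Integration.integral_cong)
  finally show "F 1 * G 1 = F 0 * G 0 + (LINT y|leb_I. f y * G y + F y * g y)"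
    by (simp add: algebra_simps)
qed

text \<open>The rule on the whole interval is applied to \<open>F\<close> and \<open>G\<close>
  frozen beyond \<open>b\<close>, whose densities are cut off there.\<close>

lemma integral_product_rule_up_to:
  fixes f g F G :: "real \<Rightarrow> real"
  assumes f: "integrable leb_I f" and g: "integrable leb_I g"
    and F: "\<And>b. b \<in> {0..1} \<Longrightarrow> F b = F 0 + (LINT y|leb_I. (if y \<le> b then f y else 0))"
    and G: "\<And>b. b \<in> {0..1} \<Longrightarrow> G b = G 0 + (LINT y|leb_I. (if y \<le> b then g y else 0))"
    and b: "b \<in> {0..1}"
  shows "F b * G b = F 0 * G 0 + (LINT y|leb_I. (if y \<le> b then f y * G y + F y * g y else 0))"
proof -
  define cut where "cut u y = (if y \<le> b then u y else 0)" for u :: "real \<Rightarrow> real" and y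
  have eq: "(LINT y|leb_I. (if y \<le> d then cut u y else 0)) = (LINT y|leb_I. (if y \<le> min b d then u y else 0))" for d u
    unfolding cut_def by (rule Bochner_Integration.integral_cong) auto
  have b0: "min b 0 = 0" using b by simp
  have FF: "F (min b d) = F (min b 0) + (LINT y|leb_I. (if y \<le> d then cut f y else 0))" if "d \<in> {0..1}" for d
    unfolding eq b0 by (rule F, use that b in \<open>simp add: min_def\<close>)
  have GG: "G (min b d) = G (min b 0) + (LINT y|leb_I. (if y \<le> d then cut g y else 0))" if "d \<in> {0..1}" for d
    unfolding eq b0 by (rule G, use that b in \<open>simp add: min_def\<close>)
  have If: "integrable leb_I (cut f)" "integrable leb_I (cut g)"
    unfolding cut_def by (rule integrable_up_to[OF f b], rule integrable_up_to[OF g b])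
  have "F (min b 1) * G (min b 1) = F (min b 0) * G (min b 0)
      + (LINT y|leb_I. cut f y * G (min b y) + F (min b y) * cut g y)"
    by (rule integral_product_rule(2)[where F = "\<lambda>d. F (min b d)" and G = "\<lambda>d. G (min b d)", OF If FF GG])
  moreover have "(LINT y|leb_I. cut f y * G (min b y) + F (min b y) * cut g y)
      = (LINT y|leb_I. (if y \<le> b then f y * G y + F y * g y else 0))"
    unfolding cut_def by (rule Bochner_Integration.integral_cong) (auto simp: min_def)
  moreover have "min b 1 = b" using b by simp
  ultimately show ?thesis unfolding b0 by metis
qed

text \<open>Because the product rule speaks of indefinite integrals of arbitrary densities, it
  applies again to \<open>u * v\<close> without identifying \<open>Dr\<close> of a product.\<close>

lemma integral_product_rule3:
  assumes "abs_cont u" "abs_cont v" "abs_cont w"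
  shows "integrable leb_I (\<lambda>y. (Dr u y * v y + u y * Dr v y) * w y + u y * v y * Dr w y)"
    and "(LINT y|leb_I. (Dr u y * v y + u y * Dr v y) * w y + u y * v y * Dr w y)
      = u 1 * v 1 * w 1 - u 0 * v 0 * w 0"
proof -
  note I = abs_cont_integrable[OF assms(1)] abs_cont_integrable[OF assms(2)] abs_cont_integrable[OF assms(3)]
  note E = abs_cont_eq[OF assms(1)] abs_cont_eq[OF assms(2)] abs_cont_eq[OF assms(3)]
  note uv = integral_product_rule(1)[OF I(1,2) E(1,2)] integral_product_rule_up_to[OF I(1,2) E(1,2)]
  show "integrable leb_I (\<lambda>y. (Dr u y * v y + u y * Dr v y) * w y + u y * v y * Dr w y)"
    by (rule integral_product_rule(1)[where F = "\<lambda>y. u y * v y", OF uv(1) I(3) uv(2) E(3)])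
  have "u 1 * v 1 * w 1 = u 0 * v 0 * w 0
      + (LINT y|leb_I. (Dr u y * v y + u y * Dr v y) * w y + u y * v y * Dr w y)"
    by (rule integral_product_rule(2)[where F = "\<lambda>y. u y * v y", OF uv(1) I(3) uv(2) E(3)])
  then show "(LINT y|leb_I. (Dr u y * v y + u y * Dr v y) * w y + u y * v y * Dr w y)
      = u 1 * v 1 * w 1 - u 0 * v 0 * w 0" by linarith
qed


lemma leb_I_integral_mono_up_to:
  fixes f :: "real \<Rightarrow> real"
  assumes f: "integrable leb_I f" and nonneg: "\<And>y. 0 \<le> f y" and "d \<in> {0..1}" "b \<in> {0..1}" "b \<le> d"
  shows "(LINT y|leb_I. (if y \<le> b then f y else 0)) \<le> (LINT y|leb_I. (if y \<le> d then f y else 0))"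
  by (rule integral_mono) (use assms in \<open>auto intro: integrable_up_to\<close>)

lemma abs_cont_diff_le:
  assumes "abs_cont u" "b \<in> {0..1}" "d \<in> {0..1}" "b \<le> d"
  shows "\<bar>u b - u 0\<bar> \<le> (LINT y|leb_I. (if y \<le> d then \<bar>Dr u y\<bar> else 0))"
proof -
  have I: "integrable leb_I (\<lambda>y. \<bar>Dr u y\<bar>)" using abs_cont_integrable[OF assms(1)] by simp
  have "u b - u 0 = (LINT y|leb_I. (if y \<le> b then Dr u y else 0))"
    using abs_cont_eq[OF assms(1,2)] by linarith
  then have "\<bar>u b - u 0\<bar> \<le> (LINT y|leb_I. \<bar>if y \<le> b then Dr u y else 0\<bar>)"
    using integral_abs_bound[of leb_I "\<lambda>y. if y \<le> b then Dr u y else 0"] by metis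
  also have "\<dots> = (LINT y|leb_I. (if y \<le> b then \<bar>Dr u y\<bar> else 0))"
    by (rule Bochner_Integration.integral_cong) auto
  also have "\<dots> \<le> (LINT y|leb_I. (if y \<le> d then \<bar>Dr u y\<bar> else 0))"
    by (rule leb_I_integral_mono_up_to[OF I]) (use assms in auto)
  finally show ?thesis .
qed

text \<open>The one-dimensional Sobolev embedding. \<open>u b\<close> is compared with
  \<open>u y\<close> through the value at 0, which costs the integral of
  \<open>\<bar>Dr u\<bar>\<close> twice, and then \<open>y\<close> is averaged over the unit
  interval.\<close>

lemma abs_cont_bound:
  assumes u: "abs_cont u" and b: "b \<in> {0..1}" and int: "integrable leb_I u"
  shows "\<bar>u b\<bar> \<le> (LINT y|leb_I. \<bar>u y\<bar>) + 2 * (LINT y|leb_I. \<bar>Dr u y\<bar>)"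
proof -
  let ?I = "LINT y|leb_I. \<bar>Dr u y\<bar>"
  have I: "(LINT y|leb_I. (if y \<le> 1 then \<bar>Dr u y\<bar> else 0)) = ?I"
    by (rule Bochner_Integration.integral_cong) auto
  have near: "\<bar>u y - u 0\<bar> \<le> ?I" if "y \<in> {0..1}" for y
    using abs_cont_diff_le[OF u that, of 1] that unfolding I by simp
  have "\<bar>u b\<bar> = (LINT y|leb_I. \<bar>u b\<bar>)" by simp
  also have "\<dots> \<le> (LINT y|leb_I. \<bar>u y\<bar> + 2 * ?I)"
  proof (rule integral_mono)
    fix y assume "y \<in> space leb_I"
    then have "\<bar>u y - u 0\<bar> \<le> ?I" using near by simp
    then show "\<bar>u b\<bar> \<le> \<bar>u y\<bar> + 2 * ?I" using near[OF b] by linarith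
  qed (use int in auto)
  also have "\<dots> = (LINT y|leb_I. \<bar>u y\<bar>) + 2 * ?I" using int by simp
  finally show ?thesis .
qed

text \<open>Absolute continuity of the integral. The index shift keeps the widths strictly between 0
  and 1, as the cut-off functions require.\<close>

lemma integral_up_to_tendsto_0:
  fixes f :: "real \<Rightarrow> real"
  assumes f: "integrable leb_I f"
  shows "(\<lambda>n. LINT y|leb_I. (if y \<le> 1 / real (n + 2) then f y else 0)) \<longlonglongrightarrow> 0"
proof -
  have [measurable]: "f \<in> borel_measurable leb_I" using f by auto
  have "(\<lambda>n. LINT y|leb_I. (if y \<le> 1 / real (n + 2) then f y else 0)) \<longlonglongrightarrow> (LINT y|leb_I. 0)"
  proof (rule integral_dominated_convergence[where w = "\<lambda>y. \<bar>f y\<bar>"])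
    show "AE y in leb_I. (\<lambda>n. if y \<le> 1 / real (n + 2) then f y else 0) \<longlonglongrightarrow> 0"
      using AE_leb_I_neq[of 0] AE_space
    proof eventually_elim
      fix y :: real assume "y \<noteq> 0" "y \<in> space leb_I"
      then have "y > 0" by simp
      have "(\<lambda>n. 1 / real n) \<longlonglongrightarrow> 0" by (rule lim_1_over_n)
      then have "(\<lambda>n. 1 / real (n + 2)) \<longlonglongrightarrow> 0" by (rule LIMSEQ_ignore_initial_segment)
      then have "\<forall>\<^sub>F n in sequentially. 1 / real (n + 2) < y" using \<open>y > 0\<close> by (rule order_tendstoD)
      then have "\<forall>\<^sub>F n in sequentially. (if y \<le> 1 / real (n + 2) then f y else 0) = 0"
        by eventually_elim auto
      then show "(\<lambda>n. if y \<le> 1 / real (n + 2) then f y else 0) \<longlonglongrightarrow> 0"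
        by (rule tendsto_eventually)
    qed
  qed (use f in auto)
  then show ?thesis by simp
qed

section \<open>Bounded and square integrable functions on the unit interval\<close>

definition bdd :: "(real \<Rightarrow> real) \<Rightarrow> bool" where
  "bdd f \<longleftrightarrow> f \<in> borel_measurable leb_I \<and> (\<exists>K. AE y in leb_I. \<bar>f y\<bar> \<le> K)"

text \<open>Both classes are qualitative, without constants. The integrands of the weak equations
  are bounded factors times at most two square integrable ones, so their integrability can be
  derived by closure rules alone.\<close>

definition sqint :: "(real \<Rightarrow> real) \<Rightarrow> bool" where
  "sqint f \<longleftrightarrow> f \<in> borel_measurable leb_I \<and> integrable leb_I (\<lambda>y. (f y)\<^sup>2)"

lemma bddI:
  assumes "f \<in> borel_measurable leb_I" "\<And>y. y \<in> {0..1} \<Longrightarrow> \<bar>f y\<bar> \<le> K"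
  shows "bdd f"
  unfolding bdd_def using assms by (auto intro!: exI[of _ K] AE_I2)

lemma bdd_const: "bdd (\<lambda>_. c)"
  by (rule bddI[of _ "\<bar>c\<bar>"]) auto

lemma bdd_add: assumes "bdd f" "bdd g" shows "bdd (\<lambda>y. f y + g y)"
proof -
  obtain K L where "AE y in leb_I. \<bar>f y\<bar> \<le> K" "AE y in leb_I. \<bar>g y\<bar> \<le> L"
    using assms unfolding bdd_def by blast
  then have "AE y in leb_I. \<bar>f y + g y\<bar> \<le> K + L" by eventually_elim simp
  then show ?thesis using assms unfolding bdd_def by auto
qed

lemma bdd_mult: assumes "bdd f" "bdd g" shows "bdd (\<lambda>y. f y * g y)"
proof -
  obtain K L where "AE y in leb_I. \<bar>f y\<bar> \<le> K" "AE y in leb_I. \<bar>g y\<bar> \<le> L"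
    using assms unfolding bdd_def by blast
  then have "AE y in leb_I. \<bar>f y * g y\<bar> \<le> K * L"
    by eventually_elim (auto simp: abs_mult intro: mult_mono)
  then show ?thesis using assms unfolding bdd_def by auto
qed

lemma bdd_power2: "bdd f \<Longrightarrow> bdd (\<lambda>y. (f y)\<^sup>2)"
  unfolding power2_eq_square by (rule bdd_mult)

lemma sqint_const: "sqint (\<lambda>_. c)"
  by (simp add: sqint_def)

lemma integrable_mult_sqint:
  assumes "sqint f" "sqint g"
  shows "integrable leb_I (\<lambda>y. f y * g y)"
proof (rule Bochner_Integration.integrable_bound[of _ "\<lambda>y. (f y)\<^sup>2 + (g y)\<^sup>2"])
  show "AE y in leb_I. norm (f y * g y) \<le> norm ((f y)\<^sup>2 + (g y)\<^sup>2)"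
  proof (rule AE_I2)
    fix y
    have "2 * \<bar>f y * g y\<bar> \<le> (f y)\<^sup>2 + (g y)\<^sup>2"
      using sum_squares_bound[of "\<bar>f y\<bar>" "\<bar>g y\<bar>"] by (simp add: abs_mult)
    then show "norm (f y * g y) \<le> norm ((f y)\<^sup>2 + (g y)\<^sup>2)" by simp
  qed
qed (use assms in \<open>auto simp: sqint_def\<close>)

lemma integrable_sqint: "sqint f \<Longrightarrow> integrable leb_I f"
  using integrable_mult_sqint[OF _ sqint_const, of f 1] by simp

lemma sqint_add: assumes "sqint f" "sqint g" shows "sqint (\<lambda>y. f y + g y)"
  using assms integrable_mult_sqint[OF assms] unfolding sqint_def power2_sum
  by (auto intro!: Bochner_Integration.integrable_add simp: mult.assoc)

lemma integrable_bdd_mult: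
  assumes "bdd f" "integrable leb_I g"
  shows "integrable leb_I (\<lambda>y. f y * g y)"
proof -
  obtain K where K: "AE y in leb_I. \<bar>f y\<bar> \<le> K" using assms unfolding bdd_def by blast
  show ?thesis
  proof (rule Bochner_Integration.integrable_bound[of _ "\<lambda>y. K * g y"])
    show "AE y in leb_I. norm (f y * g y) \<le> norm (K * g y)"
      using K by eventually_elim (auto simp: abs_mult intro!: mult_right_mono)
  qed (use assms in \<open>auto simp: bdd_def\<close>)
qed

lemma sqint_bdd_mult: assumes "bdd f" "sqint g" shows "sqint (\<lambda>y. f y * g y)"
  using integrable_bdd_mult[OF bdd_power2[OF assms(1)], of "\<lambda>y. (g y)\<^sup>2"] assms
  unfolding sqint_def bdd_def by (auto simp: power_mult_distrib)

lemma sqint_bdd: "bdd f \<Longrightarrow> sqint f"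
  using sqint_bdd_mult[OF _ sqint_const, of f 1] by simp

text \<open>Completeness of Lebesgue measure. Derivatives of vectors and sums are known only almost
  everywhere, and this carries measurability over to them.\<close>

lemma borel_measurable_leb_I_AE:
  fixes f g :: "real \<Rightarrow> real"
  assumes f: "f \<in> borel_measurable leb_I" and eq: "AE y in leb_I. f y = g y"
  shows "g \<in> borel_measurable leb_I"
proof -
  have "AE y in lebesgue. y \<in> {0..1} \<longrightarrow> f y = g y"
    using eq by (subst (asm) AE_restrict_space_iff) auto
  then have "AE y in lebesgue. (if y \<in> {0..1} then f y else 0) = (if y \<in> {0..1} then g y else 0)"
    by eventually_elim auto
  moreover have "(\<lambda>y. if y \<in> {0..1} then f y else 0) \<in> borel_measurable lebesgue"
    using f by (subst borel_measurable_if) auto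
  ultimately have "(\<lambda>y. if y \<in> {0..1} then g y else 0) \<in> borel_measurable lebesgue"
    by (rule borel_measurable_AE[rotated])
  then show ?thesis by (rule borel_measurable_if_D)
qed

section \<open>Almost everywhere derivatives of vectors, sums and cut-off functions\<close>

lemma vector2_eq: "(v :: real^2) = v $ 1 *\<^sub>R axis 1 1 + v $ 2 *\<^sub>R axis 2 1"
  by (simp add: vec_eq_iff forall_2 axis_def)

lemma Dr_nth:
  fixes u :: "real \<Rightarrow> real^2"
  assumes "(\<lambda>\<rho>. u \<rho> $ 1) differentiable (at \<rho>)" "(\<lambda>\<rho>. u \<rho> $ 2) differentiable (at \<rho>)"
  shows "Dr u \<rho> $ 1 = Dr (\<lambda>\<rho>. u \<rho> $ 1) \<rho>" "Dr u \<rho> $ 2 = Dr (\<lambda>\<rho>. u \<rho> $ 2) \<rho>"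
proof -
  let ?a = "Dr (\<lambda>\<rho>. u \<rho> $ 1) \<rho>" and ?b = "Dr (\<lambda>\<rho>. u \<rho> $ 2) \<rho>"
  have "((\<lambda>\<rho>. u \<rho> $ 1) has_vector_derivative ?a) (at \<rho>)" "((\<lambda>\<rho>. u \<rho> $ 2) has_vector_derivative ?b) (at \<rho>)"
    using assms unfolding Dr_def by (simp_all add: vector_derivative_works[symmetric])
  then have "((\<lambda>\<rho>. u \<rho> $ 1 *\<^sub>R axis 1 1 + u \<rho> $ 2 *\<^sub>R axis 2 1 :: real^2) has_vector_derivative
      (?a *\<^sub>R axis 1 1 + ?b *\<^sub>R axis 2 1)) (at \<rho>)"
    by (auto intro!: derivative_eq_intros simp: has_real_derivative_iff_has_vector_derivative[symmetric])
  then have "(u has_vector_derivative (?a *\<^sub>R axis 1 1 + ?b *\<^sub>R axis 2 1)) (at \<rho>)"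
    unfolding vector2_eq[symmetric] by simp
  then have "Dr u \<rho> = ?a *\<^sub>R axis 1 1 + ?b *\<^sub>R axis 2 1"
    unfolding Dr_def by (rule vector_derivative_at)
  then show "Dr u \<rho> $ 1 = ?a" "Dr u \<rho> $ 2 = ?b" by (simp_all add: axis_def)
qed

lemma Dr_add_scaled:
  fixes u v :: "real \<Rightarrow> real"
  assumes "u differentiable (at \<rho>)" "v differentiable (at \<rho>)"
  shows "(\<lambda>\<rho>. u \<rho> + c * v \<rho>) differentiable (at \<rho>)" "Dr (\<lambda>\<rho>. u \<rho> + c * v \<rho>) \<rho> = Dr u \<rho> + c * Dr v \<rho>"
proof -
  have "(u has_vector_derivative Dr u \<rho>) (at \<rho>)" "(v has_vector_derivative Dr v \<rho>) (at \<rho>)"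
    using assms unfolding Dr_def by (simp_all add: vector_derivative_works[symmetric])
  then have *: "((\<lambda>\<rho>. u \<rho> + c * v \<rho>) has_vector_derivative (Dr u \<rho> + c * Dr v \<rho>)) (at \<rho>)"
    by (auto intro!: derivative_eq_intros simp: has_real_derivative_iff_has_vector_derivative[symmetric])
  show "Dr (\<lambda>\<rho>. u \<rho> + c * v \<rho>) \<rho> = Dr u \<rho> + c * Dr v \<rho>"
    unfolding Dr_def[of "\<lambda>\<rho>. u \<rho> + c * v \<rho>"] by (rule vector_derivative_at[OF *])
  show "(\<lambda>\<rho>. u \<rho> + c * v \<rho>) differentiable (at \<rho>)"
    using * by (auto simp: differentiable_def has_vector_derivative_def)
qed

lemma abs_cont_add_scaled:
  assumes u: "abs_cont u" and v: "abs_cont v"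
  shows "abs_cont (\<lambda>\<rho>. u \<rho> + c * v \<rho>)" (is "abs_cont ?s")
    and "AE \<rho> in leb_I. Dr (\<lambda>\<rho>. u \<rho> + c * v \<rho>) \<rho> = Dr u \<rho> + c * Dr v \<rho>"
proof -
  have diff: "AE \<rho> in leb_I. u differentiable (at \<rho>) \<and> v differentiable (at \<rho>)"
    using u v unfolding abs_cont_def by auto
  show D: "AE \<rho> in leb_I. Dr ?s \<rho> = Dr u \<rho> + c * Dr v \<rho>"
    using diff by eventually_elim (simp add: Dr_add_scaled)
  have I: "integrable leb_I (\<lambda>\<rho>. Dr u \<rho> + c * Dr v \<rho>)"
    using u v by (auto simp: abs_cont_integrable)
  have m: "Dr ?s \<in> borel_measurable leb_I"
    by (rule borel_measurable_leb_I_AE[of "\<lambda>\<rho>. Dr u \<rho> + c * Dr v \<rho>"]) (use I D in auto)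
  have Is: "integrable leb_I (Dr ?s)"
    using I m D by (subst Bochner_Integration.integrable_cong_AE[of _ _ "\<lambda>\<rho>. Dr u \<rho> + c * Dr v \<rho>"]) auto
  have "?s b = ?s 0 + (LINT y|lebesgue_on {0..b}. Dr ?s y)" if b: "b \<in> {0..1}" for b
  proof -
    have "(LINT y|lebesgue_on {0..b}. Dr ?s y) = (LINT y|leb_I. (if y \<le> b then Dr ?s y else 0))"
      by (rule integral_up_to[OF b])
    also have "\<dots> = (LINT y|leb_I. (if y \<le> b then Dr u y else 0) + c * (if y \<le> b then Dr v y else 0))"
    proof (rule integral_cong_AE)
      show "AE y in leb_I. (if y \<le> b then Dr ?s y else 0)
          = (if y \<le> b then Dr u y else 0) + c * (if y \<le> b then Dr v y else 0)"
        using D by eventually_elim simp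
    qed (use m abs_cont_integrable[OF u] abs_cont_integrable[OF v] in auto)
    also have "\<dots> = (LINT y|leb_I. (if y \<le> b then Dr u y else 0)) + c * (LINT y|leb_I. (if y \<le> b then Dr v y else 0))"
      using integrable_up_to[OF abs_cont_integrable[OF u] b] integrable_up_to[OF abs_cont_integrable[OF v] b]
      by simp
    also have "\<dots> = (u b - u 0) + c * (v b - v 0)"
      using abs_cont_eq[OF u b] abs_cont_eq[OF v b] by simp
    finally show ?thesis by (simp add: algebra_simps)
  qed
  moreover have "AE \<rho> in leb_I. ?s differentiable (at \<rho>)"
    using diff by eventually_elim (simp add: Dr_add_scaled)
  ultimately show "abs_cont ?s" using Is unfolding abs_cont_def by blast
qed

text \<open>A cut-off concentrated at the axis end: subtracting
  \<open>v 0 $ 2 * tent d \<rho>\<close> from the second velocity component makes it vanish at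
  \<open>0\<close> and changes it, within the unit interval, only on \<open>{0..d}\<close>.\<close>

definition tent :: "real \<Rightarrow> real \<Rightarrow> real" where
  "tent d \<rho> = max 0 (1 - \<rho> / d)"

lemma tent_derivative:
  assumes "0 < d" "\<rho> \<noteq> d"
  shows "(tent d has_vector_derivative (if \<rho> \<le> d then - 1 / d else 0)) (at \<rho>)"
proof (cases "\<rho> < d")
  case True
  have "((\<lambda>\<rho>. 1 - \<rho> / d) has_vector_derivative - 1 / d) (at \<rho>)"
    using assms by (auto intro!: derivative_eq_intros simp: has_real_derivative_iff_has_vector_derivative[symmetric])
  then have "(tent d has_vector_derivative - 1 / d) (at \<rho>)"
    by (rule has_vector_derivative_transform_within_open[of _ _ _ "{..<d}"])
       (use True assms in \<open>auto simp: tent_def\<close>)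
  then show ?thesis using True by simp
next
  case False
  have "(tent d has_vector_derivative 0) (at \<rho>)"
    by (rule has_vector_derivative_transform_within_open[of "\<lambda>_. 0" _ _ "{d<..}"])
       (use False assms in \<open>auto simp: tent_def\<close>)
  then show ?thesis using False assms by simp
qed

lemma tent_abs_cont:
  assumes d: "0 < d" "d < 1"
  shows "abs_cont (tent d)" and "AE \<rho> in leb_I. Dr (tent d) \<rho> = (if \<rho> \<le> d then - 1 / d else 0)"
proof -
  let ?D = "\<lambda>\<rho>. if \<rho> \<le> d then - 1 / d else 0"
  show D: "AE \<rho> in leb_I. Dr (tent d) \<rho> = ?D \<rho>"
    using AE_leb_I_neq[of d]
    by eventually_elim (simp add: Dr_def vector_derivative_at[OF tent_derivative[OF d(1)]])
  have mD: "?D \<in> borel_measurable leb_I" by measurable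
  have m: "Dr (tent d) \<in> borel_measurable leb_I"
    by (rule borel_measurable_leb_I_AE[OF mD]) (use D in auto)
  have int_D: "integrable leb_I ?D"
    by (rule leb_I.integrable_const_bound[where B = "1 / d", OF _ mD]) (use d in auto)
  have "integrable leb_I (Dr (tent d))"
    using int_D m mD D by (subst Bochner_Integration.integrable_cong_AE[of _ _ ?D]) auto
  moreover have "tent d b = tent d 0 + (LINT y|lebesgue_on {0..b}. Dr (tent d) y)" if b: "b \<in> {0..1}" for b
  proof -
    have "(LINT y|lebesgue_on {0..b}. Dr (tent d) y) = (LINT y|leb_I. (if y \<le> b then Dr (tent d) y else 0))"
      by (rule integral_up_to[OF b])
    also have "\<dots> = (LINT y|leb_I. (if y \<le> min b d then - 1 / d else 0))"
    proof (rule integral_cong_AE)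
      show "AE y in leb_I. (if y \<le> b then Dr (tent d) y else 0) = (if y \<le> min b d then - 1 / d else 0)"
        using D by eventually_elim simp
    qed (use m in auto)
    also have "\<dots> = (LINT y|lebesgue_on {0..min b d}. - 1 / d)"
      by (rule integral_up_to[symmetric]) (use b d in \<open>auto simp: min_def\<close>)
    also have "\<dots> = - min b d / d"
      using b d by (simp add: measure_restrict_space min_def)
    finally have L: "(LINT y|lebesgue_on {0..b}. Dr (tent d) y) = - min b d / d" .
    show ?thesis unfolding L using b d
      by (cases "b \<le> d") (auto simp: tent_def field_simps)
  qed
  moreover have "AE \<rho> in leb_I. tent d differentiable (at \<rho>)"
    using AE_leb_I_neq[of d]
    by eventually_elim (use tent_derivative[OF d(1)] in \<open>auto simp: differentiable_def has_vector_derivative_def\<close>)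
  ultimately show "abs_cont (tent d)" unfolding abs_cont_def by blast
qed


section \<open>Nondegenerate curves\<close>

lemma bdd_minus: "bdd f \<Longrightarrow> bdd (\<lambda>y. - f y)"
  using bdd_mult[OF bdd_const[of "-1"], of f] by simp

lemma bdd_diff: "bdd f \<Longrightarrow> bdd g \<Longrightarrow> bdd (\<lambda>y. f y - g y)"
  using bdd_add[OF _ bdd_minus, of f g] by simp

lemma integral_leb_I_cong_AE:
  fixes f g :: "real \<Rightarrow> real"
  assumes "g \<in> borel_measurable leb_I" "AE \<rho> in leb_I. f \<rho> = g \<rho>"
  shows "(LINT \<rho>|leb_I. f \<rho>) = (LINT \<rho>|leb_I. g \<rho>)"
proof -
  have "f \<in> borel_measurable leb_I"
    by (rule borel_measurable_leb_I_AE[OF assms(1)]) (use assms(2) in auto)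
  then show ?thesis using assms by (intro integral_cong_AE) auto
qed

lemma integrable_leb_I_cong_AE:
  fixes f g :: "real \<Rightarrow> real"
  assumes "integrable leb_I g" "AE \<rho> in leb_I. f \<rho> = g \<rho>"
  shows "integrable leb_I f"
proof -
  have "f \<in> borel_measurable leb_I"
    by (rule borel_measurable_leb_I_AE[of g]) (use assms in auto)
  then show ?thesis using assms by (subst Bochner_Integration.integrable_cong_AE[of f _ g]) auto
qed

lemma norm_real_2: "norm (u :: real^2) = plane_norm (u $ 1) (u $ 2)"
  by (simp add: norm_vec_def L2_set_def sum_2 plane_norm_def)

lemma speed_eq: "speed x \<rho> = plane_norm (Dr x \<rho> $ 1) (Dr x \<rho> $ 2)"
  by (simp add: speed_def norm_real_2)

lemma speed_nonneg: "0 \<le> speed x \<rho>"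
  by (simp add: speed_def)

lemma inner_real_2: "(u :: real^2) \<bullet> v = u $ 1 * v $ 1 + u $ 2 * v $ 2"
  by (simp add: inner_vec_def sum_2)

lemma normal_nth:
  "normal x \<rho> $ 1 = - (Dr x \<rho> $ 2 / speed x \<rho>)" "normal x \<rho> $ 2 = Dr x \<rho> $ 1 / speed x \<rho>"
  by (simp_all add: normal_def perp_def tangent_def)

lemma e1_nth: "e1 $ 1 = 1" "e1 $ 2 = 0"
  by (simp_all add: e1_def)

lemma angle_eq:
  assumes "speed x \<rho> > 0"
  shows "angle x \<rho> = plane_angle (Dr x \<rho> $ 1) (Dr x \<rho> $ 2)"
proof -
  have "Complex (tangent x \<rho> $ 1) (tangent x \<rho> $ 2)
      = of_real (1 / speed x \<rho>) * Complex (Dr x \<rho> $ 1) (Dr x \<rho> $ 2)"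
    by (simp add: tangent_def complex_eq_iff)
  then show ?thesis using assms by (simp only: angle_def plane_angle_def Arg_times_of_real) simp
qed

text \<open>The reflection in the tangent line fixes the tangent, so neither the exponent \<open>1 - q\<close> nor
  the stability function contributes.\<close>

lemma Bmat_tangent:
  assumes w: "speed x \<rho> > 0"
  shows "(Bmat \<gamma> \<gamma>' S q (angle x \<rho>) *v Dr x \<rho>) $ 1
      = \<gamma> (angle x \<rho>) * Dr x \<rho> $ 1 - \<gamma>' (angle x \<rho>) * Dr x \<rho> $ 2"
    and "(Bmat \<gamma> \<gamma>' S q (angle x \<rho>) *v Dr x \<rho>) $ 2
      = \<gamma> (angle x \<rho>) * Dr x \<rho> $ 2 + \<gamma>' (angle x \<rho>) * Dr x \<rho> $ 1"
proof -
  let ?a = "Dr x \<rho> $ 1" and ?b = "Dr x \<rho> $ 2" and ?w = "speed x \<rho>" and ?t = "angle x \<rho>"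
  have nz: "?a \<noteq> 0 \<or> ?b \<noteq> 0" using w unfolding speed_eq by (metis less_irrefl plane_norm_eq_0_iff)
  have cs: "cos ?t = ?a / ?w" "sin ?t = ?b / ?w"
    unfolding angle_eq[OF w] unfolding speed_eq using nz by (simp_all add: cos_plane_angle sin_plane_angle)
  have sq: "?w * ?w = ?a * ?a + ?b * ?b"
    using plane_norm_power2[of ?a ?b] unfolding speed_eq power2_eq_square .
  have c2: "cos (2 * ?t) = (?a * ?a - ?b * ?b) / (?w * ?w)" "sin (2 * ?t) = 2 * ?a * ?b / (?w * ?w)"
    unfolding cos_double sin_double cs by (simp_all add: power2_eq_square diff_divide_distrib)
  have w2: "?w * ?w \<noteq> 0" using w by simp
  have "cos (2 * ?t) * ?a + sin (2 * ?t) * ?b = ?a * (?a * ?a + ?b * ?b) / (?w * ?w)"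
    "sin (2 * ?t) * ?a - cos (2 * ?t) * ?b = ?b * (?a * ?a + ?b * ?b) / (?w * ?w)"
    unfolding c2 times_divide_eq_left add_divide_distrib[symmetric] diff_divide_distrib[symmetric]
    by (simp_all add: algebra_simps)
  then have R: "cos (2 * ?t) * ?a + sin (2 * ?t) * ?b = ?a" "sin (2 * ?t) * ?a - cos (2 * ?t) * ?b = ?b"
    using w2 unfolding sq[symmetric] by simp_all
  have refl: "reflection ?t *v Dr x \<rho> = Dr x \<rho>"
    using R by (simp add: reflection_def vec_eq_iff forall_2 matrix_vector_mult_def sum_2)
  have S: "(S ?t *\<^sub>R ((1/2) *\<^sub>R mat 1 - (1/2) *\<^sub>R reflection ?t)) *v Dr x \<rho> = 0"
    by (simp add: scaleR_matrix_vector_assoc[symmetric] matrix_vector_mult_diff_rdistrib refl)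
  have "(if q = 1 then mat 1 else reflection ?t) *v Dr x \<rho> = Dr x \<rho>" using refl by simp
  then have B: "Bmat \<gamma> \<gamma>' S q ?t *v Dr x \<rho>
      = (vector [vector [\<gamma> ?t, - \<gamma>' ?t], vector [\<gamma>' ?t, \<gamma> ?t]] :: real^2^2) *v Dr x \<rho>"
    unfolding Bmat_def by (simp only: matrix_vector_mult_add_rdistrib S matrix_vector_mul_assoc[symmetric] add_0_right)
  show "(Bmat \<gamma> \<gamma>' S q ?t *v Dr x \<rho>) $ 1 = \<gamma> ?t * ?a - \<gamma>' ?t * ?b"
    "(Bmat \<gamma> \<gamma>' S q ?t *v Dr x \<rho>) $ 2 = \<gamma> ?t * ?b + \<gamma>' ?t * ?a"
    unfolding B by (simp_all add: matrix_vector_mult_def sum_2)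
qed

text \<open>The formal time derivative of the integrand of the bulk energy divided by
  \<open>2 * pi\<close>, when \<open>x\<close> moves with velocity \<open>v\<close> and
  \<open>h\<close> with rate \<open>h'\<close>. The speed changes at the rate
  \<open>(a * a' + b * b') / w\<close> and the angle at the rate
  \<open>(a * b' - b * a') / w^2\<close>.\<close>

definition energy_rate ::
  "(real \<Rightarrow> real) \<Rightarrow> (real \<Rightarrow> real) \<Rightarrow> real \<Rightarrow> (real \<Rightarrow> real^2) \<Rightarrow> (real \<Rightarrow> real^2)
    \<Rightarrow> (real \<Rightarrow> real) \<Rightarrow> (real \<Rightarrow> real) \<Rightarrow> real \<Rightarrow> real" where
  "energy_rate \<gamma> \<gamma>' \<epsilon> x v h h' \<rho> =
     (let r = x \<rho> $ 1; a = Dr x \<rho> $ 1; b = Dr x \<rho> $ 2; a' = Dr v \<rho> $ 1; b' = Dr v \<rho> $ 2;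
        w = plane_norm a b; \<theta> = plane_angle a b in
      v \<rho> $ 1 * (\<gamma> \<theta> * w) + r * ((\<gamma> \<theta> * (a * a' + b * b') + \<gamma>' \<theta> * (a * b' - b * a')) / w)
      + \<epsilon>\<^sup>2 / 2 * (v \<rho> $ 1 * (h \<rho>)\<^sup>2 * w + r * (2 * h \<rho> * h' \<rho>) * w
                   + r * (h \<rho>)\<^sup>2 * ((a * a' + b * b') / w)))"

text \<open>Since \<open>r\<^sub>s ds = r\<^sub>\<rho> d\<rho>\<close>, the integrand of the volume
  is \<open>r z r\<^sub>\<rho>\<close> up to the factor \<open>2 * pi\<close>; this is its rate by
  the product rule.\<close>

definition volume_rate :: "(real \<Rightarrow> real^2) \<Rightarrow> (real \<Rightarrow> real^2) \<Rightarrow> real \<Rightarrow> real" where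
  "volume_rate x v \<rho> = v \<rho> $ 1 * x \<rho> $ 2 * Dr x \<rho> $ 1 + x \<rho> $ 1 * v \<rho> $ 2 * Dr x \<rho> $ 1
     + x \<rho> $ 1 * x \<rho> $ 2 * Dr v \<rho> $ 1"

text \<open>The speed is bounded below but not above. The lower bound places \<open>L2 x\<close>
  inside the unweighted square integrable functions, and \<open>r_H1\<close>, \<open>z_H1\<close>
  make the cube of the speed integrable.\<close>

locale nondegenerate_curve =
  fixes x :: "real \<Rightarrow> real^2" and c :: real
  assumes c_pos: "0 < c" and speed_ge: "AE \<rho> in leb_I. c \<le> speed x \<rho>"
    and r_H1: "(\<lambda>\<rho>. x \<rho> $ 1) \<in> H1 x" and z_H1: "(\<lambda>\<rho>. x \<rho> $ 2) \<in> H1 x"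
begin

abbreviation "w \<equiv> speed x"

lemma H1_abs_cont: "u \<in> H1 x \<Longrightarrow> abs_cont u"
  and H1_L2: "u \<in> H1 x \<Longrightarrow> u \<in> L2 x"
  and H1_Dr_L2: "u \<in> H1 x \<Longrightarrow> Dr u \<in> L2 x"
  by (simp_all add: H1_def)

text \<open>\<open>Dr\<close> is an arbitrary value where no derivative exists, so components can be
  taken only where both are differentiable, which is a set of full measure.\<close>

lemma Dr_vector:
  fixes u :: "real \<Rightarrow> real^2"
  assumes "(\<lambda>\<rho>. u \<rho> $ 1) \<in> H1 x" "(\<lambda>\<rho>. u \<rho> $ 2) \<in> H1 x"
  shows "AE \<rho> in leb_I. Dr u \<rho> $ 1 = Dr (\<lambda>\<rho>. u \<rho> $ 1) \<rho> \<and> Dr u \<rho> $ 2 = Dr (\<lambda>\<rho>. u \<rho> $ 2) \<rho>"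
proof -
  have "AE \<rho> in leb_I. (\<lambda>\<rho>. u \<rho> $ 1) differentiable (at \<rho>)" "AE \<rho> in leb_I. (\<lambda>\<rho>. u \<rho> $ 2) differentiable (at \<rho>)"
    using assms by (auto simp: H1_def abs_cont_def)
  then show ?thesis by eventually_elim (use Dr_nth in blast)
qed

lemma Dr_vector_measurable:
  fixes u :: "real \<Rightarrow> real^2"
  assumes "(\<lambda>\<rho>. u \<rho> $ 1) \<in> H1 x" "(\<lambda>\<rho>. u \<rho> $ 2) \<in> H1 x"
  shows "(\<lambda>\<rho>. Dr u \<rho> $ 1) \<in> borel_measurable leb_I" "(\<lambda>\<rho>. Dr u \<rho> $ 2) \<in> borel_measurable leb_I"
proof -
  have "Dr (\<lambda>\<rho>. u \<rho> $ 1) \<in> borel_measurable leb_I" "Dr (\<lambda>\<rho>. u \<rho> $ 2) \<in> borel_measurable leb_I"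
    using assms by (auto simp: H1_def L2_def)
  moreover have "AE \<rho> in leb_I. Dr (\<lambda>\<rho>. u \<rho> $ 1) \<rho> = Dr u \<rho> $ 1" "AE \<rho> in leb_I. Dr (\<lambda>\<rho>. u \<rho> $ 2) \<rho> = Dr u \<rho> $ 2"
    using Dr_vector[OF assms] by auto
  ultimately show "(\<lambda>\<rho>. Dr u \<rho> $ 1) \<in> borel_measurable leb_I" "(\<lambda>\<rho>. Dr u \<rho> $ 2) \<in> borel_measurable leb_I"
    by (blast intro: borel_measurable_leb_I_AE)+
qed

lemma Dr_x_measurable [measurable]:
  "(\<lambda>\<rho>. Dr x \<rho> $ 1) \<in> borel_measurable leb_I" "(\<lambda>\<rho>. Dr x \<rho> $ 2) \<in> borel_measurable leb_I"
  by (rule Dr_vector_measurable[OF r_H1 z_H1])+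

lemma w_measurable [measurable]: "w \<in> borel_measurable leb_I"
  unfolding speed_eq[abs_def] plane_norm_def by measurable

lemma L2_sqint:
  assumes "f \<in> L2 x"
  shows "sqint f"
proof -
  have [measurable]: "f \<in> borel_measurable leb_I" and I: "integrable leb_I (\<lambda>\<rho>. \<bar>f \<rho>\<bar>\<^sup>2 * w \<rho>)"
    using assms by (auto simp: L2_def)
  have "integrable leb_I (\<lambda>\<rho>. (f \<rho>)\<^sup>2)"
  proof (rule Bochner_Integration.integrable_bound[OF integrable_mult_right[OF I, of "1 / c"]])
    show "AE \<rho> in leb_I. norm ((f \<rho>)\<^sup>2) \<le> norm (1 / c * (\<bar>f \<rho>\<bar>\<^sup>2 * w \<rho>))"
      using speed_ge
    proof eventually_elim
      fix \<rho> assume "c \<le> w \<rho>"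
      then have "(f \<rho>)\<^sup>2 * c \<le> (f \<rho>)\<^sup>2 * w \<rho>" by (intro mult_left_mono) auto
      then show "norm ((f \<rho>)\<^sup>2) \<le> norm (1 / c * (\<bar>f \<rho>\<bar>\<^sup>2 * w \<rho>))"
        using c_pos speed_nonneg[of x \<rho>] by (simp add: field_simps)
    qed
  qed measurable
  then show ?thesis by (simp add: sqint_def)
qed

lemma sqint_cong_AE:
  assumes "sqint f" "AE \<rho> in leb_I. g \<rho> = f \<rho>"
  shows "sqint g"
proof -
  have "g \<in> borel_measurable leb_I"
    by (rule borel_measurable_leb_I_AE[of f]) (use assms in \<open>auto simp: sqint_def\<close>)
  moreover have "integrable leb_I (\<lambda>\<rho>. (g \<rho>)\<^sup>2)"
    by (rule integrable_leb_I_cong_AE[of "\<lambda>\<rho>. (f \<rho>)\<^sup>2"]) (use assms in \<open>auto simp: sqint_def\<close>)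
  ultimately show ?thesis by (simp add: sqint_def)
qed

lemma Dr_vector_sqint:
  fixes u :: "real \<Rightarrow> real^2"
  assumes "(\<lambda>\<rho>. u \<rho> $ 1) \<in> H1 x" "(\<lambda>\<rho>. u \<rho> $ 2) \<in> H1 x"
  shows "sqint (\<lambda>\<rho>. Dr u \<rho> $ 1)" "sqint (\<lambda>\<rho>. Dr u \<rho> $ 2)"
proof -
  show "sqint (\<lambda>\<rho>. Dr u \<rho> $ 1)"
    by (rule sqint_cong_AE[OF L2_sqint[OF H1_Dr_L2[OF assms(1)]]]) (use Dr_vector[OF assms] in auto)
  show "sqint (\<lambda>\<rho>. Dr u \<rho> $ 2)"
    by (rule sqint_cong_AE[OF L2_sqint[OF H1_Dr_L2[OF assms(2)]]]) (use Dr_vector[OF assms] in auto)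
qed

lemma w_sqint: "sqint w"
  using Dr_vector_sqint[OF r_H1 z_H1] unfolding sqint_def speed_eq plane_norm_power2
  by (auto simp: speed_eq[symmetric])

lemma w_integrable: "integrable leb_I w"
  by (rule integrable_sqint[OF w_sqint])

lemma H1_measurable: "u \<in> H1 x \<Longrightarrow> u \<in> borel_measurable leb_I"
  by (simp add: H1_def L2_def)

lemma H1_bdd: assumes "u \<in> H1 x" shows "bdd u"
  by (rule bddI[OF H1_measurable[OF assms] abs_cont_bound[OF H1_abs_cont[OF assms]]])
     (auto intro: integrable_sqint L2_sqint H1_L2 assms)

lemma bdd_L2: assumes "bdd f" shows "f \<in> L2 x"
  using integrable_bdd_mult[OF bdd_power2[OF assms] w_integrable] assms
  by (simp add: L2_def bdd_def)

lemma L2_add_scaled: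
  assumes "f \<in> L2 x" "g \<in> L2 x"
  shows "(\<lambda>\<rho>. f \<rho> + d * g \<rho>) \<in> L2 x"
proof -
  have [measurable]: "f \<in> borel_measurable leb_I" "g \<in> borel_measurable leb_I" using assms by (auto simp: L2_def)
  have I: "integrable leb_I (\<lambda>\<rho>. 2 * (\<bar>f \<rho>\<bar>\<^sup>2 * w \<rho>) + 2 * d\<^sup>2 * (\<bar>g \<rho>\<bar>\<^sup>2 * w \<rho>))"
    using assms by (auto simp: L2_def)
  have "integrable leb_I (\<lambda>\<rho>. \<bar>f \<rho> + d * g \<rho>\<bar>\<^sup>2 * w \<rho>)"
  proof (rule Bochner_Integration.integrable_bound[OF I])
    show "AE \<rho> in leb_I. norm (\<bar>f \<rho> + d * g \<rho>\<bar>\<^sup>2 * w \<rho>) \<le> norm (2 * (\<bar>f \<rho>\<bar>\<^sup>2 * w \<rho>) + 2 * d\<^sup>2 * (\<bar>g \<rho>\<bar>\<^sup>2 * w \<rho>))"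
    proof (rule AE_I2)
      fix \<rho>
      have "(f \<rho> + d * g \<rho>)\<^sup>2 \<le> 2 * (f \<rho>)\<^sup>2 + 2 * d\<^sup>2 * (g \<rho>)\<^sup>2"
        using sum_squares_bound[of "f \<rho>" "d * g \<rho>"] by (simp add: power2_sum power_mult_distrib)
      then have "(f \<rho> + d * g \<rho>)\<^sup>2 * w \<rho> \<le> (2 * (f \<rho>)\<^sup>2 + 2 * d\<^sup>2 * (g \<rho>)\<^sup>2) * w \<rho>"
        by (rule mult_right_mono) (rule speed_nonneg)
      then show "norm (\<bar>f \<rho> + d * g \<rho>\<bar>\<^sup>2 * w \<rho>) \<le> norm (2 * (\<bar>f \<rho>\<bar>\<^sup>2 * w \<rho>) + 2 * d\<^sup>2 * (\<bar>g \<rho>\<bar>\<^sup>2 * w \<rho>))"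
        using speed_nonneg[of x \<rho>] by (simp add: algebra_simps)
    qed
  qed measurable
  then show ?thesis by (simp add: L2_def)
qed

lemma L2_cong_AE:
  assumes "f \<in> L2 x" "AE \<rho> in leb_I. g \<rho> = f \<rho>"
  shows "g \<in> L2 x"
proof -
  have "g \<in> borel_measurable leb_I"
    by (rule borel_measurable_leb_I_AE[of f]) (use assms in \<open>auto simp: L2_def\<close>)
  moreover have "integrable leb_I (\<lambda>\<rho>. \<bar>g \<rho>\<bar>\<^sup>2 * w \<rho>)"
    by (rule integrable_leb_I_cong_AE[of "\<lambda>\<rho>. \<bar>f \<rho>\<bar>\<^sup>2 * w \<rho>"]) (use assms in \<open>auto simp: L2_def\<close>)
  ultimately show ?thesis by (simp add: L2_def)
qed

lemma H1_add_scaled: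
  assumes "u \<in> H1 x" "v \<in> H1 x"
  shows "(\<lambda>\<rho>. u \<rho> + d * v \<rho>) \<in> H1 x"
  using assms abs_cont_add_scaled[OF H1_abs_cont[OF assms(1)] H1_abs_cont[OF assms(2)]]
  unfolding H1_def by (auto intro: L2_add_scaled L2_cong_AE)

lemma tent_H1:
  assumes "0 < d" "d < 1"
  shows "tent d \<in> H1 x"
proof -
  have "bdd (tent d)"
  proof (rule bddI)
    show "tent d \<in> borel_measurable leb_I" unfolding tent_def[abs_def] by measurable
    show "\<bar>tent d y\<bar> \<le> 1" if "y \<in> {0..1}" for y using that assms by (simp add: tent_def)
  qed
  moreover have "bdd (\<lambda>\<rho>. if \<rho> \<le> d then - 1 / d else 0)"
  proof (rule bddI)
    show "\<bar>if y \<le> d then - 1 / d else 0\<bar> \<le> 1 / d" for y using assms by simp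
  qed measurable
  ultimately have "tent d \<in> L2 x" "Dr (tent d) \<in> L2 x"
    using bdd_L2 L2_cong_AE[OF _ tent_abs_cont(2)[OF assms]] by blast+
  then show ?thesis unfolding H1_def using tent_abs_cont(1)[OF assms] by blast
qed

lemma one_H1: "(\<lambda>_. 1) \<in> H1 x"
proof -
  have D: "Dr (\<lambda>_. 1 :: real) = (\<lambda>_. 0)" by (simp add: Dr_def fun_eq_iff)
  have "abs_cont (\<lambda>_. 1)" unfolding abs_cont_def D by simp
  moreover have "(\<lambda>_. 1) \<in> L2 x" "(\<lambda>_. 0) \<in> L2 x" by (rule bdd_L2[OF bdd_const])+
  ultimately show ?thesis by (simp add: H1_def D)
qed

lemma integrable_bdd_w: "bdd f \<Longrightarrow> integrable leb_I (\<lambda>\<rho>. f \<rho> * w \<rho>)"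
  by (rule integrable_bdd_mult[OF _ w_integrable])

lemma integrable_bdd_sqint: "bdd f \<Longrightarrow> sqint d \<Longrightarrow> integrable leb_I (\<lambda>\<rho>. f \<rho> * d \<rho>)"
  by (rule integrable_bdd_mult[OF _ integrable_sqint])

lemma L2_w_integrable: assumes "k \<in> L2 x" shows "integrable leb_I (\<lambda>\<rho>. k \<rho> * w \<rho>)"
proof (rule Bochner_Integration.integrable_bound)
  show "integrable leb_I (\<lambda>\<rho>. w \<rho> + \<bar>k \<rho>\<bar>\<^sup>2 * w \<rho>)" using assms w_integrable by (auto simp: L2_def)
  show "(\<lambda>\<rho>. k \<rho> * w \<rho>) \<in> borel_measurable leb_I" using assms by (auto simp: L2_def)
  show "AE \<rho> in leb_I. norm (k \<rho> * w \<rho>) \<le> norm (w \<rho> + \<bar>k \<rho>\<bar>\<^sup>2 * w \<rho>)"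
  proof (rule AE_I2)
    fix \<rho>
    have "2 * \<bar>k \<rho>\<bar> \<le> 1 + (k \<rho>)\<^sup>2" using sum_squares_bound[of 1 "\<bar>k \<rho>\<bar>"] by simp
    then have "\<bar>k \<rho>\<bar> * w \<rho> \<le> (1 + (k \<rho>)\<^sup>2) * w \<rho>" by (intro mult_right_mono speed_nonneg) simp
    then show "norm (k \<rho> * w \<rho>) \<le> norm (w \<rho> + \<bar>k \<rho>\<bar>\<^sup>2 * w \<rho>)"
      using speed_nonneg[of x \<rho>] by (simp add: abs_mult algebra_simps)
  qed
qed

lemma bdd_tangent: "bdd (\<lambda>\<rho>. Dr x \<rho> $ 1 / w \<rho>)" "bdd (\<lambda>\<rho>. Dr x \<rho> $ 2 / w \<rho>)"
proof -
  have "\<bar>a\<bar> / plane_norm a b \<le> 1" "\<bar>b\<bar> / plane_norm a b \<le> 1" for a b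
    using abs_le_plane_norm[of a b] abs_le_plane_norm[of b a]
    by (auto simp: divide_le_eq_1 less_le)
  then show "bdd (\<lambda>\<rho>. Dr x \<rho> $ 1 / w \<rho>)" "bdd (\<lambda>\<rho>. Dr x \<rho> $ 2 / w \<rho>)"
    using bddI[of "\<lambda>\<rho>. Dr x \<rho> $ 1 / w \<rho>" 1] bddI[of "\<lambda>\<rho>. Dr x \<rho> $ 2 / w \<rho>" 1]
    by (simp_all add: speed_eq abs_divide plane_norm_def)
qed

lemma bdd_inverse_w: "bdd (\<lambda>\<rho>. 1 / w \<rho>)"
  unfolding bdd_def
proof (intro conjI exI)
  show "AE \<rho> in leb_I. \<bar>1 / w \<rho>\<bar> \<le> 1 / c"
    using speed_ge by eventually_elim (use c_pos in \<open>auto simp: frac_le\<close>)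
qed measurable

lemma sqint_div_w: "sqint d \<Longrightarrow> sqint (\<lambda>\<rho>. d \<rho> / w \<rho>)"
  using sqint_bdd_mult[OF bdd_inverse_w, of d] by simp

lemma integrable_bdd_sqint_sqint:
  assumes "bdd f" "sqint d" "sqint e"
  shows "integrable leb_I (\<lambda>\<rho>. f \<rho> * (d \<rho> / w \<rho> * e \<rho>))"
  by (rule integrable_bdd_mult[OF assms(1) integrable_mult_sqint[OF sqint_div_w[OF assms(2)] assms(3)]])

end


section \<open>The variational formulation at a fixed time\<close>

text \<open>Cauchy-Schwarz against the constant 1, obtained from the nonnegative integral of the
  squared deviation of \<open>\<bar>f\<bar>\<close> from its mean on \<open>{0..d}\<close>. The
  factor \<open>d\<close> on the right will compensate the slope of the cut-off.\<close>

lemma power2_integral_up_to_le: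
  assumes f: "sqint f" and d: "0 < d" "d \<le> 1"
  shows "(LINT y|leb_I. (if y \<le> d then \<bar>f y\<bar> else 0))\<^sup>2 \<le> d * (LINT y|leb_I. (if y \<le> d then (f y)\<^sup>2 else 0))"
proof -
  define I where "I = (LINT y|leb_I. (if y \<le> d then \<bar>f y\<bar> else 0))"
  have d': "d \<in> {0..1}" using d by simp
  have i1: "integrable leb_I (\<lambda>y. if y \<le> d then \<bar>f y\<bar> else 0)"
    using integrable_up_to[of "\<lambda>y. \<bar>f y\<bar>"] integrable_sqint[OF f] d' by simp
  have i2: "integrable leb_I (\<lambda>y. if y \<le> d then (f y)\<^sup>2 else 0)"
    using integrable_up_to[of "\<lambda>y. (f y)\<^sup>2"] f d' by (simp add: sqint_def)
  have i3: "integrable leb_I (\<lambda>y. if y \<le> d then 1 else 0 :: real)"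
    using integrable_up_to[of "\<lambda>y. 1"] d' by simp
  have one: "(LINT y|leb_I. (if y \<le> d then 1 else 0 :: real)) = d"
    using integral_up_to[OF d', of "\<lambda>_. 1"] d by (simp add: measure_restrict_space)
  have "0 \<le> (LINT y|leb_I. (if y \<le> d then (\<bar>f y\<bar> - I / d)\<^sup>2 else 0))"
    by (rule Bochner_Integration.integral_nonneg) auto
  also have "\<dots> = (LINT y|leb_I. (if y \<le> d then (f y)\<^sup>2 else 0) - 2 * (I / d) * (if y \<le> d then \<bar>f y\<bar> else 0)
      + (I / d)\<^sup>2 * (if y \<le> d then 1 else 0))"
    by (rule Bochner_Integration.integral_cong) (auto simp: power2_eq_square algebra_simps)
  also have "\<dots> = (LINT y|leb_I. (if y \<le> d then (f y)\<^sup>2 else 0)) - 2 * (I / d) * I + (I / d)\<^sup>2 * d"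
    using i1 i2 i3 by (simp add: one I_def[symmetric])
  also have "\<dots> = (LINT y|leb_I. (if y \<le> d then (f y)\<^sup>2 else 0)) - I\<^sup>2 / d"
    using d by (simp add: field_simps power2_eq_square)
  finally show ?thesis using d unfolding I_def[symmetric] by (simp add: field_simps)
qed

text \<open>A single time, with the time derivatives as separate fields \<open>v\<close> and
  \<open>h'\<close>. The conditions on \<open>v 1 $ 2\<close> and \<open>v 0 $ 2\<close> are the
  boundary conditions on \<open>z\<close>, differentiated in time.\<close>

locale film_state = nondegenerate_curve x c + surface_energy \<gamma> \<gamma>'
  for x :: "real \<Rightarrow> real^2" and c :: real and \<gamma> \<gamma>' :: "real \<Rightarrow> real" +
  fixes \<epsilon> \<eta> \<sigma> :: real and S :: "real \<Rightarrow> real" and q :: nat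
    and v :: "real \<Rightarrow> real^2" and m h h' k :: "real \<Rightarrow> real"
  assumes \<eta>_pos: "0 < \<eta>"
    and r_nonneg: "\<And>\<rho>. \<rho> \<in> {0..1} \<Longrightarrow> 0 \<le> x \<rho> $ 1"
    and v1_H1: "(\<lambda>\<rho>. v \<rho> $ 1) \<in> H1 x" and v2_H1: "(\<lambda>\<rho>. v \<rho> $ 2) \<in> H1 x"
    and m_H1: "m \<in> H1 x" and h_H1_0: "h \<in> H1_0 x" and h'_L2: "h' \<in> L2 x" and k_L2: "k \<in> L2 x"
    and v2_1: "v 1 $ 2 = 0" and v2_0: "0 < x 0 $ 1 \<Longrightarrow> v 0 $ 2 = 0"
    and z_1: "x 1 $ 2 = 0" and z_0: "0 < x 0 $ 1 \<Longrightarrow> x 0 $ 2 = 0"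
    and V1: "V1 x v m" and V2: "V2 \<epsilon> \<eta> \<sigma> \<gamma> \<gamma>' S q x v m h k" and V3: "V3 x v h h' k"
begin

text \<open>\<open>(T1, T2)\<close> is the unit tangent, so the normal is
  \<open>(- T2, T1)\<close>.\<close>

definition "T1 \<rho> = Dr x \<rho> $ 1 / w \<rho>"
definition "T2 \<rho> = Dr x \<rho> $ 2 / w \<rho>"
definition "g \<rho> = \<gamma> (plane_angle (Dr x \<rho> $ 1) (Dr x \<rho> $ 2))"
definition "g' \<rho> = \<gamma>' (plane_angle (Dr x \<rho> $ 1) (Dr x \<rho> $ 2))"

lemma h_H1: "h \<in> H1 x" and h_0: "h 0 = 0" and h_1: "h 1 = 0"
  using h_H1_0 by (auto simp: H1_0_def)

lemma bdd_facts: "bdd (\<lambda>\<rho>. x \<rho> $ 1)" "bdd (\<lambda>\<rho>. x \<rho> $ 2)" "bdd (\<lambda>\<rho>. v \<rho> $ 1)" "bdd (\<lambda>\<rho>. v \<rho> $ 2)"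
  "bdd (\<lambda>\<rho>. m \<rho>)" "bdd (\<lambda>\<rho>. h \<rho>)" "bdd (\<lambda>\<rho>. T1 \<rho>)" "bdd (\<lambda>\<rho>. T2 \<rho>)"
  using H1_bdd r_H1 z_H1 v1_H1 v2_H1 m_H1 h_H1 bdd_tangent by (auto simp: T1_def T2_def)

lemma bdd_g: "bdd (\<lambda>\<rho>. g \<rho>)" "bdd (\<lambda>\<rho>. g' \<rho>)"
proof -
  obtain \<Gamma> where "\<And>a b. \<bar>\<gamma> (plane_angle a b)\<bar> \<le> \<Gamma> \<and> \<bar>\<gamma>' (plane_angle a b)\<bar> \<le> \<Gamma>"
    using bounded_energy by blast
  then show "bdd (\<lambda>\<rho>. g \<rho>)" "bdd (\<lambda>\<rho>. g' \<rho>)"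
    unfolding g_def g'_def
    by (auto intro!: bddI[where K = \<Gamma>] borel_measurable_energy Dr_x_measurable)
qed

lemmas bdd_rules = bdd_add bdd_diff bdd_mult bdd_power2 bdd_const bdd_facts bdd_g

lemma hr_sqint: "sqint (Dr h)"
  by (rule L2_sqint[OF H1_Dr_L2[OF h_H1]])

text \<open>\<open>E1\<close> to \<open>E6\<close> are the integrands of the six pairings of (V2), in this order, for a test function
  with components \<open>o1\<close>, \<open>o2\<close> and derivative \<open>(d1, d2)\<close>.\<close>

definition E1 where "E1 o1 o2 \<rho> = (x \<rho> $ 1 * m \<rho> * (T1 \<rho> * o2 \<rho> - T2 \<rho> * o1 \<rho>)) * w \<rho>"
definition E2 where "E2 d1 d2 \<rho> = (x \<rho> $ 1 * (g \<rho> * T1 \<rho> - g' \<rho> * T2 \<rho>)) * d1 \<rho>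
   + (x \<rho> $ 1 * (g \<rho> * T2 \<rho> + g' \<rho> * T1 \<rho>)) * d2 \<rho>"
definition E3 where "E3 d1 d2 \<rho> = (x \<rho> $ 1 * T1 \<rho>) * (Dr h \<rho> / w \<rho> * d2 \<rho>)
   - (x \<rho> $ 1 * T2 \<rho>) * (Dr h \<rho> / w \<rho> * d1 \<rho>)
   + ((1/2 * x \<rho> $ 1 * (h \<rho>)\<^sup>2 - T2 \<rho> * h \<rho>) * T1 \<rho>) * d1 \<rho>
   + ((1/2 * x \<rho> $ 1 * (h \<rho>)\<^sup>2 - T2 \<rho> * h \<rho>) * T2 \<rho>) * d2 \<rho>"
definition E4 where "E4 o1 \<rho> = (g \<rho> * o1 \<rho>) * w \<rho>"
definition E5 where "E5 o1 \<rho> = ((h \<rho>)\<^sup>2 * o1 \<rho>) * w \<rho>"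
definition E6 where "E6 o1 \<rho> = (h \<rho> * o1 \<rho>) * (k \<rho> * w \<rho>)"

text \<open>The derivatives \<open>d1\<close>, \<open>d2\<close> are arguments of their own, so the
  integrand is linear in the test data at every point, whereas \<open>Dr\<close> of a sum splits
  only where both summands are differentiable.\<close>

definition L where "L o1 o2 d1 d2 \<rho> = E1 o1 o2 \<rho> - E2 d1 d2 \<rho> + \<epsilon>\<^sup>2 * E3 d1 d2 \<rho> - E4 o1 \<rho>
    + \<epsilon>\<^sup>2 / 2 * E5 o1 \<rho> - \<epsilon>\<^sup>2 * E6 o1 \<rho>"

definition bdry where "bdry o1 = - 1 / \<eta> * (x 0 $ 1 * v 0 $ 1 * o1 0 + x 1 $ 1 * v 1 $ 1 * o1 1)
    + \<sigma> * (x 1 $ 1 * o1 1 - x 0 $ 1 * o1 0)"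

lemma E_integrable:
  assumes o: "bdd o1" "bdd o2" and d: "sqint d1" "sqint d2"
  shows "integrable leb_I (E1 o1 o2)" "integrable leb_I (E2 d1 d2)" "integrable leb_I (E3 d1 d2)"
    "integrable leb_I (E4 o1)" "integrable leb_I (E5 o1)" "integrable leb_I (E6 o1)"
proof -
  have o': "bdd (\<lambda>\<rho>. o1 \<rho>)" "bdd (\<lambda>\<rho>. o2 \<rho>)" using o by auto
  show "integrable leb_I (E1 o1 o2)" unfolding E1_def[abs_def]
    by (intro integrable_bdd_w bdd_rules o')
  show "integrable leb_I (E2 d1 d2)" unfolding E2_def[abs_def]
    by (intro Bochner_Integration.integrable_add integrable_bdd_sqint bdd_rules d)
  show "integrable leb_I (E3 d1 d2)" unfolding E3_def[abs_def]
    by (intro Bochner_Integration.integrable_add Bochner_Integration.integrable_diff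
        integrable_bdd_sqint_sqint integrable_bdd_sqint bdd_rules d hr_sqint)
  show "integrable leb_I (E4 o1)" unfolding E4_def[abs_def]
    by (intro integrable_bdd_w bdd_rules o')
  show "integrable leb_I (E5 o1)" unfolding E5_def[abs_def]
    by (intro integrable_bdd_w bdd_rules o')
  show "integrable leb_I (E6 o1)" unfolding E6_def[abs_def]
    by (intro integrable_bdd_mult L2_w_integrable k_L2 bdd_rules o')
qed

lemma L_integrable:
  assumes "bdd o1" "bdd o2" "sqint d1" "sqint d2"
  shows "integrable leb_I (L o1 o2 d1 d2)"
  using E_integrable[OF assms] unfolding L_def[abs_def] by simp

lemma H1_sqint: "u \<in> H1 x \<Longrightarrow> sqint (Dr u)"
  by (rule L2_sqint[OF H1_Dr_L2])

lemma V2_scalar: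
  assumes o1: "o1 \<in> H1 x" and o2: "o2 \<in> H1_0 x"
  shows "(LINT \<rho>|leb_I. L o1 o2 (Dr o1) (Dr o2) \<rho>) + bdry o1 = 0"
proof -
  define \<omega> :: "real \<Rightarrow> real^2" where "\<omega> \<rho> = vector [o1 \<rho>, o2 \<rho>]" for \<rho>
  have \<omega>[simp]: "\<omega> \<rho> $ 1 = o1 \<rho>" "\<omega> \<rho> $ 2 = o2 \<rho>" for \<rho> by (simp_all add: \<omega>_def)
  have o2': "o2 \<in> H1 x" using o2 by (simp add: H1_0_def)
  note I = E_integrable[OF H1_bdd[OF o1] H1_bdd[OF o2'] H1_sqint[OF o1] H1_sqint[OF o2']]
  have Dw: "AE \<rho> in leb_I. Dr \<omega> \<rho> $ 1 = Dr o1 \<rho> \<and> Dr \<omega> \<rho> $ 2 = Dr o2 \<rho>"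
    using Dr_vector[of \<omega>] o1 o2' by simp
  have wpos: "AE \<rho> in leb_I. w \<rho> > 0" using speed_ge by eventually_elim (use c_pos in simp)
  have 1: "pairing (\<lambda>\<rho>. (x \<rho> $ 1 * m \<rho>) *\<^sub>R normal x \<rho>) (\<lambda>\<rho>. w \<rho> *\<^sub>R \<omega> \<rho>) = (LINT \<rho>|leb_I. E1 o1 o2 \<rho>)"
    unfolding pairing_def
    by (rule Bochner_Integration.integral_cong)
       (simp_all add: inner_real_2 normal_nth E1_def T1_def T2_def algebra_simps)
  have 2: "pairing (\<lambda>\<rho>. x \<rho> $ 1 *\<^sub>R (Bmat \<gamma> \<gamma>' S q (angle x \<rho>) *v Dr x \<rho>)) (\<lambda>\<rho>. (1 / w \<rho>) *\<^sub>R Dr \<omega> \<rho>)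
      = (LINT \<rho>|leb_I. E2 (Dr o1) (Dr o2) \<rho>)"
    unfolding pairing_def
  proof (rule integral_leb_I_cong_AE)
    show "AE \<rho> in leb_I. x \<rho> $ 1 *\<^sub>R (Bmat \<gamma> \<gamma>' S q (angle x \<rho>) *v Dr x \<rho>) \<bullet> (1 / w \<rho>) *\<^sub>R Dr \<omega> \<rho>
        = E2 (Dr o1) (Dr o2) \<rho>"
      using Dw wpos
    proof eventually_elim
      fix \<rho> assume D: "Dr \<omega> \<rho> $ 1 = Dr o1 \<rho> \<and> Dr \<omega> \<rho> $ 2 = Dr o2 \<rho>" and w: "w \<rho> > 0"
      show "x \<rho> $ 1 *\<^sub>R (Bmat \<gamma> \<gamma>' S q (angle x \<rho>) *v Dr x \<rho>) \<bullet> (1 / w \<rho>) *\<^sub>R Dr \<omega> \<rho>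
        = E2 (Dr o1) (Dr o2) \<rho>"
        unfolding inner_real_2 vector_scaleR_component Bmat_tangent[OF w]
        unfolding angle_eq[OF w] g_def[symmetric] g'_def[symmetric] E2_def T1_def T2_def
        using D by (simp add: algebra_simps add_divide_distrib diff_divide_distrib)
    qed
  qed (use I(2) in auto)
  have 3: "pairing (\<lambda>\<rho>. (x \<rho> $ 1 * Dr h \<rho>) *\<^sub>R normal x \<rho> + (1/2 * x \<rho> $ 1 * (h \<rho>)\<^sup>2) *\<^sub>R Dr x \<rho>
        + ((normal x \<rho> \<bullet> e1) * h \<rho>) *\<^sub>R Dr x \<rho>) (\<lambda>\<rho>. (1 / w \<rho>) *\<^sub>R Dr \<omega> \<rho>)
      = (LINT \<rho>|leb_I. E3 (Dr o1) (Dr o2) \<rho>)"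
    unfolding pairing_def
  proof (rule integral_leb_I_cong_AE)
    show "AE \<rho> in leb_I. ((x \<rho> $ 1 * Dr h \<rho>) *\<^sub>R normal x \<rho> + (1/2 * x \<rho> $ 1 * (h \<rho>)\<^sup>2) *\<^sub>R Dr x \<rho>
        + ((normal x \<rho> \<bullet> e1) * h \<rho>) *\<^sub>R Dr x \<rho>) \<bullet> (1 / w \<rho>) *\<^sub>R Dr \<omega> \<rho> = E3 (Dr o1) (Dr o2) \<rho>"
      using Dw
      by eventually_elim
        (simp add: inner_real_2 normal_nth e1_nth E3_def T1_def T2_def algebra_simps add_divide_distrib diff_divide_distrib)
  qed (use I(3) in auto)
  have 4: "pairing (\<lambda>\<rho>. \<gamma> (angle x \<rho>) *\<^sub>R e1) (\<lambda>\<rho>. w \<rho> *\<^sub>R \<omega> \<rho>) = (LINT \<rho>|leb_I. E4 o1 \<rho>)"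
    unfolding pairing_def
  proof (rule integral_leb_I_cong_AE)
    show "AE \<rho> in leb_I. \<gamma> (angle x \<rho>) *\<^sub>R e1 \<bullet> w \<rho> *\<^sub>R \<omega> \<rho> = E4 o1 \<rho>"
      using wpos
      by eventually_elim (simp add: inner_real_2 e1_nth E4_def g_def angle_eq)
  qed (use I(4) in auto)
  have 5: "pairing (\<lambda>\<rho>. (h \<rho>)\<^sup>2 *\<^sub>R e1) (\<lambda>\<rho>. w \<rho> *\<^sub>R \<omega> \<rho>) = (LINT \<rho>|leb_I. E5 o1 \<rho>)"
    unfolding pairing_def
    by (rule Bochner_Integration.integral_cong) (simp_all add: inner_real_2 e1_nth E5_def)
  have 6: "pairing (\<lambda>\<rho>. (h \<rho> * k \<rho>) *\<^sub>R e1) (\<lambda>\<rho>. w \<rho> *\<^sub>R \<omega> \<rho>) = (LINT \<rho>|leb_I. E6 o1 \<rho>)"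
    unfolding pairing_def
    by (rule Bochner_Integration.integral_cong) (simp_all add: inner_real_2 e1_nth E6_def)
  have "(\<lambda>\<rho>. \<omega> \<rho> $ 1) \<in> H1 x \<and> (\<lambda>\<rho>. \<omega> \<rho> $ 2) \<in> H1_0 x" using o1 o2 by simp
  from V2[unfolded V2_def, rule_format, OF this]
  have "(LINT \<rho>|leb_I. E1 o1 o2 \<rho>) - (LINT \<rho>|leb_I. E2 (Dr o1) (Dr o2) \<rho>) + \<epsilon>\<^sup>2 * (LINT \<rho>|leb_I. E3 (Dr o1) (Dr o2) \<rho>)
    - (LINT \<rho>|leb_I. E4 o1 \<rho>) + \<epsilon>\<^sup>2 / 2 * (LINT \<rho>|leb_I. E5 o1 \<rho>) - \<epsilon>\<^sup>2 * (LINT \<rho>|leb_I. E6 o1 \<rho>) + bdry o1 = 0"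
    unfolding 1 2 3 4 5 6 bdry_def by simp
  moreover have "(LINT \<rho>|leb_I. L o1 o2 (Dr o1) (Dr o2) \<rho>)
    = (LINT \<rho>|leb_I. E1 o1 o2 \<rho>) - (LINT \<rho>|leb_I. E2 (Dr o1) (Dr o2) \<rho>) + \<epsilon>\<^sup>2 * (LINT \<rho>|leb_I. E3 (Dr o1) (Dr o2) \<rho>)
    - (LINT \<rho>|leb_I. E4 o1 \<rho>) + \<epsilon>\<^sup>2 / 2 * (LINT \<rho>|leb_I. E5 o1 \<rho>) - \<epsilon>\<^sup>2 * (LINT \<rho>|leb_I. E6 o1 \<rho>)"
    unfolding L_def using I by simp
  ultimately show ?thesis by simp
qed

lemma L_linear:
  "L (\<lambda>\<rho>. o1 \<rho>) (\<lambda>\<rho>. o2 \<rho> + a * p2 \<rho>) (\<lambda>\<rho>. d1 \<rho>) (\<lambda>\<rho>. d2 \<rho> + a * e2 \<rho>) \<rho>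
    = L o1 o2 d1 d2 \<rho> + a * L (\<lambda>_. 0) p2 (\<lambda>_. 0) e2 \<rho>"
  unfolding L_def E1_def E2_def E3_def E4_def E5_def E6_def
  by (simp add: algebra_simps add_divide_distrib)

abbreviation "dv1 \<equiv> Dr (\<lambda>\<rho>. v \<rho> $ 1)"
abbreviation "dv2 \<equiv> Dr (\<lambda>\<rho>. v \<rho> $ 2)"
abbreviation "Lv \<equiv> L (\<lambda>\<rho>. v \<rho> $ 1) (\<lambda>\<rho>. v \<rho> $ 2) dv1 dv2"

lemma L_cong_AE:
  assumes "AE \<rho> in leb_I. d2 \<rho> = e2 \<rho>" "bdd o1" "bdd o2" "sqint d1" "sqint e2"
  shows "(LINT \<rho>|leb_I. L o1 o2 d1 d2 \<rho>) = (LINT \<rho>|leb_I. L o1 o2 d1 e2 \<rho>)"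
proof (rule integral_leb_I_cong_AE)
  show "L o1 o2 d1 e2 \<in> borel_measurable leb_I" using L_integrable[OF assms(2-5)] by auto
  show "AE \<rho> in leb_I. L o1 o2 d1 d2 \<rho> = L o1 o2 d1 e2 \<rho>"
    using assms(1) by eventually_elim (simp add: L_def E2_def E3_def)
qed

text \<open>(V2) is tested with the velocity corrected by the tent. The left side does not depend on
  \<open>d\<close>, so it vanishes as soon as the right side tends to 0 for some sequence of
  widths.\<close>

lemma V2_cutoff:
  assumes d: "0 < d" "d < 1"
  shows "(LINT \<rho>|leb_I. Lv \<rho>) + bdry (\<lambda>\<rho>. v \<rho> $ 1)
    = v 0 $ 2 * (LINT \<rho>|leb_I. L (\<lambda>_. 0) (tent d) (\<lambda>_. 0) (\<lambda>\<rho>. if \<rho> \<le> d then - 1 / d else 0) \<rho>)"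
proof -
  let ?D = "\<lambda>\<rho>. if \<rho> \<le> d then - 1 / d else 0" and ?a = "- v 0 $ 2"
  let ?o = "\<lambda>\<rho>. v \<rho> $ 2 + ?a * tent d \<rho>"
  have o: "?o \<in> H1 x" by (rule H1_add_scaled[OF v2_H1 tent_H1[OF d]])
  have "?o 0 = 0" "?o 1 = 0" using d v2_1 by (simp_all add: tent_def)
  then have o0: "?o \<in> H1_0 x" using o by (simp add: H1_0_def)
  have bD: "bdd ?D"
  proof (rule bddI)
    show "\<bar>?D y\<bar> \<le> 1 / d" for y using d by simp
  qed measurable
  have sD: "sqint ?D" by (rule sqint_bdd[OF bD])
  have sD': "sqint (\<lambda>\<rho>. dv2 \<rho> + ?a * ?D \<rho>)"
    by (rule sqint_add[OF H1_sqint[OF v2_H1] sqint_bdd[OF bdd_mult[OF bdd_const bD]]])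
  have "AE \<rho> in leb_I. Dr ?o \<rho> = dv2 \<rho> + ?a * ?D \<rho>"
    using abs_cont_add_scaled(2)[OF H1_abs_cont[OF v2_H1] tent_abs_cont(1)[OF d], of ?a] tent_abs_cont(2)[OF d]
    by eventually_elim simp
  then have "(LINT \<rho>|leb_I. L (\<lambda>\<rho>. v \<rho> $ 1) ?o dv1 (Dr ?o) \<rho>)
      = (LINT \<rho>|leb_I. L (\<lambda>\<rho>. v \<rho> $ 1) ?o dv1 (\<lambda>\<rho>. dv2 \<rho> + ?a * ?D \<rho>) \<rho>)"
    by (rule L_cong_AE[OF _ H1_bdd[OF v1_H1] H1_bdd[OF o] H1_sqint[OF v1_H1] sD'])
  also have "\<dots> = (LINT \<rho>|leb_I. Lv \<rho> + ?a * L (\<lambda>_. 0) (tent d) (\<lambda>_. 0) ?D \<rho>)"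
    unfolding L_linear[symmetric] ..
  also have "\<dots> = (LINT \<rho>|leb_I. Lv \<rho>) + ?a * (LINT \<rho>|leb_I. L (\<lambda>_. 0) (tent d) (\<lambda>_. 0) ?D \<rho>)"
    using L_integrable[OF H1_bdd[OF v1_H1] H1_bdd[OF v2_H1] H1_sqint[OF v1_H1] H1_sqint[OF v2_H1]]
      L_integrable[OF bdd_const H1_bdd[OF tent_H1[OF d]] sqint_const sD, of 0 0] by simp
  finally show ?thesis using V2_scalar[OF v1_H1 o0] by simp
qed

text \<open>All integrals extend over \<open>{0..d}\<close> only, hence the whole expression tends
  to 0 with \<open>d\<close>. The product of the two roots stems from the term with
  \<open>r * Dr h\<close>.\<close>

definition cutoff_bound where "cutoff_bound K d =
   (LINT \<rho>|leb_I. (if \<rho> \<le> d then \<bar>x \<rho> $ 1 * m \<rho> * T1 \<rho> * w \<rho>\<bar> else 0))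
      + K * (sqrt (LINT \<rho>|leb_I. (if \<rho> \<le> d then (Dr (\<lambda>\<rho>. x \<rho> $ 1) \<rho>)\<^sup>2 else 0))
        + sqrt (LINT \<rho>|leb_I. (if \<rho> \<le> d then (Dr h \<rho>)\<^sup>2 else 0))
        + sqrt (LINT \<rho>|leb_I. (if \<rho> \<le> d then (Dr (\<lambda>\<rho>. x \<rho> $ 1) \<rho>)\<^sup>2 else 0))
          * sqrt (LINT \<rho>|leb_I. (if \<rho> \<le> d then (Dr h \<rho>)\<^sup>2 else 0)))"

text \<open>Each term that meets the slope of the tent carries a factor \<open>r\<close> or
  \<open>h\<close>. Both vanish at 0, so on \<open>{0..d}\<close> they are at most the integrals
  \<open>R\<close> and \<open>H\<close> of their derivatives, and by Cauchy-Schwarz these are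
  \<open>sqrt d\<close> times a quantity that tends to 0.\<close>

lemma cutoff_term_bound:
  assumes r0: "x 0 $ 1 = 0"
  obtains K where "0 \<le> K" and "\<And>d. 0 < d \<Longrightarrow> d < 1 \<Longrightarrow>
    \<bar>LINT \<rho>|leb_I. L (\<lambda>_. 0) (tent d) (\<lambda>_. 0) (\<lambda>\<rho>. if \<rho> \<le> d then - 1 / d else 0) \<rho>\<bar>
    \<le> cutoff_bound K d"
proof -
  let ?dr = "Dr (\<lambda>\<rho>. x \<rho> $ 1)"
  \<comment> \<open>Bounded coefficients of \<open>r\<close>, of \<open>r * Dr h\<close> and, up to
    sign, of \<open>h\<close> in the part of the integrand that is multiplied by the slope of the
    tent.\<close>
  define b1 where "b1 \<rho> = 1/2 * \<epsilon>\<^sup>2 * (h \<rho>)\<^sup>2 * T2 \<rho> - (g \<rho> * T2 \<rho> + g' \<rho> * T1 \<rho>)" for \<rho>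
  define b2 where "b2 \<rho> = \<epsilon>\<^sup>2 * T1 \<rho> * (1 / w \<rho>)" for \<rho>
  define b4 where "b4 \<rho> = \<epsilon>\<^sup>2 * T2 \<rho> * T2 \<rho>" for \<rho>
  have "bdd b1" unfolding b1_def[abs_def] by (intro bdd_rules)
  then obtain K1 where K1: "AE \<rho> in leb_I. \<bar>b1 \<rho>\<bar> \<le> K1" unfolding bdd_def by blast
  have "bdd b2" unfolding b2_def[abs_def] by (intro bdd_rules bdd_inverse_w)
  then obtain K2 where K2: "AE \<rho> in leb_I. \<bar>b2 \<rho>\<bar> \<le> K2" unfolding bdd_def by blast
  have "bdd b4" unfolding b4_def[abs_def] by (intro bdd_rules)
  then obtain K4 where K4: "AE \<rho> in leb_I. \<bar>b4 \<rho>\<bar> \<le> K4" unfolding bdd_def by blast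
  define K where "K = \<bar>K1\<bar> + \<bar>K2\<bar> + \<bar>K4\<bar>"
  have K: "AE \<rho> in leb_I. \<bar>b1 \<rho>\<bar> \<le> K \<and> \<bar>b2 \<rho>\<bar> \<le> K \<and> \<bar>b4 \<rho>\<bar> \<le> K"
    using K1 K2 K4 by eventually_elim (auto simp: K_def)
  have "0 \<le> K" by (simp add: K_def)
  have r_sq: "sqint ?dr" by (rule H1_sqint[OF r_H1])
  show thesis
  proof (rule that[OF \<open>0 \<le> K\<close>])
    fix d :: real assume d: "0 < d" "d < 1"
    then have d': "d \<in> {0..1}" "d \<le> 1" by auto
    let ?D = "\<lambda>\<rho>. if \<rho> \<le> d then - 1 / d else 0"
    define A where "A \<rho> = (if \<rho> \<le> d then \<bar>x \<rho> $ 1 * m \<rho> * T1 \<rho> * w \<rho>\<bar> else 0)" for \<rho>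
    define R where "R = (LINT y|leb_I. (if y \<le> d then \<bar>?dr y\<bar> else 0))"
    define H where "H = (LINT y|leb_I. (if y \<le> d then \<bar>Dr h y\<bar> else 0))"
    define hr where "hr \<rho> = (if \<rho> \<le> d then \<bar>Dr h \<rho>\<bar> else 0)" for \<rho>
    define one where "one \<rho> = (if \<rho> \<le> d then 1 else 0 :: real)" for \<rho>
    have R0: "0 \<le> R" unfolding R_def by (rule Bochner_Integration.integral_nonneg) auto
    have H0: "0 \<le> H" unfolding H_def by (rule Bochner_Integration.integral_nonneg) auto
    have iA: "integrable leb_I A"
      unfolding A_def[abs_def]
      by (rule integrable_up_to[OF _ d'(1)], rule integrable_abs) (intro integrable_bdd_w bdd_rules)
    have ihr: "integrable leb_I hr" unfolding hr_def[abs_def]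
      by (rule integrable_up_to[OF _ d'(1)], rule integrable_abs) (rule integrable_sqint[OF hr_sqint])
    have ione: "integrable leb_I one" unfolding one_def[abs_def]
      using integrable_up_to[of "\<lambda>y. 1"] d'(1) by simp
    have Ione: "integral\<^sup>L leb_I one = d" unfolding one_def
      using integral_up_to[OF d'(1), of "\<lambda>_. 1"] d by (simp add: measure_restrict_space)
    have Ihr: "integral\<^sup>L leb_I hr = H" unfolding hr_def[abs_def] H_def ..
    have pt: "AE \<rho> in leb_I. \<bar>L (\<lambda>_. 0) (tent d) (\<lambda>_. 0) ?D \<rho>\<bar>
        \<le> A \<rho> + (K / d) * ((R + H) * one \<rho> + R * hr \<rho>)"
      using K AE_space
    proof eventually_elim
      fix \<rho> assume b: "\<bar>b1 \<rho>\<bar> \<le> K \<and> \<bar>b2 \<rho>\<bar> \<le> K \<and> \<bar>b4 \<rho>\<bar> \<le> K" and "\<rho> \<in> space leb_I"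
      then have \<rho>: "\<rho> \<in> {0..1}" by simp
      show "\<bar>L (\<lambda>_. 0) (tent d) (\<lambda>_. 0) ?D \<rho>\<bar> \<le> A \<rho> + (K / d) * ((R + H) * one \<rho> + R * hr \<rho>)"
      proof (cases "\<rho> \<le> d")
        case True
        have r: "0 \<le> x \<rho> $ 1" "x \<rho> $ 1 \<le> R"
          using abs_cont_diff_le[OF H1_abs_cont[OF r_H1] \<rho> d'(1) True] r0 r_nonneg[OF \<rho>]
          by (auto simp: R_def)
        have hH: "\<bar>h \<rho>\<bar> \<le> H"
          using abs_cont_diff_le[OF H1_abs_cont[OF h_H1] \<rho> d'(1) True] h_0 by (simp add: H_def)
        have "L (\<lambda>_. 0) (tent d) (\<lambda>_. 0) ?D \<rho> = (x \<rho> $ 1 * m \<rho> * T1 \<rho> * w \<rho>) * tent d \<rho>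
            - 1 / d * (x \<rho> $ 1 * b1 \<rho> + x \<rho> $ 1 * (b2 \<rho> * Dr h \<rho>) - h \<rho> * b4 \<rho>)"
          using True unfolding L_def E1_def E2_def E3_def E4_def E5_def E6_def b1_def b2_def b4_def
          by (simp add: algebra_simps add_divide_distrib diff_divide_distrib)
        moreover have "\<bar>(x \<rho> $ 1 * m \<rho> * T1 \<rho> * w \<rho>) * tent d \<rho>\<bar> \<le> A \<rho>"
        proof -
          have "\<bar>tent d \<rho>\<bar> \<le> 1" using d \<rho> by (simp add: tent_def)
          then have "\<bar>x \<rho> $ 1 * m \<rho> * T1 \<rho> * w \<rho>\<bar> * \<bar>tent d \<rho>\<bar> \<le> \<bar>x \<rho> $ 1 * m \<rho> * T1 \<rho> * w \<rho>\<bar> * 1"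
            by (rule mult_left_mono) simp
          then show ?thesis using True by (simp add: A_def abs_mult)
        qed
        moreover have "\<bar>x \<rho> $ 1 * b1 \<rho> + x \<rho> $ 1 * (b2 \<rho> * Dr h \<rho>) - h \<rho> * b4 \<rho>\<bar>
            \<le> K * ((R + H) + R * \<bar>Dr h \<rho>\<bar>)"
        proof -
          have "\<bar>x \<rho> $ 1 * b1 \<rho>\<bar> \<le> R * K"
            unfolding abs_mult by (rule mult_mono) (use r b R0 in auto)
          moreover have "\<bar>x \<rho> $ 1 * (b2 \<rho> * Dr h \<rho>)\<bar> \<le> R * (K * \<bar>Dr h \<rho>\<bar>)"
            unfolding abs_mult by (intro mult_mono) (use r b R0 \<open>0 \<le> K\<close> in auto)
          moreover have "\<bar>h \<rho> * b4 \<rho>\<bar> \<le> H * K"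
            unfolding abs_mult by (rule mult_mono) (use hH b H0 in auto)
          ultimately show ?thesis by (simp add: algebra_simps)
        qed
        then have "\<bar>1 / d * (x \<rho> $ 1 * b1 \<rho> + x \<rho> $ 1 * (b2 \<rho> * Dr h \<rho>) - h \<rho> * b4 \<rho>)\<bar>
            \<le> 1 / d * (K * ((R + H) + R * \<bar>Dr h \<rho>\<bar>))"
          unfolding abs_mult using d by (intro mult_mono) auto
        moreover have "1 / d * (K * ((R + H) + R * \<bar>Dr h \<rho>\<bar>)) = (K / d) * ((R + H) * one \<rho> + R * hr \<rho>)"
          using True by (simp add: one_def hr_def)
        ultimately show ?thesis by linarith
      next
        case False
        then have "tent d \<rho> = 0" using d by (simp add: tent_def)
        then have "L (\<lambda>_. 0) (tent d) (\<lambda>_. 0) ?D \<rho> = 0"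
          using False unfolding L_def E1_def E2_def E3_def E4_def E5_def E6_def by simp
        then show ?thesis using False by (simp add: A_def one_def hr_def)
      qed
    qed
    have iL: "integrable leb_I (L (\<lambda>_. 0) (tent d) (\<lambda>_. 0) ?D)"
    proof (rule L_integrable[OF bdd_const H1_bdd[OF tent_H1[OF d]] sqint_const sqint_bdd])
      show "bdd ?D"
      proof (rule bddI)
        show "\<bar>?D y\<bar> \<le> 1 / d" for y using d by simp
      qed measurable
    qed
    have "\<bar>LINT \<rho>|leb_I. L (\<lambda>_. 0) (tent d) (\<lambda>_. 0) ?D \<rho>\<bar>
        \<le> (LINT \<rho>|leb_I. \<bar>L (\<lambda>_. 0) (tent d) (\<lambda>_. 0) ?D \<rho>\<bar>)"
      by (rule integral_abs_bound)
    also have "\<dots> \<le> (LINT \<rho>|leb_I. A \<rho> + (K / d) * ((R + H) * one \<rho> + R * hr \<rho>))"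
      by (rule integral_mono_AE) (use iL iA ihr ione pt in auto)
    also have "\<dots> = integral\<^sup>L leb_I A + (K / d) * ((R + H) * d + R * H)"
      using iA ihr ione by (simp add: Ione Ihr)
    \<comment> \<open>The critical term is \<open>R * H / d\<close>: one factor
      \<open>1 / sqrt d\<close> goes to each of \<open>R\<close> and \<open>H\<close>, exactly what
      Cauchy-Schwarz allows.\<close>
    also have "\<dots> = integral\<^sup>L leb_I A + K * (R + H + (R / sqrt d) * (H / sqrt d))"
      using d by (simp add: field_simps)
    also have "\<dots> \<le> cutoff_bound K d"
    proof -
      have cs: "I / sqrt d \<le> sqrt J \<and> I \<le> sqrt J" if "I\<^sup>2 \<le> d * J" "0 \<le> I" "0 \<le> J" for I J
      proof -
        have "I \<le> sqrt (d * J)" using that by (simp add: real_le_rsqrt)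
        then have "I \<le> sqrt d * sqrt J" by (simp add: real_sqrt_mult)
        moreover have "sqrt d * sqrt J \<le> 1 * sqrt J" using d that by (intro mult_right_mono) auto
        ultimately show ?thesis using d by (simp add: field_simps)
      qed
      have "R / sqrt d \<le> sqrt (LINT \<rho>|leb_I. (if \<rho> \<le> d then (?dr \<rho>)\<^sup>2 else 0))
          \<and> R \<le> sqrt (LINT \<rho>|leb_I. (if \<rho> \<le> d then (?dr \<rho>)\<^sup>2 else 0))"
        by (rule cs[OF power2_integral_up_to_le[OF r_sq d(1) d'(2), folded R_def] R0])
           (rule Bochner_Integration.integral_nonneg, simp)
      moreover have "H / sqrt d \<le> sqrt (LINT \<rho>|leb_I. (if \<rho> \<le> d then (Dr h \<rho>)\<^sup>2 else 0))
          \<and> H \<le> sqrt (LINT \<rho>|leb_I. (if \<rho> \<le> d then (Dr h \<rho>)\<^sup>2 else 0))"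
        by (rule cs[OF power2_integral_up_to_le[OF hr_sqint d(1) d'(2), folded H_def] H0])
           (rule Bochner_Integration.integral_nonneg, simp)
      ultimately show ?thesis unfolding cutoff_bound_def A_def using d H0 R0 \<open>0 \<le> K\<close>
        by (intro add_mono mult_left_mono mult_mono) auto
    qed
    finally show "\<bar>LINT \<rho>|leb_I. L (\<lambda>_. 0) (tent d) (\<lambda>_. 0) ?D \<rho>\<bar>
    \<le> cutoff_bound K d" .
  qed
qed

text \<open>If the curve starts on the rotation axis, \<open>v 0 $ 2\<close> need not vanish and the velocity is not
  an admissible test function; it is a limit of admissible ones, since \<open>r\<close> and \<open>h\<close> vanish there.\<close>

lemma V2_velocity: "(LINT \<rho>|leb_I. Lv \<rho>) + bdry (\<lambda>\<rho>. v \<rho> $ 1) = 0"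
proof (cases "x 0 $ 1 = 0")
  case False
  then have "v 0 $ 2 = 0" using r_nonneg[of 0] v2_0 by simp
  then have "(\<lambda>\<rho>. v \<rho> $ 2) \<in> H1_0 x" using v2_H1 v2_1 by (simp add: H1_0_def)
  then show ?thesis by (rule V2_scalar[OF v1_H1])
next
  case True
  let ?dr = "Dr (\<lambda>\<rho>. x \<rho> $ 1)" and ?d = "\<lambda>n. 1 / real (n + 2)"
  let ?Q = "\<lambda>n. LINT \<rho>|leb_I. L (\<lambda>_. 0) (tent (?d n)) (\<lambda>_. 0) (\<lambda>\<rho>. if \<rho> \<le> ?d n then - 1 / ?d n else 0) \<rho>"
  obtain K where K: "\<And>d. 0 < d \<Longrightarrow> d < 1 \<Longrightarrow>
    \<bar>LINT \<rho>|leb_I. L (\<lambda>_. 0) (tent d) (\<lambda>_. 0) (\<lambda>\<rho>. if \<rho> \<le> d then - 1 / d else 0) \<rho>\<bar>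
    \<le> cutoff_bound K d"
    using cutoff_term_bound[OF True] by blast
  have i: "integrable leb_I (\<lambda>\<rho>. \<bar>x \<rho> $ 1 * m \<rho> * T1 \<rho> * w \<rho>\<bar>)"
    by (rule integrable_abs) (intro integrable_bdd_w bdd_rules)
  have j: "integrable leb_I (\<lambda>\<rho>. (?dr \<rho>)\<^sup>2)" "integrable leb_I (\<lambda>\<rho>. (Dr h \<rho>)\<^sup>2)"
    using H1_sqint[OF r_H1] hr_sqint by (auto simp: sqint_def)
  have "(\<lambda>n. cutoff_bound K (?d n)) \<longlonglongrightarrow> 0 + K * (sqrt 0 + sqrt 0 + sqrt 0 * sqrt 0)"
    unfolding cutoff_bound_def by (intro tendsto_intros integral_up_to_tendsto_0 i j)
  then have lim: "(\<lambda>n. \<bar>v 0 $ 2\<bar> * cutoff_bound K (?d n)) \<longlonglongrightarrow> 0"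
    using tendsto_mult_right_zero by fastforce
  have "\<bar>(LINT \<rho>|leb_I. Lv \<rho>) + bdry (\<lambda>\<rho>. v \<rho> $ 1)\<bar> \<le> 0"
  proof (rule LIMSEQ_le_const[OF lim], intro exI allI impI)
    fix n :: nat
    have d: "0 < ?d n" "?d n < 1" by simp_all
    have "\<bar>(LINT \<rho>|leb_I. Lv \<rho>) + bdry (\<lambda>\<rho>. v \<rho> $ 1)\<bar> = \<bar>v 0 $ 2\<bar> * \<bar>?Q n\<bar>"
      unfolding V2_cutoff[OF d] abs_mult ..
    also have "\<dots> \<le> \<bar>v 0 $ 2\<bar> * cutoff_bound K (?d n)" by (rule mult_left_mono[OF K[OF d]]) simp
    finally show "\<bar>(LINT \<rho>|leb_I. Lv \<rho>) + bdry (\<lambda>\<rho>. v \<rho> $ 1)\<bar> \<le> \<bar>v 0 $ 2\<bar> * cutoff_bound K (?d n)" .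
  qed
  then show ?thesis by simp
qed

text \<open>The pairings of (V3) with \<open>\<psi> = h\<close> have the integrands \<open>E5\<close>, \<open>M2\<close>, \<open>M3\<close>, \<open>M4\<close>, \<open>- M5\<close>, \<open>E6\<close>, where
  \<open>E5\<close> and \<open>E6\<close> are taken at the velocity.\<close>

definition M2 where "M2 \<rho> = (x \<rho> $ 1 * h \<rho>) * (h' \<rho> * w \<rho>)"
definition M3 where "M3 \<rho> = (x \<rho> $ 1 * T1 \<rho>) * (Dr h \<rho> / w \<rho> * dv2 \<rho>)
   - (x \<rho> $ 1 * T2 \<rho>) * (Dr h \<rho> / w \<rho> * dv1 \<rho>)"
definition M4 where "M4 \<rho> = (x \<rho> $ 1 * (h \<rho>)\<^sup>2 * T1 \<rho>) * dv1 \<rho> + (x \<rho> $ 1 * (h \<rho>)\<^sup>2 * T2 \<rho>) * dv2 \<rho>"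
definition M5 where "M5 \<rho> = (T2 \<rho> * h \<rho> * T1 \<rho>) * dv1 \<rho> + (T2 \<rho> * h \<rho> * T2 \<rho>) * dv2 \<rho>"

lemma dv_sqint: "sqint dv1" "sqint dv2"
  by (rule H1_sqint[OF v1_H1], rule H1_sqint[OF v2_H1])

lemma M_integrable: "integrable leb_I M2" "integrable leb_I M3" "integrable leb_I M4" "integrable leb_I M5"
proof -
  show "integrable leb_I M2" unfolding M2_def[abs_def]
    by (intro integrable_bdd_mult L2_w_integrable h'_L2 bdd_rules)
  show "integrable leb_I M3" unfolding M3_def[abs_def]
    by (intro Bochner_Integration.integrable_diff integrable_bdd_sqint_sqint bdd_rules dv_sqint hr_sqint)
  show "integrable leb_I M4" unfolding M4_def[abs_def]
    by (intro Bochner_Integration.integrable_add integrable_bdd_sqint bdd_rules dv_sqint)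
  show "integrable leb_I M5" unfolding M5_def[abs_def]
    by (intro Bochner_Integration.integrable_add integrable_bdd_sqint bdd_rules dv_sqint)
qed

lemmas v_integrable = E_integrable[OF H1_bdd[OF v1_H1] H1_bdd[OF v2_H1] dv_sqint]

lemma Dv: "AE \<rho> in leb_I. Dr v \<rho> $ 1 = dv1 \<rho> \<and> Dr v \<rho> $ 2 = dv2 \<rho>"
  by (rule Dr_vector[OF v1_H1 v2_H1])

lemma V3_mean_curvature:
  "(LINT \<rho>|leb_I. E5 (\<lambda>\<rho>. v \<rho> $ 1) \<rho>) + (LINT \<rho>|leb_I. M2 \<rho>) + (LINT \<rho>|leb_I. M3 \<rho>)
    + (LINT \<rho>|leb_I. M4 \<rho>) - (LINT \<rho>|leb_I. M5 \<rho>) - (LINT \<rho>|leb_I. E6 (\<lambda>\<rho>. v \<rho> $ 1) \<rho>) = 0"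
proof -
  have 1: "pairing (\<lambda>\<rho>. v \<rho> $ 1 * h \<rho>) (\<lambda>\<rho>. h \<rho> * w \<rho>) = (LINT \<rho>|leb_I. E5 (\<lambda>\<rho>. v \<rho> $ 1) \<rho>)"
    unfolding pairing_def
    by (rule Bochner_Integration.integral_cong) (simp_all add: E5_def power2_eq_square)
  have 2: "pairing (\<lambda>\<rho>. x \<rho> $ 1 * h' \<rho>) (\<lambda>\<rho>. h \<rho> * w \<rho>) = (LINT \<rho>|leb_I. M2 \<rho>)"
    unfolding pairing_def by (rule Bochner_Integration.integral_cong) (simp_all add: M2_def)
  have 3: "pairing (\<lambda>\<rho>. x \<rho> $ 1 * (normal x \<rho> \<bullet> Dr v \<rho>)) (\<lambda>\<rho>. Dr h \<rho> / w \<rho>) = (LINT \<rho>|leb_I. M3 \<rho>)"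
    unfolding pairing_def
  proof (rule integral_leb_I_cong_AE)
    show "AE \<rho> in leb_I. (x \<rho> $ 1 * (normal x \<rho> \<bullet> Dr v \<rho>)) \<bullet> (Dr h \<rho> / w \<rho>) = M3 \<rho>"
      using Dv by eventually_elim (simp add: inner_real_2 normal_nth M3_def T1_def T2_def algebra_simps)
  qed (use M_integrable in auto)
  have 4: "pairing (\<lambda>\<rho>. x \<rho> $ 1 * (Dr x \<rho> \<bullet> Dr v \<rho>) * h \<rho>) (\<lambda>\<rho>. h \<rho> / w \<rho>) = (LINT \<rho>|leb_I. M4 \<rho>)"
    unfolding pairing_def
  proof (rule integral_leb_I_cong_AE)
    show "AE \<rho> in leb_I. (x \<rho> $ 1 * (Dr x \<rho> \<bullet> Dr v \<rho>) * h \<rho>) \<bullet> (h \<rho> / w \<rho>) = M4 \<rho>"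
      using Dv by eventually_elim
        (simp add: inner_real_2 M4_def T1_def T2_def algebra_simps power2_eq_square add_divide_distrib)
  qed (use M_integrable in auto)
  have 5: "pairing (\<lambda>\<rho>. (normal x \<rho> \<bullet> e1) * (Dr x \<rho> \<bullet> Dr v \<rho>)) (\<lambda>\<rho>. h \<rho> / w \<rho>) = (LINT \<rho>|leb_I. - M5 \<rho>)"
    unfolding pairing_def
  proof (rule integral_leb_I_cong_AE)
    show "AE \<rho> in leb_I. ((normal x \<rho> \<bullet> e1) * (Dr x \<rho> \<bullet> Dr v \<rho>)) \<bullet> (h \<rho> / w \<rho>) = - M5 \<rho>"
      using Dv by eventually_elim
        (simp add: inner_real_2 normal_nth e1_nth M5_def T1_def T2_def algebra_simps power2_eq_square add_divide_distrib)
  qed (use M_integrable in auto)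
  have 6: "pairing (\<lambda>\<rho>. v \<rho> $ 1 * k \<rho>) (\<lambda>\<rho>. h \<rho> * w \<rho>) = (LINT \<rho>|leb_I. E6 (\<lambda>\<rho>. v \<rho> $ 1) \<rho>)"
    unfolding pairing_def by (rule Bochner_Integration.integral_cong) (simp_all add: E6_def)
  have "(LINT \<rho>|leb_I. - M5 \<rho>) = - (LINT \<rho>|leb_I. M5 \<rho>)" using M_integrable by simp
  with V3[unfolded V3_def, rule_format, OF h_H1_0] show ?thesis unfolding 1 2 3 4 5 6 by linarith
qed

lemma V1_scalar:
  assumes "\<phi> \<in> H1 x"
  shows "(LINT \<rho>|leb_I. x \<rho> $ 1 * \<phi> \<rho> * (T1 \<rho> * v \<rho> $ 2 - T2 \<rho> * v \<rho> $ 1) * w \<rho>)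
    = - (LINT \<rho>|leb_I. x \<rho> $ 1 * (Dr m \<rho> * Dr \<phi> \<rho>) / w \<rho>)"
proof -
  have 1: "pairing (\<lambda>\<rho>. x \<rho> $ 1 * (v \<rho> \<bullet> normal x \<rho>)) (\<lambda>\<rho>. \<phi> \<rho> * w \<rho>)
      = (LINT \<rho>|leb_I. x \<rho> $ 1 * \<phi> \<rho> * (T1 \<rho> * v \<rho> $ 2 - T2 \<rho> * v \<rho> $ 1) * w \<rho>)"
    unfolding pairing_def
    by (rule Bochner_Integration.integral_cong) (simp_all add: inner_real_2 normal_nth T1_def T2_def algebra_simps)
  have 2: "pairing (\<lambda>\<rho>. x \<rho> $ 1 * Dr m \<rho>) (\<lambda>\<rho>. Dr \<phi> \<rho> / w \<rho>) = (LINT \<rho>|leb_I. x \<rho> $ 1 * (Dr m \<rho> * Dr \<phi> \<rho>) / w \<rho>)"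
    unfolding pairing_def by (rule Bochner_Integration.integral_cong) simp_all
  show ?thesis using V1[unfolded V1_def, rule_format, OF assms] unfolding 1 2 by linarith
qed

text \<open>The first pairing of (V2) at the velocity is the first pairing of (V1) at the test
  function \<open>m\<close>, hence minus the integral of \<open>r * (Dr m)^2 / w\<close>.\<close>

lemma E1_nonpos: "(LINT \<rho>|leb_I. E1 (\<lambda>\<rho>. v \<rho> $ 1) (\<lambda>\<rho>. v \<rho> $ 2) \<rho>) \<le> 0"
proof -
  have "(LINT \<rho>|leb_I. x \<rho> $ 1 * (Dr m \<rho> * Dr m \<rho>) / w \<rho>) \<ge> 0"
    by (rule integral_nonneg_AE, rule AE_I2) (simp add: r_nonneg speed_nonneg)
  then show ?thesis using V1_scalar[OF m_H1] by (simp add: E1_def)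
qed

text \<open>Adding the integrand of (V2) at the velocity to the rate cancels the surface energy
  terms \<open>E2\<close> and \<open>E4\<close>. The curvature terms add up to (V3) at the test
  function \<open>h\<close>: the halves of \<open>E5\<close> and \<open>M4\<close> in the rate meet
  the halves in (V2). Left over are \<open>E1\<close> and the contact line terms; among the latter
  the friction with factor \<open>- 1 / \<eta>\<close> has a sign, and the wetting term is the
  bound.\<close>

lemma energy_dissipation:
  "integrable leb_I (energy_rate \<gamma> \<gamma>' \<epsilon> x v h h')"
  "(LINT \<rho>|leb_I. energy_rate \<gamma> \<gamma>' \<epsilon> x v h h' \<rho>) \<le> \<sigma> * (x 1 $ 1 * v 1 $ 1 - x 0 $ 1 * v 0 $ 1)"
proof -
  let ?v1 = "\<lambda>\<rho>. v \<rho> $ 1" and ?v2 = "\<lambda>\<rho>. v \<rho> $ 2"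
  let ?R = "\<lambda>\<rho>. E4 ?v1 \<rho> + E2 dv1 dv2 \<rho> + \<epsilon>\<^sup>2 * (1/2 * E5 ?v1 \<rho> + M2 \<rho> + 1/2 * M4 \<rho>)"
  have eq: "AE \<rho> in leb_I. energy_rate \<gamma> \<gamma>' \<epsilon> x v h h' \<rho> = ?R \<rho>"
    using Dv
  proof eventually_elim
    fix \<rho> assume D: "Dr v \<rho> $ 1 = dv1 \<rho> \<and> Dr v \<rho> $ 2 = dv2 \<rho>"
    show "energy_rate \<gamma> \<gamma>' \<epsilon> x v h h' \<rho> = ?R \<rho>"
      unfolding energy_rate_def Let_def speed_eq[symmetric] g_def[symmetric] g'_def[symmetric]
        E4_def E2_def E5_def M2_def M4_def T1_def T2_def
      using D by (simp add: algebra_simps add_divide_distrib diff_divide_distrib)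
  qed
  have I: "integrable leb_I ?R"
    using v_integrable M_integrable by auto
  show "integrable leb_I (energy_rate \<gamma> \<gamma>' \<epsilon> x v h h')"
    by (rule integrable_leb_I_cong_AE[OF I eq])
  have "(LINT \<rho>|leb_I. energy_rate \<gamma> \<gamma>' \<epsilon> x v h h' \<rho>) = (LINT \<rho>|leb_I. ?R \<rho>)"
    by (rule integral_leb_I_cong_AE[OF _ eq]) (use I in auto)
  also have "\<dots> = (LINT \<rho>|leb_I. E4 ?v1 \<rho>) + (LINT \<rho>|leb_I. E2 dv1 dv2 \<rho>)
      + \<epsilon>\<^sup>2 * (1/2 * (LINT \<rho>|leb_I. E5 ?v1 \<rho>) + (LINT \<rho>|leb_I. M2 \<rho>) + 1/2 * (LINT \<rho>|leb_I. M4 \<rho>))"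
    using v_integrable M_integrable by simp
  finally have R: "(LINT \<rho>|leb_I. energy_rate \<gamma> \<gamma>' \<epsilon> x v h h' \<rho>) = \<dots>" .
  have E3: "E3 dv1 dv2 \<rho> = M3 \<rho> + 1/2 * M4 \<rho> - M5 \<rho>" for \<rho>
    unfolding E3_def M3_def M4_def M5_def by (simp add: algebra_simps)
  have E3': "(LINT \<rho>|leb_I. E3 dv1 dv2 \<rho>) = (LINT \<rho>|leb_I. M3 \<rho>) + 1/2 * (LINT \<rho>|leb_I. M4 \<rho>) - (LINT \<rho>|leb_I. M5 \<rho>)"
    unfolding E3 using M_integrable by simp
  have L: "(LINT \<rho>|leb_I. Lv \<rho>) = (LINT \<rho>|leb_I. E1 ?v1 ?v2 \<rho>) - (LINT \<rho>|leb_I. E2 dv1 dv2 \<rho>)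
      + \<epsilon>\<^sup>2 * ((LINT \<rho>|leb_I. M3 \<rho>) + 1/2 * (LINT \<rho>|leb_I. M4 \<rho>) - (LINT \<rho>|leb_I. M5 \<rho>))
      - (LINT \<rho>|leb_I. E4 ?v1 \<rho>) + \<epsilon>\<^sup>2 / 2 * (LINT \<rho>|leb_I. E5 ?v1 \<rho>) - \<epsilon>\<^sup>2 * (LINT \<rho>|leb_I. E6 ?v1 \<rho>)"
    unfolding E3'[symmetric] L_def using v_integrable by simp
  have "(LINT \<rho>|leb_I. energy_rate \<gamma> \<gamma>' \<epsilon> x v h h' \<rho>) + (LINT \<rho>|leb_I. Lv \<rho>)
      = (LINT \<rho>|leb_I. E1 ?v1 ?v2 \<rho>) + \<epsilon>\<^sup>2 * ((LINT \<rho>|leb_I. E5 ?v1 \<rho>) + (LINT \<rho>|leb_I. M2 \<rho>) + (LINT \<rho>|leb_I. M3 \<rho>)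
    + (LINT \<rho>|leb_I. M4 \<rho>) - (LINT \<rho>|leb_I. M5 \<rho>) - (LINT \<rho>|leb_I. E6 ?v1 \<rho>))"
    unfolding R L by (simp add: algebra_simps)
  also have "\<dots> \<le> 0" unfolding V3_mean_curvature using E1_nonpos by simp
  finally have "(LINT \<rho>|leb_I. energy_rate \<gamma> \<gamma>' \<epsilon> x v h h' \<rho>) \<le> bdry ?v1" using V2_velocity by linarith
  also have "\<dots> \<le> \<sigma> * (x 1 $ 1 * v 1 $ 1 - x 0 $ 1 * v 0 $ 1)"
  proof -
    have "0 \<le> 1 / \<eta> * (x 0 $ 1 * (v 0 $ 1 * v 0 $ 1) + x 1 $ 1 * (v 1 $ 1 * v 1 $ 1))"
      using \<eta>_pos mult_nonneg_nonneg[OF r_nonneg[of 0] zero_le_square[of "v 0 $ 1"]]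
        mult_nonneg_nonneg[OF r_nonneg[of 1] zero_le_square[of "v 1 $ 1"]]
      by (intro mult_nonneg_nonneg[of "1 / \<eta>"]) auto
    then show ?thesis unfolding bdry_def by (simp add: mult.assoc)
  qed
  finally show "(LINT \<rho>|leb_I. energy_rate \<gamma> \<gamma>' \<epsilon> x v h h' \<rho>) \<le> \<sigma> * (x 1 $ 1 * v 1 $ 1 - x 0 $ 1 * v 0 $ 1)" .
qed

text \<open>The rate is the \<open>\<rho>\<close>-derivative of \<open>r * z * v\<^sub>1\<close>
  plus the normal flux \<open>r * (v \<bullet> n) * w\<close>. The derivative integrates to 0,
  because \<open>z\<close> vanishes at the outer end and \<open>r\<close> or \<open>z\<close> at the
  inner one; the flux integrates to 0 by (V1) with a constant test function.\<close>

lemma volume_conservation: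
  "integrable leb_I (volume_rate x v)" "(LINT \<rho>|leb_I. volume_rate x v \<rho>) = 0"
proof -
  let ?r = "\<lambda>\<rho>. x \<rho> $ 1" and ?z = "\<lambda>\<rho>. x \<rho> $ 2" and ?v1 = "\<lambda>\<rho>. v \<rho> $ 1"
  let ?P = "\<lambda>y. (Dr ?r y * ?z y + ?r y * Dr ?z y) * ?v1 y + ?r y * ?z y * Dr ?v1 y"
  let ?N = "\<lambda>\<rho>. x \<rho> $ 1 * 1 * (T1 \<rho> * v \<rho> $ 2 - T2 \<rho> * v \<rho> $ 1) * w \<rho>"
  have P: "integrable leb_I ?P" "(LINT y|leb_I. ?P y) = 0"
  proof -
    note p = integral_product_rule3[OF H1_abs_cont[OF r_H1] H1_abs_cont[OF z_H1] H1_abs_cont[OF v1_H1]]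
    show "integrable leb_I ?P" by (rule p(1))
    have "x 0 $ 1 = 0 \<or> x 0 $ 2 = 0" using r_nonneg[of 0] z_0 by force
    then show "(LINT y|leb_I. ?P y) = 0" unfolding p(2) using z_1 by auto
  qed
  have N: "integrable leb_I ?N" by (intro integrable_bdd_w bdd_rules)
  have D1: "Dr (\<lambda>_. 1 :: real) \<rho> = 0" for \<rho> by (simp add: Dr_def)
  have N0: "(LINT \<rho>|leb_I. ?N \<rho>) = 0" using V1_scalar[OF one_H1] by (simp add: D1)
  have eq: "AE \<rho> in leb_I. volume_rate x v \<rho> = ?P \<rho> + ?N \<rho>"
    using Dv Dr_vector[OF r_H1 z_H1] speed_ge
  proof eventually_elim
    fix \<rho> assume "Dr v \<rho> $ 1 = dv1 \<rho> \<and> Dr v \<rho> $ 2 = dv2 \<rho>"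
      "Dr x \<rho> $ 1 = Dr ?r \<rho> \<and> Dr x \<rho> $ 2 = Dr ?z \<rho>" "c \<le> w \<rho>"
    then show "volume_rate x v \<rho> = ?P \<rho> + ?N \<rho>"
      using c_pos by (simp add: volume_rate_def T1_def T2_def algebra_simps)
  qed
  show "integrable leb_I (volume_rate x v)"
    by (rule integrable_leb_I_cong_AE[OF _ eq]) (use P N in simp)
  have "(LINT \<rho>|leb_I. volume_rate x v \<rho>) = (LINT \<rho>|leb_I. ?P \<rho> + ?N \<rho>)"
    by (rule integral_leb_I_cong_AE[OF _ eq]) (use P N in auto)
  also have "\<dots> = 0" using P N N0 by simp
  finally show "(LINT \<rho>|leb_I. volume_rate x v \<rho>) = 0" .
qed

end

section \<open>Bounds on the rates that are uniform in time\<close>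

lemma le_one_add_cube: "0 \<le> a \<Longrightarrow> (a :: real) \<le> 1 + a\<^sup>2 * a"
proof (cases "a \<le> 1")
  case False
  then have "1 * a \<le> a\<^sup>2 * a" by (intro mult_right_mono) auto
  then show ?thesis by simp
next
  case True
  moreover assume "0 \<le> a"
  then have "0 \<le> a\<^sup>2 * a" by simp
  ultimately show ?thesis by linarith
qed

lemma abs_le_one_add_square: "\<bar>a :: real\<bar> \<le> 1 + a\<^sup>2"
  using sum_squares_bound[of 1 "\<bar>a\<bar>"] by simp

text \<open>Lagrange's identity: the squares of the cross and the dot product add up to the squared
  product of the norms.\<close>

lemma abs_cross_le: "\<bar>a * d - b * e\<bar> \<le> plane_norm a b * plane_norm e d"
  and abs_dot_le: "\<bar>a * e + b * d\<bar> \<le> plane_norm a b * plane_norm e d"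
proof -
  have "(a * d - b * e)\<^sup>2 + (a * e + b * d)\<^sup>2 = (plane_norm a b * plane_norm e d)\<^sup>2"
    unfolding power_mult_distrib plane_norm_power2 by (simp add: power2_eq_square algebra_simps)
  then have "(a * d - b * e)\<^sup>2 \<le> (plane_norm a b * plane_norm e d)\<^sup>2"
    "(a * e + b * d)\<^sup>2 \<le> (plane_norm a b * plane_norm e d)\<^sup>2"
    using zero_le_power2[of "a * d - b * e"] zero_le_power2[of "a * e + b * d"] by linarith+
  then show "\<bar>a * d - b * e\<bar> \<le> plane_norm a b * plane_norm e d"
    "\<bar>a * e + b * d\<bar> \<le> plane_norm a b * plane_norm e d"
    using abs_le_square_iff[of "a * d - b * e" "plane_norm a b * plane_norm e d"]
      abs_le_square_iff[of "a * e + b * d" "plane_norm a b * plane_norm e d"]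
    by (simp_all only: abs_mult abs_of_nonneg[OF plane_norm_nonneg])
qed

context nondegenerate_curve begin

lemma L2_integral_abs_le:
  assumes "f \<in> L2 x" "(LINT \<rho>|leb_I. \<bar>f \<rho>\<bar>\<^sup>2 * w \<rho>) \<le> C"
  shows "(LINT \<rho>|leb_I. \<bar>f \<rho>\<bar>) \<le> 1 + C / c"
proof -
  have I: "integrable leb_I (\<lambda>\<rho>. \<bar>f \<rho>\<bar>\<^sup>2 * w \<rho>)" using assms by (simp add: L2_def)
  have "(LINT \<rho>|leb_I. \<bar>f \<rho>\<bar>) \<le> (LINT \<rho>|leb_I. 1 + 1 / c * (\<bar>f \<rho>\<bar>\<^sup>2 * w \<rho>))"
  proof (rule integral_mono_AE)
    show "AE \<rho> in leb_I. \<bar>f \<rho>\<bar> \<le> 1 + 1 / c * (\<bar>f \<rho>\<bar>\<^sup>2 * w \<rho>)"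
      using speed_ge
    proof eventually_elim
      fix \<rho> assume "c \<le> w \<rho>"
      then have "(f \<rho>)\<^sup>2 * c \<le> (f \<rho>)\<^sup>2 * w \<rho>" by (intro mult_left_mono) auto
      then have "(f \<rho>)\<^sup>2 \<le> 1 / c * (\<bar>f \<rho>\<bar>\<^sup>2 * w \<rho>)" using c_pos by (simp add: field_simps)
      then show "\<bar>f \<rho>\<bar> \<le> 1 + 1 / c * (\<bar>f \<rho>\<bar>\<^sup>2 * w \<rho>)" using abs_le_one_add_square[of "f \<rho>"] by linarith
    qed
  qed (use I integrable_sqint[OF L2_sqint[OF assms(1)]] in auto)
  also have "\<dots> = 1 + 1 / c * (LINT \<rho>|leb_I. \<bar>f \<rho>\<bar>\<^sup>2 * w \<rho>)" using I by simp
  also have "\<dots> \<le> 1 + 1 / c * C" using assms(2) c_pos by (intro add_mono mult_left_mono) auto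
  finally show ?thesis by simp
qed

text \<open>The supremum bound uses one integral of \<open>\<bar>u\<bar>\<close> and two of
  \<open>\<bar>Dr u\<bar>\<close>; each is at most \<open>1 + C / c\<close>, as
  \<open>\<bar>f\<bar> \<le> 1 + f^2\<close> and the weight is at least \<open>c\<close>.\<close>

lemma H1_bound:
  assumes "u \<in> H1 x" "(LINT \<rho>|leb_I. \<bar>u \<rho>\<bar>\<^sup>2 * w \<rho>) \<le> C" "(LINT \<rho>|leb_I. \<bar>Dr u \<rho>\<bar>\<^sup>2 * w \<rho>) \<le> C"
    and "\<rho> \<in> {0..1}"
  shows "\<bar>u \<rho>\<bar> \<le> 3 * (1 + C / c)"
proof -
  have "\<bar>u \<rho>\<bar> \<le> (LINT y|leb_I. \<bar>u y\<bar>) + 2 * (LINT y|leb_I. \<bar>Dr u y\<bar>)"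
    by (rule abs_cont_bound[OF H1_abs_cont[OF assms(1)] assms(4) integrable_sqint[OF L2_sqint[OF H1_L2[OF assms(1)]]]])
  moreover have "(LINT y|leb_I. \<bar>u y\<bar>) \<le> 1 + C / c" by (rule L2_integral_abs_le[OF H1_L2[OF assms(1)] assms(2)])
  moreover have "(LINT y|leb_I. \<bar>Dr u y\<bar>) \<le> 1 + C / c" by (rule L2_integral_abs_le[OF H1_Dr_L2[OF assms(1)] assms(3)])
  ultimately have "\<bar>u \<rho>\<bar> \<le> (1 + C / c) + 2 * (1 + C / c)"
    by (meson add_mono mult_left_mono order_trans zero_le_numeral)
  then show ?thesis by simp
qed

lemma normsq_integrable:
  fixes u :: "real \<Rightarrow> real^2"
  assumes "(\<lambda>\<rho>. u \<rho> $ 1) \<in> L2 x" "(\<lambda>\<rho>. u \<rho> $ 2) \<in> L2 x"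
  shows "integrable leb_I (\<lambda>\<rho>. (norm (u \<rho>))\<^sup>2 * w \<rho>)"
  using assms unfolding norm_real_2 plane_norm_power2 distrib_right by (simp add: L2_def)

lemma normsq_nth_le:
  fixes u :: "real \<Rightarrow> real^2"
  assumes "(\<lambda>\<rho>. u \<rho> $ 1) \<in> L2 x" "(\<lambda>\<rho>. u \<rho> $ 2) \<in> L2 x" "normsq x u \<le> C"
  shows "(LINT \<rho>|leb_I. \<bar>u \<rho> $ 1\<bar>\<^sup>2 * w \<rho>) \<le> C" "(LINT \<rho>|leb_I. \<bar>u \<rho> $ 2\<bar>\<^sup>2 * w \<rho>) \<le> C"
proof -
  have I: "integrable leb_I (\<lambda>\<rho>. (u \<rho> $ 1)\<^sup>2 * w \<rho>)" "integrable leb_I (\<lambda>\<rho>. (u \<rho> $ 2)\<^sup>2 * w \<rho>)"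
    using assms by (simp_all add: L2_def)
  have "0 \<le> (LINT \<rho>|leb_I. (u \<rho> $ 1)\<^sup>2 * w \<rho>)" "0 \<le> (LINT \<rho>|leb_I. (u \<rho> $ 2)\<^sup>2 * w \<rho>)"
    by (rule integral_nonneg_AE, simp add: speed_nonneg)+
  moreover have "normsq x u = (LINT \<rho>|leb_I. (u \<rho> $ 1)\<^sup>2 * w \<rho>) + (LINT \<rho>|leb_I. (u \<rho> $ 2)\<^sup>2 * w \<rho>)"
    using I unfolding normsq_def norm_real_2 plane_norm_power2 distrib_right by simp
  ultimately show "(LINT \<rho>|leb_I. \<bar>u \<rho> $ 1\<bar>\<^sup>2 * w \<rho>) \<le> C" "(LINT \<rho>|leb_I. \<bar>u \<rho> $ 2\<bar>\<^sup>2 * w \<rho>) \<le> C"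
    using assms(3) by auto
qed

lemma Dr_vector_L2:
  fixes u :: "real \<Rightarrow> real^2"
  assumes "(\<lambda>\<rho>. u \<rho> $ 1) \<in> H1 x" "(\<lambda>\<rho>. u \<rho> $ 2) \<in> H1 x"
  shows "(\<lambda>\<rho>. Dr u \<rho> $ 1) \<in> L2 x" "(\<lambda>\<rho>. Dr u \<rho> $ 2) \<in> L2 x"
proof -
  have D: "AE \<rho> in leb_I. Dr u \<rho> $ 1 = Dr (\<lambda>\<rho>. u \<rho> $ 1) \<rho>" "AE \<rho> in leb_I. Dr u \<rho> $ 2 = Dr (\<lambda>\<rho>. u \<rho> $ 2) \<rho>"
    using Dr_vector[OF assms] by auto
  show "(\<lambda>\<rho>. Dr u \<rho> $ 1) \<in> L2 x" "(\<lambda>\<rho>. Dr u \<rho> $ 2) \<in> L2 x"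
    by (rule L2_cong_AE[OF H1_Dr_L2[OF assms(1)] D(1)], rule L2_cong_AE[OF H1_Dr_L2[OF assms(2)] D(2)])
qed

lemma H1_vector_bound:
  fixes u :: "real \<Rightarrow> real^2"
  assumes "(\<lambda>\<rho>. u \<rho> $ 1) \<in> H1 x" "(\<lambda>\<rho>. u \<rho> $ 2) \<in> H1 x" "normsq x u \<le> C" "normsq x (Dr u) \<le> C"
    and "\<rho> \<in> {0..1}"
  shows "\<bar>u \<rho> $ 1\<bar> \<le> 3 * (1 + C / c)" "\<bar>u \<rho> $ 2\<bar> \<le> 3 * (1 + C / c)"
proof -
  note D = normsq_nth_le[OF Dr_vector_L2[OF assms(1,2)] assms(4)]
  have m: "(\<lambda>\<rho>. \<bar>Dr u \<rho> $ 1\<bar>\<^sup>2 * w \<rho>) \<in> borel_measurable leb_I" "(\<lambda>\<rho>. \<bar>Dr u \<rho> $ 2\<bar>\<^sup>2 * w \<rho>) \<in> borel_measurable leb_I"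
    using Dr_vector_L2[OF assms(1,2)] by (auto simp: L2_def)
  have e: "AE \<rho> in leb_I. \<bar>Dr (\<lambda>\<rho>. u \<rho> $ 1) \<rho>\<bar>\<^sup>2 * w \<rho> = \<bar>Dr u \<rho> $ 1\<bar>\<^sup>2 * w \<rho>"
    "AE \<rho> in leb_I. \<bar>Dr (\<lambda>\<rho>. u \<rho> $ 2) \<rho>\<bar>\<^sup>2 * w \<rho> = \<bar>Dr u \<rho> $ 2\<bar>\<^sup>2 * w \<rho>"
    using Dr_vector[OF assms(1,2)] by (eventually_elim, simp)+
  have "(LINT \<rho>|leb_I. \<bar>Dr (\<lambda>\<rho>. u \<rho> $ 1) \<rho>\<bar>\<^sup>2 * w \<rho>) \<le> C"
    using D(1) integral_leb_I_cong_AE[OF m(1) e(1)] by simp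
  then show "\<bar>u \<rho> $ 1\<bar> \<le> 3 * (1 + C / c)"
    using H1_bound[OF assms(1) normsq_nth_le(1)[OF H1_L2[OF assms(1)] H1_L2[OF assms(2)] assms(3)]] assms(5) by blast
  have "(LINT \<rho>|leb_I. \<bar>Dr (\<lambda>\<rho>. u \<rho> $ 2) \<rho>\<bar>\<^sup>2 * w \<rho>) \<le> C"
    using D(2) integral_leb_I_cong_AE[OF m(2) e(2)] by simp
  then show "\<bar>u \<rho> $ 2\<bar> \<le> 3 * (1 + C / c)"
    using H1_bound[OF assms(2) normsq_nth_le(2)[OF H1_L2[OF assms(1)] H1_L2[OF assms(2)] assms(3)]] assms(5) by blast
qed

end

text \<open>The divisions by the speed do no harm: dot and cross products of \<open>Dr x\<close> and
  \<open>Dr v\<close> are at most the speed times \<open>norm (Dr v \<rho>)\<close>. So only the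
  speed, \<open>norm (Dr v \<rho>)\<close> and \<open>\<bar>h' \<rho>\<bar>\<close> times the speed
  remain, with constant coefficients.\<close>

lemma energy_rate_le:
  fixes x v :: "real \<Rightarrow> real^2"
  assumes G: "\<And>a b. \<bar>\<gamma> (plane_angle a b)\<bar> \<le> \<Gamma>" "\<And>a b. \<bar>\<gamma>' (plane_angle a b)\<bar> \<le> \<Gamma>"
    and B: "\<bar>x \<rho> $ 1\<bar> \<le> B" "\<bar>v \<rho> $ 1\<bar> \<le> B" "\<bar>h \<rho>\<bar> \<le> B"
    and s: "0 < speed x \<rho>"
  shows "\<bar>energy_rate \<gamma> \<gamma>' \<epsilon> x v h h' \<rho>\<bar> \<le> B * (\<Gamma> * speed x \<rho>) + B * (2 * \<Gamma> * norm (Dr v \<rho>))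
    + \<epsilon>\<^sup>2 / 2 * (B * B\<^sup>2 * speed x \<rho> + B * (2 * B * (\<bar>h' \<rho>\<bar> * speed x \<rho>)) + B * B\<^sup>2 * norm (Dr v \<rho>))"
proof -
  let ?a = "Dr x \<rho> $ 1" and ?b = "Dr x \<rho> $ 2" and ?a' = "Dr v \<rho> $ 1" and ?b' = "Dr v \<rho> $ 2"
  let ?w = "speed x \<rho>" and ?q = "norm (Dr v \<rho>)" and ?\<theta> = "plane_angle (Dr x \<rho> $ 1) (Dr x \<rho> $ 2)"
  have B0: "0 \<le> B" using B(1) by linarith
  have G0: "0 \<le> \<Gamma>" using G(1)[of 0 0] by linarith
  have dot: "\<bar>?a * ?a' + ?b * ?b'\<bar> \<le> ?w * ?q" and cross: "\<bar>?a * ?b' - ?b * ?a'\<bar> \<le> ?w * ?q"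
    unfolding speed_eq norm_real_2 by (rule abs_dot_le, rule abs_cross_le)
  have q: "\<bar>(?a * ?a' + ?b * ?b') / ?w\<bar> \<le> ?q"
    using dot s by (simp add: abs_divide divide_le_eq mult.commute)
  have hB: "(h \<rho>)\<^sup>2 \<le> B\<^sup>2" using B(3) by (metis abs_le_square_iff abs_of_nonneg B0)
  have 1: "\<bar>v \<rho> $ 1 * (\<gamma> ?\<theta> * ?w)\<bar> \<le> B * (\<Gamma> * ?w)"
    unfolding abs_mult using s by (intro mult_mono B G) (auto simp: G0 B0)
  have "\<bar>\<gamma> ?\<theta> * (?a * ?a' + ?b * ?b')\<bar> \<le> \<Gamma> * (?w * ?q)" "\<bar>\<gamma>' ?\<theta> * (?a * ?b' - ?b * ?a')\<bar> \<le> \<Gamma> * (?w * ?q)"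
    unfolding abs_mult by (intro mult_mono G dot cross, auto simp: G0)+
  then have "\<bar>\<gamma> ?\<theta> * (?a * ?a' + ?b * ?b') + \<gamma>' ?\<theta> * (?a * ?b' - ?b * ?a')\<bar> \<le> 2 * \<Gamma> * ?q * ?w"
    by (simp add: algebra_simps)
  then have "\<bar>(\<gamma> ?\<theta> * (?a * ?a' + ?b * ?b') + \<gamma>' ?\<theta> * (?a * ?b' - ?b * ?a')) / ?w\<bar> \<le> 2 * \<Gamma> * ?q"
    using s by (simp add: abs_divide divide_le_eq)
  then have 2: "\<bar>x \<rho> $ 1 * ((\<gamma> ?\<theta> * (?a * ?a' + ?b * ?b') + \<gamma>' ?\<theta> * (?a * ?b' - ?b * ?a')) / ?w)\<bar> \<le> B * (2 * \<Gamma> * ?q)"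
    unfolding abs_mult[of "x \<rho> $ 1"] by (intro mult_mono B) (auto simp: B0)
  have 3: "\<bar>v \<rho> $ 1 * (h \<rho>)\<^sup>2 * ?w\<bar> \<le> B * B\<^sup>2 * ?w"
    unfolding abs_mult using s hB by (intro mult_mono B) (auto simp: B0)
  have "\<bar>x \<rho> $ 1\<bar> * (2 * \<bar>h \<rho>\<bar> * (\<bar>h' \<rho>\<bar> * ?w)) \<le> B * (2 * B * (\<bar>h' \<rho>\<bar> * ?w))"
    using s by (intro mult_mono B) (auto simp: B0 B)
  then have 4: "\<bar>x \<rho> $ 1 * (2 * h \<rho> * h' \<rho>) * ?w\<bar> \<le> B * (2 * B * (\<bar>h' \<rho>\<bar> * ?w))"
    using s by (simp add: abs_mult mult.assoc)
  have 5: "\<bar>x \<rho> $ 1 * (h \<rho>)\<^sup>2 * ((?a * ?a' + ?b * ?b') / ?w)\<bar> \<le> B * B\<^sup>2 * ?q"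
    unfolding abs_mult using q hB by (intro mult_mono B) (auto simp: B0 abs_mult)
  have "\<bar>v \<rho> $ 1 * (h \<rho>)\<^sup>2 * ?w + x \<rho> $ 1 * (2 * h \<rho> * h' \<rho>) * ?w + x \<rho> $ 1 * (h \<rho>)\<^sup>2 * ((?a * ?a' + ?b * ?b') / ?w)\<bar>
      \<le> B * B\<^sup>2 * ?w + B * (2 * B * (\<bar>h' \<rho>\<bar> * ?w)) + B * B\<^sup>2 * ?q"
    using 3 4 5 by linarith
  then have "\<bar>\<epsilon>\<^sup>2 / 2 * (v \<rho> $ 1 * (h \<rho>)\<^sup>2 * ?w + x \<rho> $ 1 * (2 * h \<rho> * h' \<rho>) * ?w + x \<rho> $ 1 * (h \<rho>)\<^sup>2 * ((?a * ?a' + ?b * ?b') / ?w))\<bar>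
      \<le> \<epsilon>\<^sup>2 / 2 * (B * B\<^sup>2 * ?w + B * (2 * B * (\<bar>h' \<rho>\<bar> * ?w)) + B * B\<^sup>2 * ?q)"
    unfolding abs_mult[of "\<epsilon>\<^sup>2 / 2"] by (simp add: mult_left_mono)
  then show ?thesis
    unfolding energy_rate_def Let_def speed_eq[symmetric] using 1 2 by linarith
qed

lemma volume_rate_le:
  fixes x v :: "real \<Rightarrow> real^2"
  assumes B: "\<bar>x \<rho> $ 1\<bar> \<le> B" "\<bar>x \<rho> $ 2\<bar> \<le> B" "\<bar>v \<rho> $ 1\<bar> \<le> B" "\<bar>v \<rho> $ 2\<bar> \<le> B"
  shows "\<bar>volume_rate x v \<rho>\<bar> \<le> 2 * (B * B * speed x \<rho>) + B * B * norm (Dr v \<rho>)"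
proof -
  have B0: "0 \<le> B" using B(1) by linarith
  have p: "\<bar>Dr x \<rho> $ 1\<bar> \<le> speed x \<rho>" "\<bar>Dr v \<rho> $ 1\<bar> \<le> norm (Dr v \<rho>)"
    unfolding speed_eq norm_real_2 by (rule abs_le_plane_norm)+
  have "\<bar>v \<rho> $ 1 * x \<rho> $ 2 * Dr x \<rho> $ 1\<bar> \<le> B * B * speed x \<rho>"
    "\<bar>x \<rho> $ 1 * v \<rho> $ 2 * Dr x \<rho> $ 1\<bar> \<le> B * B * speed x \<rho>"
    "\<bar>x \<rho> $ 1 * x \<rho> $ 2 * Dr v \<rho> $ 1\<bar> \<le> B * B * norm (Dr v \<rho>)"
    unfolding abs_mult by (intro mult_mono B p, auto simp: B0)+
  then show ?thesis unfolding volume_rate_def by linarith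
qed

context film_state begin

text \<open>The bounds involve only \<open>c\<close>, \<open>C\<close>, \<open>\<Gamma>\<close> and
  \<open>\<epsilon>\<close>, which are the same for all times of a window, whereas the pointwise
  majorant used on the way varies with the state.\<close>

lemma rates_bounded:
  assumes C: "normsq x x \<le> C" "normsq x (Dr x) \<le> C" "normsq x v \<le> C" "normsq x (Dr v) \<le> C"
      "normsq x h \<le> C" "normsq x (Dr h) \<le> C" "normsq x h' \<le> C"
    and G: "\<And>a b. \<bar>\<gamma> (plane_angle a b)\<bar> \<le> \<Gamma>" "\<And>a b. \<bar>\<gamma>' (plane_angle a b)\<bar> \<le> \<Gamma>"
    and B: "B = 3 * (1 + C / c)"
  shows "(LINT \<rho>|leb_I. \<bar>energy_rate \<gamma> \<gamma>' \<epsilon> x v h h' \<rho>\<bar>)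
      \<le> (B * \<Gamma> + B * (2 * \<Gamma> * (1 + 1 / c)) + \<epsilon>\<^sup>2 / 2 * (B * B\<^sup>2 + B * (2 * B) + B * B\<^sup>2 * (1 + 1 / c))) * (1 + 3 * C)"
      (is "_ \<le> ?K * _")
    and "(LINT \<rho>|leb_I. \<bar>volume_rate x v \<rho>\<bar>) \<le> (2 * (B * B) + B * B * (1 + 1 / c)) * (1 + 3 * C)"
      (is "_ \<le> ?K' * _")
proof -
  \<comment> \<open>One majorant, up to constants, for all the unbounded factors in the rates; its
    integral is 1 plus three of the norms bounded by \<open>C\<close>.\<close>
  define D where "D \<rho> = 1 + (norm (Dr x \<rho>))\<^sup>2 * w \<rho> + (norm (Dr v \<rho>))\<^sup>2 * w \<rho> + (h' \<rho>)\<^sup>2 * w \<rho>" for \<rho>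
  have I: "integrable leb_I (\<lambda>\<rho>. (norm (Dr x \<rho>))\<^sup>2 * w \<rho>)" "integrable leb_I (\<lambda>\<rho>. (norm (Dr v \<rho>))\<^sup>2 * w \<rho>)"
    "integrable leb_I (\<lambda>\<rho>. (h' \<rho>)\<^sup>2 * w \<rho>)"
    using normsq_integrable[OF Dr_vector_L2[OF r_H1 z_H1]] normsq_integrable[OF Dr_vector_L2[OF v1_H1 v2_H1]] h'_L2
    by (simp_all add: L2_def)
  then have ID: "integrable leb_I D" unfolding D_def[abs_def] by simp
  have "(LINT \<rho>|leb_I. D \<rho>) = 1 + normsq x (Dr x) + normsq x (Dr v) + normsq x h'"
    unfolding D_def normsq_def using I by simp
  then have intD: "(LINT \<rho>|leb_I. D \<rho>) \<le> 1 + 3 * C" using C by linarith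
  have bx: "\<bar>x \<rho> $ 1\<bar> \<le> B" "\<bar>x \<rho> $ 2\<bar> \<le> B" "\<bar>v \<rho> $ 1\<bar> \<le> B" "\<bar>v \<rho> $ 2\<bar> \<le> B" if "\<rho> \<in> {0..1}" for \<rho>
    unfolding B using H1_vector_bound[OF r_H1 z_H1 C(1,2) that] H1_vector_bound[OF v1_H1 v2_H1 C(3,4) that] by auto
  have bh: "\<bar>h \<rho>\<bar> \<le> B" if "\<rho> \<in> {0..1}" for \<rho>
    unfolding B using H1_bound[OF h_H1, of C] C(5,6) that by (simp add: normsq_def)
  have B0: "0 \<le> B" using bh[of 0] by simp
  have G0: "0 \<le> \<Gamma>" using G(1)[of 0 0] by linarith
  have dom: "w \<rho> \<le> D \<rho> \<and> norm (Dr v \<rho>) \<le> (1 + 1 / c) * D \<rho> \<and> \<bar>h' \<rho>\<bar> * w \<rho> \<le> D \<rho>" if c: "c \<le> w \<rho>" for \<rho>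
  proof -
    have nn: "0 \<le> (norm (Dr x \<rho>))\<^sup>2 * w \<rho>" "0 \<le> (norm (Dr v \<rho>))\<^sup>2 * w \<rho>" "0 \<le> (h' \<rho>)\<^sup>2 * w \<rho>"
      by (simp_all add: speed_nonneg)
    \<comment> \<open>\<open>normsq x (Dr x)\<close> is the integral of the cube of the speed, so
      this is the power that has to control the speed itself.\<close>
    have w3: "w \<rho> \<le> 1 + (norm (Dr x \<rho>))\<^sup>2 * w \<rho>"
      using le_one_add_cube[of "w \<rho>"] by (simp add: speed_def)
    have "(norm (Dr v \<rho>))\<^sup>2 * c \<le> (norm (Dr v \<rho>))\<^sup>2 * w \<rho>" using c by (intro mult_left_mono) auto
    then have "(norm (Dr v \<rho>))\<^sup>2 \<le> 1 / c * ((norm (Dr v \<rho>))\<^sup>2 * w \<rho>)" using c_pos by (simp add: field_simps)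
    also have "\<dots> \<le> 1 / c * D \<rho>" unfolding D_def using nn c_pos by (intro mult_left_mono) auto
    finally have q2: "(norm (Dr v \<rho>))\<^sup>2 \<le> 1 / c * D \<rho>" .
    have "1 \<le> D \<rho>" unfolding D_def using nn by linarith
    then have q: "norm (Dr v \<rho>) \<le> D \<rho> + 1 / c * D \<rho>"
      using abs_le_one_add_square[of "norm (Dr v \<rho>)"] q2 by simp
    have "\<bar>h' \<rho>\<bar> * w \<rho> \<le> (1 + (h' \<rho>)\<^sup>2) * w \<rho>" by (intro mult_right_mono abs_le_one_add_square speed_nonneg)
    then have "\<bar>h' \<rho>\<bar> * w \<rho> \<le> w \<rho> + (h' \<rho>)\<^sup>2 * w \<rho>" by (simp add: algebra_simps)
    then show ?thesis using w3 nn q unfolding D_def by (simp add: algebra_simps)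
  qed
  have integrate: "(LINT \<rho>|leb_I. \<bar>f \<rho>\<bar>) \<le> K * (1 + 3 * C)"
    if "integrable leb_I f" "AE \<rho> in leb_I. \<bar>f \<rho>\<bar> \<le> K * D \<rho>" "0 \<le> K" for f :: "real \<Rightarrow> real" and K
  proof -
    have "(LINT \<rho>|leb_I. \<bar>f \<rho>\<bar>) \<le> (LINT \<rho>|leb_I. K * D \<rho>)"
      by (rule integral_mono_AE) (use that ID in auto)
    also have "\<dots> = K * (LINT \<rho>|leb_I. D \<rho>)" by simp
    also have "\<dots> \<le> K * (1 + 3 * C)" using intD that(3) by (rule mult_left_mono)
    finally show ?thesis .
  qed
  show "(LINT \<rho>|leb_I. \<bar>energy_rate \<gamma> \<gamma>' \<epsilon> x v h h' \<rho>\<bar>)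
      \<le> ?K * (1 + 3 * C)"
  proof (rule integrate[OF energy_dissipation(1)])
    show "AE \<rho> in leb_I. \<bar>energy_rate \<gamma> \<gamma>' \<epsilon> x v h h' \<rho>\<bar>
        \<le> ?K * D \<rho>"
      using speed_ge AE_space
    proof eventually_elim
      fix \<rho> assume c: "c \<le> w \<rho>" and "\<rho> \<in> space leb_I"
      then have \<rho>: "\<rho> \<in> {0..1}" by simp
      have "\<bar>energy_rate \<gamma> \<gamma>' \<epsilon> x v h h' \<rho>\<bar> \<le> B * (\<Gamma> * w \<rho>) + B * (2 * \<Gamma> * norm (Dr v \<rho>))
        + \<epsilon>\<^sup>2 / 2 * (B * B\<^sup>2 * w \<rho> + B * (2 * B * (\<bar>h' \<rho>\<bar> * w \<rho>)) + B * B\<^sup>2 * norm (Dr v \<rho>))"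
        by (rule energy_rate_le) (use G bx[OF \<rho>] bh[OF \<rho>] c c_pos in auto)
      also have "\<dots> \<le> B * (\<Gamma> * D \<rho>) + B * (2 * \<Gamma> * ((1 + 1 / c) * D \<rho>))
        + \<epsilon>\<^sup>2 / 2 * (B * B\<^sup>2 * D \<rho> + B * (2 * B * D \<rho>) + B * B\<^sup>2 * ((1 + 1 / c) * D \<rho>))"
        using dom[OF c] B0 G0 by (intro add_mono mult_left_mono) auto
      also have "\<dots> = ?K * D \<rho>"
        by (simp only: distrib_left distrib_right mult.assoc)
      finally show "\<bar>energy_rate \<gamma> \<gamma>' \<epsilon> x v h h' \<rho>\<bar>
        \<le> ?K * D \<rho>" .
    qed
  qed (use B0 G0 c_pos in \<open>auto intro!: add_nonneg_nonneg mult_nonneg_nonneg\<close>)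
  show "(LINT \<rho>|leb_I. \<bar>volume_rate x v \<rho>\<bar>) \<le> ?K' * (1 + 3 * C)"
  proof (rule integrate[OF volume_conservation(1)])
    show "AE \<rho> in leb_I. \<bar>volume_rate x v \<rho>\<bar> \<le> ?K' * D \<rho>"
      using speed_ge AE_space
    proof eventually_elim
      fix \<rho> assume c: "c \<le> w \<rho>" and "\<rho> \<in> space leb_I"
      then have \<rho>: "\<rho> \<in> {0..1}" by simp
      have "\<bar>volume_rate x v \<rho>\<bar> \<le> 2 * (B * B * w \<rho>) + B * B * norm (Dr v \<rho>)"
        by (rule volume_rate_le) (use bx[OF \<rho>] in auto)
      also have "\<dots> \<le> 2 * (B * B * D \<rho>) + B * B * ((1 + 1 / c) * D \<rho>)"
        using dom[OF c] B0 by (intro add_mono mult_left_mono) auto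
      also have "\<dots> = ?K' * D \<rho>"
        by (simp only: distrib_left distrib_right mult.assoc)
      finally show "\<bar>volume_rate x v \<rho>\<bar> \<le> ?K' * D \<rho>" .
    qed
  qed (use B0 c_pos in \<open>auto intro!: add_nonneg_nonneg mult_nonneg_nonneg\<close>)
qed

end


section \<open>Evolution in time\<close>

lemma has_real_derivative_vec_nth:
  fixes f :: "real \<Rightarrow> real^'n"
  assumes "(f has_vector_derivative f') (at t within T)"
  shows "((\<lambda>t. f t $ i) has_real_derivative f' $ i) (at t within T)"
  unfolding has_real_derivative_iff_has_vector_derivative
  by (rule bounded_linear.has_vector_derivative[OF bounded_linear_vec_nth assms])

text \<open>The integrand of the bulk energy with the factor \<open>2 * pi\<close> taken out; the
  substrate term, which lives at the end points, is kept apart.\<close>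

definition energy_density ::
  "(real \<Rightarrow> real) \<Rightarrow> real \<Rightarrow> (real \<Rightarrow> real^2) \<Rightarrow> (real \<Rightarrow> real) \<Rightarrow> real \<Rightarrow> real" where
  "energy_density \<gamma> \<epsilon> x h \<rho> =
     x \<rho> $ 1 * (\<gamma> (plane_angle (Dr x \<rho> $ 1) (Dr x \<rho> $ 2)) * plane_norm (Dr x \<rho> $ 1) (Dr x \<rho> $ 2))
     + \<epsilon>\<^sup>2 / 2 * (x \<rho> $ 1 * (h \<rho>)\<^sup>2 * plane_norm (Dr x \<rho> $ 1) (Dr x \<rho> $ 2))"

context film_state begin

lemma energy_eq:
  "integrable leb_I (energy_density \<gamma> \<epsilon> x h)"
  "energy \<epsilon> \<sigma> \<gamma> x h = 2 * pi * ((LINT \<rho>|leb_I. energy_density \<gamma> \<epsilon> x h \<rho>)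
      - \<sigma> / 2 * ((x 1 $ 1)\<^sup>2 - (x 0 $ 1)\<^sup>2))"
proof -
  have dens: "energy_density \<gamma> \<epsilon> x h \<rho> = (x \<rho> $ 1 * g \<rho>) * w \<rho> + \<epsilon>\<^sup>2 / 2 * ((x \<rho> $ 1 * (h \<rho>)\<^sup>2) * w \<rho>)" for \<rho>
    by (simp add: energy_density_def g_def speed_eq)
  have I: "integrable leb_I (\<lambda>\<rho>. (x \<rho> $ 1 * g \<rho>) * w \<rho>)" "integrable leb_I (\<lambda>\<rho>. (x \<rho> $ 1 * (h \<rho>)\<^sup>2) * w \<rho>)"
    by (intro integrable_bdd_w bdd_rules)+
  show "integrable leb_I (energy_density \<gamma> \<epsilon> x h)" unfolding dens[abs_def] using I by simp
  have "arc_integral x (\<lambda>\<rho>. x \<rho> $ 1 * \<gamma> (angle x \<rho>)) = (LINT \<rho>|leb_I. (x \<rho> $ 1 * g \<rho>) * w \<rho>)"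
    unfolding arc_integral_def
  proof (rule integral_leb_I_cong_AE)
    show "AE \<rho> in leb_I. x \<rho> $ 1 * \<gamma> (angle x \<rho>) * w \<rho> = x \<rho> $ 1 * g \<rho> * w \<rho>"
      using speed_ge by eventually_elim (use c_pos in \<open>simp add: angle_eq g_def\<close>)
  qed (use I in auto)
  moreover have "(LINT \<rho>|leb_I. energy_density \<gamma> \<epsilon> x h \<rho>) = (LINT \<rho>|leb_I. (x \<rho> $ 1 * g \<rho>) * w \<rho>)
      + \<epsilon>\<^sup>2 / 2 * (LINT \<rho>|leb_I. (x \<rho> $ 1 * (h \<rho>)\<^sup>2) * w \<rho>)"
    unfolding dens using I by simp
  ultimately show "energy \<epsilon> \<sigma> \<gamma> x h = 2 * pi * ((LINT \<rho>|leb_I. energy_density \<gamma> \<epsilon> x h \<rho>)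
      - \<sigma> / 2 * ((x 1 $ 1)\<^sup>2 - (x 0 $ 1)\<^sup>2))"
    unfolding energy_def by (simp add: arc_integral_def algebra_simps)
qed

lemma vol_eq:
  "integrable leb_I (\<lambda>\<rho>. x \<rho> $ 1 * x \<rho> $ 2 * Dr x \<rho> $ 1)"
  "vol x = 2 * pi * (LINT \<rho>|leb_I. x \<rho> $ 1 * x \<rho> $ 2 * Dr x \<rho> $ 1)"
proof -
  have "sqint (\<lambda>\<rho>. Dr x \<rho> $ 1)" by (rule Dr_vector_sqint[OF r_H1 z_H1])
  then show I: "integrable leb_I (\<lambda>\<rho>. x \<rho> $ 1 * x \<rho> $ 2 * Dr x \<rho> $ 1)"
    by (intro integrable_bdd_sqint bdd_rules)
  have "arc_integral x (\<lambda>\<rho>. x \<rho> $ 1 * x \<rho> $ 2 * tangent x \<rho> $ 1) = (LINT \<rho>|leb_I. x \<rho> $ 1 * x \<rho> $ 2 * Dr x \<rho> $ 1)"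
    unfolding arc_integral_def
  proof (rule integral_leb_I_cong_AE)
    show "AE \<rho> in leb_I. x \<rho> $ 1 * x \<rho> $ 2 * tangent x \<rho> $ 1 * w \<rho> = x \<rho> $ 1 * x \<rho> $ 2 * Dr x \<rho> $ 1"
      using speed_ge by eventually_elim (use c_pos in \<open>simp add: tangent_def\<close>)
  qed (use I in auto)
  then show "vol x = 2 * pi * (LINT \<rho>|leb_I. x \<rho> $ 1 * x \<rho> $ 2 * Dr x \<rho> $ 1)"
    by (simp add: vol_def)
qed

end

text \<open>\<open>\<Omega>\<close> is a set of full measure of parameters at which the time derivatives exist at all times
  simultaneously.\<close>

locale film_window = surface_energy \<gamma> \<gamma>' for \<gamma> \<gamma>' :: "real \<Rightarrow> real" +
  fixes \<epsilon> \<eta> \<sigma> :: real and S :: "real \<Rightarrow> real" and q :: nat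
    and X V :: "real \<Rightarrow> real \<Rightarrow> real^2" and \<mu> h h' \<kappa> :: "real \<Rightarrow> real \<Rightarrow> real"
    and a b c C :: real and \<Omega> :: "real set"
  assumes ab: "a < b"
    and state: "\<And>t. t \<in> {a..b} \<Longrightarrow>
      film_state (X t) c \<gamma> \<gamma>' \<epsilon> \<eta> \<sigma> S q (V t) (\<mu> t) (h t) (h' t) (\<kappa> t)"
    and bounds: "\<And>t. t \<in> {a..b} \<Longrightarrow> normsq (X t) (X t) \<le> C" "\<And>t. t \<in> {a..b} \<Longrightarrow> normsq (X t) (Dr (X t)) \<le> C"
      "\<And>t. t \<in> {a..b} \<Longrightarrow> normsq (X t) (V t) \<le> C" "\<And>t. t \<in> {a..b} \<Longrightarrow> normsq (X t) (Dr (V t)) \<le> C"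
      "\<And>t. t \<in> {a..b} \<Longrightarrow> normsq (X t) (h t) \<le> C" "\<And>t. t \<in> {a..b} \<Longrightarrow> normsq (X t) (Dr (h t)) \<le> C"
      "\<And>t. t \<in> {a..b} \<Longrightarrow> normsq (X t) (h' t) \<le> C"
    and dX: "\<And>t \<rho>. t \<in> {a..b} \<Longrightarrow> \<rho> \<in> {0..1} \<Longrightarrow>
      ((\<lambda>\<tau>. X \<tau> \<rho>) has_vector_derivative V t \<rho>) (at t within {a..b})"
    and \<Omega>_sets: "\<Omega> \<in> sets leb_I" and \<Omega>_AE: "AE \<rho> in leb_I. \<rho> \<in> \<Omega>"
    and dDX: "\<And>t \<rho>. t \<in> {a..b} \<Longrightarrow> \<rho> \<in> \<Omega> \<Longrightarrow>
      ((\<lambda>\<tau>. Dr (X \<tau>) \<rho>) has_vector_derivative Dr (V t) \<rho>) (at t within {a..b})"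
    and dh: "\<And>t \<rho>. t \<in> {a..b} \<Longrightarrow> \<rho> \<in> \<Omega> \<Longrightarrow>
      ((\<lambda>\<tau>. h \<tau> \<rho>) has_vector_derivative h' t \<rho>) (at t within {a..b})"
    and speed_pos: "\<And>t \<rho>. t \<in> {a..b} \<Longrightarrow> \<rho> \<in> \<Omega> \<Longrightarrow> 0 < speed (X t) \<rho>"
begin

text \<open>On the restricted space differentiability in time holds at every point, as the joint
  measurability and Fubini lemmas demand; integrals do not change because \<open>\<Omega>\<close>
  has full measure.\<close>

definition "M = restrict_space leb_I \<Omega>"

lemma \<Omega>_subset: "\<Omega> \<subseteq> {0..1}"
  using sets.sets_into_space[OF \<Omega>_sets] by simp

lemma space_M: "space M = \<Omega>"
  using \<Omega>_subset by (auto simp: M_def space_restrict_space)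

lemma measurable_M: "f \<in> borel_measurable leb_I \<Longrightarrow> f \<in> borel_measurable M"
  unfolding M_def by (rule measurable_restrict_space1)

lemma \<Omega>_sets': "\<Omega> \<inter> space leb_I \<in> sets leb_I"
  using \<Omega>_sets \<Omega>_subset by (simp add: Int_absorb2)

lemma integrable_M: "integrable leb_I f \<Longrightarrow> integrable M (f :: real \<Rightarrow> real)"
  unfolding M_def integrable_restrict_space[OF \<Omega>_sets'] real_scaleR_def
  by (subst mult.commute) (rule integrable_real_mult_indicator[OF \<Omega>_sets])

lemma integral_M:
  fixes f :: "real \<Rightarrow> real"
  assumes "f \<in> borel_measurable leb_I"
  shows "(LINT \<rho>|M. f \<rho>) = (LINT \<rho>|leb_I. f \<rho>)"
  unfolding M_def integral_restrict_space[OF \<Omega>_sets'] real_scaleR_def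
proof (rule integral_leb_I_cong_AE[OF assms])
  show "AE \<rho> in leb_I. indicat_real \<Omega> \<rho> * f \<rho> = f \<rho>" using \<Omega>_AE by eventually_elim simp
qed

lemma sigma_finite_M: "sigma_finite_measure M"
proof -
  have "finite_measure M" unfolding M_def
    by (rule finite_measure_restrict_space) (use \<Omega>_sets in \<open>auto intro: finite_measure_lebesgue_on\<close>)
  then show ?thesis by (simp add: finite_measure_def)
qed

lemma dX_nth: "t \<in> {a..b} \<Longrightarrow> \<rho> \<in> {0..1} \<Longrightarrow> ((\<lambda>\<tau>. X \<tau> \<rho> $ i) has_real_derivative V t \<rho> $ i) (at t within {a..b})"
  by (rule has_real_derivative_vec_nth[OF dX])

lemma dDX_nth: "t \<in> {a..b} \<Longrightarrow> \<rho> \<in> \<Omega> \<Longrightarrow> ((\<lambda>\<tau>. Dr (X \<tau>) \<rho> $ i) has_real_derivative Dr (V t) \<rho> $ i) (at t within {a..b})"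
  by (rule has_real_derivative_vec_nth[OF dDX])

lemma dh_real: "t \<in> {a..b} \<Longrightarrow> \<rho> \<in> \<Omega> \<Longrightarrow> ((\<lambda>\<tau>. h \<tau> \<rho>) has_real_derivative h' t \<rho>) (at t within {a..b})"
  unfolding has_real_derivative_iff_has_vector_derivative by (rule dh)

lemma continuous_on_time:
  assumes "\<And>t. t \<in> {a..b} \<Longrightarrow> (f has_real_derivative f' t) (at t within {a..b})"
  shows "continuous_on {a..b} f"
  using assms by (meson DERIV_continuous continuous_on_eq_continuous_within)

lemma Dr_nonzero: "t \<in> {a..b} \<Longrightarrow> \<rho> \<in> \<Omega> \<Longrightarrow> Dr (X t) \<rho> $ 1 \<noteq> 0 \<or> Dr (X t) \<rho> $ 2 \<noteq> 0"
  using speed_pos[of t \<rho>] unfolding speed_eq by (metis less_irrefl plane_norm_eq_0_iff)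

abbreviation "P \<equiv> lebesgue_on {a<..<b} \<Otimes>\<^sub>M M"

text \<open>Applied to each field paired with its time derivative: measurability in
  \<open>\<rho>\<close> at fixed times and differentiability in time make both jointly
  measurable.\<close>

lemma joint_measurable:
  fixes f f' :: "real \<Rightarrow> real \<Rightarrow> real"
  assumes "\<And>t. t \<in> {a..b} \<Longrightarrow> f t \<in> borel_measurable leb_I"
    and "\<And>t \<rho>. t \<in> {a..b} \<Longrightarrow> \<rho> \<in> \<Omega> \<Longrightarrow> ((\<lambda>\<tau>. f \<tau> \<rho>) has_real_derivative f' t \<rho>) (at t within {a..b})"
  shows "(\<lambda>p. f (fst p) (snd p)) \<in> borel_measurable P" "(\<lambda>p. f' (fst p) (snd p)) \<in> borel_measurable P"
proof -
  have "(\<lambda>(t, \<rho>). f t \<rho>) \<in> borel_measurable P"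
    by (rule borel_measurable_pair_caratheodory[of a b])
       (use assms measurable_M continuous_on_time[OF assms(2)] in \<open>auto simp: space_M\<close>)
  then show "(\<lambda>p. f (fst p) (snd p)) \<in> borel_measurable P" by (simp add: case_prod_beta')
  have "(\<lambda>(t, \<rho>). f' t \<rho>) \<in> borel_measurable P"
    by (rule borel_measurable_pair_derivative[of a b f])
       (use assms measurable_M in \<open>auto simp: space_M has_real_derivative_iff_has_vector_derivative[symmetric]\<close>)
  then show "(\<lambda>p. f' (fst p) (snd p)) \<in> borel_measurable P" by (simp add: case_prod_beta')
qed

lemma X_measurable: "t \<in> {a..b} \<Longrightarrow> (\<lambda>\<rho>. X t \<rho> $ 1) \<in> borel_measurable leb_I" "t \<in> {a..b} \<Longrightarrow> (\<lambda>\<rho>. X t \<rho> $ 2) \<in> borel_measurable leb_I"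
  and DX_measurable: "t \<in> {a..b} \<Longrightarrow> (\<lambda>\<rho>. Dr (X t) \<rho> $ 1) \<in> borel_measurable leb_I" "t \<in> {a..b} \<Longrightarrow> (\<lambda>\<rho>. Dr (X t) \<rho> $ 2) \<in> borel_measurable leb_I"
  and h_measurable: "t \<in> {a..b} \<Longrightarrow> h t \<in> borel_measurable leb_I"
proof -
  assume t: "t \<in> {a..b}"
  interpret film_state "X t" c \<gamma> \<gamma>' \<epsilon> \<eta> \<sigma> S q "V t" "\<mu> t" "h t" "h' t" "\<kappa> t" by (rule state[OF t])
  show "(\<lambda>\<rho>. X t \<rho> $ 1) \<in> borel_measurable leb_I" "(\<lambda>\<rho>. X t \<rho> $ 2) \<in> borel_measurable leb_I" "h t \<in> borel_measurable leb_I"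
    by (rule H1_measurable[OF r_H1], rule H1_measurable[OF z_H1], rule H1_measurable[OF h_H1])
  show "(\<lambda>\<rho>. Dr (X t) \<rho> $ 1) \<in> borel_measurable leb_I" "(\<lambda>\<rho>. Dr (X t) \<rho> $ 2) \<in> borel_measurable leb_I"
    by (rule Dr_x_measurable)+
qed

lemma in_unit: "\<rho> \<in> \<Omega> \<Longrightarrow> \<rho> \<in> {0..1}"
  using \<Omega>_subset by auto

lemmas fields_measurable [measurable] =
  joint_measurable[OF X_measurable(1) dX_nth[OF _ in_unit]]
  joint_measurable[OF X_measurable(2) dX_nth[OF _ in_unit]]
  joint_measurable[OF DX_measurable(1) dDX_nth] joint_measurable[OF DX_measurable(2) dDX_nth]
  joint_measurable[OF h_measurable dh_real]

lemma energy_rate_measurable: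
  "(\<lambda>(t, \<rho>). energy_rate \<gamma> \<gamma>' \<epsilon> (X t) (V t) (h t) (h' t) \<rho>) \<in> borel_measurable P"
proof -
  note [measurable] = borel_measurable_energy[of "\<lambda>p. Dr (X (fst p)) (snd p) $ 1" P "\<lambda>p. Dr (X (fst p)) (snd p) $ 2",
      OF fields_measurable(5) fields_measurable(7)]
  show ?thesis unfolding energy_rate_def Let_def case_prod_beta' plane_norm_def by measurable
qed

lemma volume_rate_measurable: "(\<lambda>(t, \<rho>). volume_rate (X t) (V t) \<rho>) \<in> borel_measurable P"
  unfolding volume_rate_def case_prod_beta' by measurable

lemma energy_density_derivative:
  assumes t: "t \<in> {a..b}" and \<rho>: "\<rho> \<in> \<Omega>" and tangential: "Dr (X t) \<rho> $ 2 = 0 \<Longrightarrow> Dr (V t) \<rho> $ 2 = 0"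
  shows "((\<lambda>t. energy_density \<gamma> \<epsilon> (X t) (h t) \<rho>) has_real_derivative
    energy_rate \<gamma> \<gamma>' \<epsilon> (X t) (V t) (h t) (h' t) \<rho>) (at t within {a..b})"
proof -
  note nz = Dr_nonzero[OF t \<rho>]
  note r = dX_nth[OF t in_unit[OF \<rho>], of 1] and p = dDX_nth[OF t \<rho>, of 1] dDX_nth[OF t \<rho>, of 2]
  note w = plane_norm_has_real_derivative[OF p nz]
  note s = energy_has_real_derivative[OF p nz tangential]
  note d = DERIV_add[OF DERIV_mult[OF r s]
      DERIV_cmult[OF DERIV_mult[OF DERIV_mult[OF r DERIV_power[OF dh_real[OF t \<rho>], of 2]] w], of "\<epsilon>\<^sup>2 / 2"]]
  show ?thesis unfolding energy_density_def
  proof (rule DERIV_cong[OF d])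
    let ?a = "Dr (X t) \<rho> $ 1" and ?b = "Dr (X t) \<rho> $ 2" and ?a' = "Dr (V t) \<rho> $ 1" and ?b' = "Dr (V t) \<rho> $ 2"
    show "V t \<rho> $ 1 * (\<gamma> (plane_angle ?a ?b) * plane_norm ?a ?b)
      + (\<gamma> (plane_angle ?a ?b) * (?a * ?a' + ?b * ?b') + \<gamma>' (plane_angle ?a ?b) * (?a * ?b' - ?b * ?a'))
        / plane_norm ?a ?b * X t \<rho> $ 1
      + \<epsilon>\<^sup>2 / 2 * ((V t \<rho> $ 1 * (h t \<rho>)\<^sup>2 + real 2 * (h' t \<rho> * h t \<rho> ^ (2 - Suc 0)) * X t \<rho> $ 1) * plane_norm ?a ?b
        + (?a * ?a' + ?b * ?b') / plane_norm ?a ?b * (X t \<rho> $ 1 * (h t \<rho>)\<^sup>2))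
      = energy_rate \<gamma> \<gamma>' \<epsilon> (X t) (V t) (h t) (h' t) \<rho>"
      unfolding energy_rate_def Let_def
      by (intro arg_cong2[where f = "(+)"] arg_cong[where f = "(*) (\<epsilon>\<^sup>2 / 2)"]) (simp_all add: algebra_simps)
  qed
qed

lemma energy_density_continuous:
  assumes \<rho>: "\<rho> \<in> \<Omega>"
  shows "continuous_on {a..b} (\<lambda>t. energy_density \<gamma> \<epsilon> (X t) (h t) \<rho>)"
proof -
  have c: "continuous_on {a..b} (\<lambda>t. X t \<rho> $ 1)" "continuous_on {a..b} (\<lambda>t. Dr (X t) \<rho> $ 1)"
    "continuous_on {a..b} (\<lambda>t. Dr (X t) \<rho> $ 2)" "continuous_on {a..b} (\<lambda>t. h t \<rho>)"
    by (rule continuous_on_time, erule dX_nth[OF _ in_unit[OF \<rho>]],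
        rule continuous_on_time, erule dDX_nth[OF _ \<rho>], rule continuous_on_time, erule dDX_nth[OF _ \<rho>],
        rule continuous_on_time, erule dh_real[OF _ \<rho>])
  show ?thesis unfolding energy_density_def plane_norm_def
    by (intro continuous_intros c continuous_on_energy Dr_nonzero[OF _ \<rho>])
qed

lemma has_integral_in_time:
  fixes F G :: "real \<Rightarrow> real \<Rightarrow> real"
  assumes F: "\<And>t. t \<in> {a..b} \<Longrightarrow> integrable leb_I (F t)"
    and G: "\<And>t. t \<in> {a..b} \<Longrightarrow> integrable leb_I (G t)"
    and bound: "\<And>t. t \<in> {a..b} \<Longrightarrow> (LINT \<rho>|leb_I. \<bar>G t \<rho>\<bar>) \<le> K"
    and cont: "\<And>\<rho>. \<rho> \<in> \<Omega> \<Longrightarrow> continuous_on {a..b} (\<lambda>t. F t \<rho>)"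
    and ctbl: "\<And>\<rho>. \<rho> \<in> \<Omega> \<Longrightarrow> countable (Z \<rho>)"
    and der: "\<And>\<rho> t. \<rho> \<in> \<Omega> \<Longrightarrow> t \<in> {a..b} - Z \<rho> \<Longrightarrow>
      ((\<lambda>t. F t \<rho>) has_real_derivative G t \<rho>) (at t within {a..b})"
    and meas: "(\<lambda>(t, \<rho>). G t \<rho>) \<in> borel_measurable P"
  shows "((\<lambda>t. LINT \<rho>|leb_I. G t \<rho>) has_integral
    ((LINT \<rho>|leb_I. F b \<rho>) - (LINT \<rho>|leb_I. F a \<rho>))) {a..b}"
proof -
  have a: "a \<in> {a..b}" and b: "b \<in> {a..b}" using ab by auto
  have MF: "(LINT \<rho>|M. F t \<rho>) = (LINT \<rho>|leb_I. F t \<rho>)"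
    and MG: "(LINT \<rho>|M. G t \<rho>) = (LINT \<rho>|leb_I. G t \<rho>)"
    and MG': "(LINT \<rho>|M. \<bar>G t \<rho>\<bar>) = (LINT \<rho>|leb_I. \<bar>G t \<rho>\<bar>)" if "t \<in> {a..b}" for t
    using F[OF that] G[OF that] by (auto intro!: integral_M)
  have "((\<lambda>t. LINT \<rho>|M. G t \<rho>) has_integral ((LINT \<rho>|M. F b \<rho>) - (LINT \<rho>|M. F a \<rho>))) {a..b}"
  proof (rule has_integral_integral_derivative[where S = Z,
        OF sigma_finite_M ab integrable_M[OF F[OF a]] integrable_M[OF F[OF b]] _ _ _ meas])
    show "integrable M (G t)" if "t \<in> {a<..<b}" for t using that by (intro integrable_M G) auto
    show "(LINT \<rho>|M. \<bar>G t \<rho>\<bar>) \<le> K" if "t \<in> {a<..<b}" for t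
      using that bound[of t] MG'[of t] by simp
  qed (use cont ctbl der in \<open>auto simp: space_M has_real_derivative_iff_has_vector_derivative[symmetric]\<close>)
  then have "((\<lambda>t. LINT \<rho>|M. G t \<rho>) has_integral ((LINT \<rho>|leb_I. F b \<rho>) - (LINT \<rho>|leb_I. F a \<rho>))) {a..b}"
    unfolding MF[OF a] MF[OF b] .
  then show ?thesis by (rule has_integral_eq[rotated]) (rule MG)
qed

lemma rates_bound:
  obtains K where "\<And>t. t \<in> {a..b} \<Longrightarrow> (LINT \<rho>|leb_I. \<bar>energy_rate \<gamma> \<gamma>' \<epsilon> (X t) (V t) (h t) (h' t) \<rho>\<bar>) \<le> K"
    and "\<And>t. t \<in> {a..b} \<Longrightarrow> (LINT \<rho>|leb_I. \<bar>volume_rate (X t) (V t) \<rho>\<bar>) \<le> K"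
proof -
  obtain \<Gamma> where \<Gamma>: "\<And>a b. \<bar>\<gamma> (plane_angle a b)\<bar> \<le> \<Gamma>" "\<And>a b. \<bar>\<gamma>' (plane_angle a b)\<bar> \<le> \<Gamma>"
    using bounded_energy by blast
  note * = film_state.rates_bounded[OF state bounds \<Gamma> refl]
  show thesis by (rule that[OF order_trans[OF *(1) max.cobounded1] order_trans[OF *(2) max.cobounded2]])
qed

text \<open>\<open>W\<close> itself is never differentiated. The bulk energy and the substrate term
  are both written as time integrals, and the two integrands are compared at every time of the
  window.\<close>

lemma energy_decreasing: "energy \<epsilon> \<sigma> \<gamma> (X b) (h b) \<le> energy \<epsilon> \<sigma> \<gamma> (X a) (h a)"
proof -
  let ?F = "\<lambda>t. energy_density \<gamma> \<epsilon> (X t) (h t)"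
  let ?G = "\<lambda>t. energy_rate \<gamma> \<gamma>' \<epsilon> (X t) (V t) (h t) (h' t)"
  \<comment> \<open>The times at which the tangent turns through a horizontal direction with nonzero
    speed. They depend on \<open>\<rho>\<close>, so they are removed separately for each
    \<open>\<rho>\<close> and not as a common set of bad times.\<close>
  let ?Z = "\<lambda>\<rho>. {t \<in> {a..b}. Dr (X t) \<rho> $ 2 = 0 \<and> Dr (V t) \<rho> $ 2 \<noteq> 0}"
  let ?W = "\<lambda>t. \<sigma> / 2 * ((X t 1 $ 1)\<^sup>2 - (X t 0 $ 1)\<^sup>2)"
  have a: "a \<in> {a..b}" and b: "b \<in> {a..b}" using ab by auto
  obtain K where K: "\<And>t. t \<in> {a..b} \<Longrightarrow> (LINT \<rho>|leb_I. \<bar>?G t \<rho>\<bar>) \<le> K"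
    using rates_bound by blast
  have bulk: "((\<lambda>t. LINT \<rho>|leb_I. ?G t \<rho>) has_integral ((LINT \<rho>|leb_I. ?F b \<rho>) - (LINT \<rho>|leb_I. ?F a \<rho>))) {a..b}"
  proof (rule has_integral_in_time[where Z = ?Z, OF _ _ K _ _ _ energy_rate_measurable])
    fix \<rho> assume \<rho>: "\<rho> \<in> \<Omega>"
    show "continuous_on {a..b} (\<lambda>t. ?F t \<rho>)" by (rule energy_density_continuous[OF \<rho>])
    show "countable (?Z \<rho>)"
      by (rule countable_transversal_zeros)
         (simp add: dDX_nth[OF _ \<rho>] has_real_derivative_iff_has_vector_derivative[symmetric])
    show "((\<lambda>t. ?F t \<rho>) has_real_derivative ?G t \<rho>) (at t within {a..b})" if "t \<in> {a..b} - ?Z \<rho>" for t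
      by (rule energy_density_derivative[OF _ \<rho>]) (use that in auto)
  qed (rule film_state.energy_eq(1)[OF state] film_state.energy_dissipation(1)[OF state], assumption)+
  have line: "((\<lambda>t. \<sigma> * (X t 1 $ 1 * V t 1 $ 1 - X t 0 $ 1 * V t 0 $ 1)) has_integral (?W b - ?W a)) {a..b}"
  proof (rule fundamental_theorem_of_calculus)
    fix t assume t: "t \<in> {a..b}"
    have "(?W has_real_derivative \<sigma> / 2 * (2 * X t 1 $ 1 * V t 1 $ 1 - 2 * X t 0 $ 1 * V t 0 $ 1)) (at t within {a..b})"
      by (intro DERIV_cmult DERIV_diff)
         (rule DERIV_cong, rule DERIV_power[OF dX_nth[OF t]], simp, simp)+
    then show "(?W has_vector_derivative \<sigma> * (X t 1 $ 1 * V t 1 $ 1 - X t 0 $ 1 * V t 0 $ 1)) (at t within {a..b})"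
      unfolding has_real_derivative_iff_has_vector_derivative[symmetric]
      by (rule DERIV_cong) (simp add: algebra_simps)
  qed (use ab in simp)
  have "(LINT \<rho>|leb_I. ?F b \<rho>) - (LINT \<rho>|leb_I. ?F a \<rho>) \<le> ?W b - ?W a"
    by (rule has_integral_le[OF bulk line]) (rule film_state.energy_dissipation(2)[OF state])
  then have "(LINT \<rho>|leb_I. ?F b \<rho>) - ?W b \<le> (LINT \<rho>|leb_I. ?F a \<rho>) - ?W a" by linarith
  then have "2 * pi * ((LINT \<rho>|leb_I. ?F b \<rho>) - ?W b) \<le> 2 * pi * ((LINT \<rho>|leb_I. ?F a \<rho>) - ?W a)"
    by (rule mult_left_mono) simp
  then show ?thesis
    unfolding film_state.energy_eq(2)[OF state[OF a]] film_state.energy_eq(2)[OF state[OF b]] .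
qed

lemma volume_constant: "vol (X b) = vol (X a)"
proof -
  let ?F = "\<lambda>t \<rho>. X t \<rho> $ 1 * X t \<rho> $ 2 * Dr (X t) \<rho> $ 1"
  let ?G = "\<lambda>t. volume_rate (X t) (V t)"
  have a: "a \<in> {a..b}" and b: "b \<in> {a..b}" using ab by auto
  obtain K where K: "\<And>t. t \<in> {a..b} \<Longrightarrow> (LINT \<rho>|leb_I. \<bar>?G t \<rho>\<bar>) \<le> K"
    using rates_bound by blast
  have dF: "((\<lambda>t. ?F t \<rho>) has_real_derivative ?G t \<rho>) (at t within {a..b})" if t: "t \<in> {a..b}" and \<rho>: "\<rho> \<in> \<Omega>" for t \<rho>
    by (rule DERIV_cong, rule DERIV_mult[OF DERIV_mult[OF dX_nth[OF t in_unit[OF \<rho>]] dX_nth[OF t in_unit[OF \<rho>]]] dDX_nth[OF t \<rho>]])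
       (simp add: volume_rate_def algebra_simps)
  have "((\<lambda>t. LINT \<rho>|leb_I. ?G t \<rho>) has_integral ((LINT \<rho>|leb_I. ?F b \<rho>) - (LINT \<rho>|leb_I. ?F a \<rho>))) {a..b}"
  proof (rule has_integral_in_time[where Z = "\<lambda>_. {}", OF _ _ K _ _ _ volume_rate_measurable])
    show "continuous_on {a..b} (\<lambda>t. ?F t \<rho>)" if "\<rho> \<in> \<Omega>" for \<rho>
      by (rule continuous_on_time) (erule dF[OF _ that])
  qed (use dF film_state.vol_eq(1)[OF state] film_state.volume_conservation(1)[OF state] in auto)
  moreover have "((\<lambda>t. LINT \<rho>|leb_I. ?G t \<rho>) has_integral 0) {a..b}"
    by (rule has_integral_is_0) (rule film_state.volume_conservation(2)[OF state])
  ultimately have "(LINT \<rho>|leb_I. ?F b \<rho>) - (LINT \<rho>|leb_I. ?F a \<rho>) = 0" by (rule has_integral_unique)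
  then show ?thesis
    unfolding film_state.vol_eq(2)[OF state[OF a]] film_state.vol_eq(2)[OF state[OF b]] by simp
qed

end

section \<open>From a solution to a compact window of time\<close>

lemma abs_cont_tendsto:
  assumes u: "abs_cont u" and s: "\<And>n. s n \<in> {0..1}" and b: "b \<in> {0..1}" and lim: "s \<longlonglongrightarrow> b"
  shows "(\<lambda>n. u (s n)) \<longlonglongrightarrow> u b"
proof -
  have I: "integrable leb_I (Dr u)" by (rule abs_cont_integrable[OF u])
  then have [measurable]: "Dr u \<in> borel_measurable leb_I" by auto
  have "(\<lambda>n. LINT y|leb_I. (if y \<le> s n then Dr u y else 0)) \<longlonglongrightarrow> (LINT y|leb_I. (if y \<le> b then Dr u y else 0))"
  proof (rule integral_dominated_convergence[where w = "\<lambda>y. \<bar>Dr u y\<bar>"])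
    show "AE y in leb_I. (\<lambda>n. if y \<le> s n then Dr u y else 0) \<longlonglongrightarrow> (if y \<le> b then Dr u y else 0)"
      using AE_leb_I_neq[of b]
    proof eventually_elim
      fix y :: real assume "y \<noteq> b"
      then consider "y < b" | "b < y" by linarith
      then have "\<forall>\<^sub>F n in sequentially. (if y \<le> s n then Dr u y else 0) = (if y \<le> b then Dr u y else 0)"
      proof cases
        case 1
        from order_tendstoD(1)[OF lim 1] show ?thesis by eventually_elim (use 1 in auto)
      next
        case 2
        from order_tendstoD(2)[OF lim 2] show ?thesis by eventually_elim (use 2 in auto)
      qed
      then show "(\<lambda>n. if y \<le> s n then Dr u y else 0) \<longlonglongrightarrow> (if y \<le> b then Dr u y else 0)"
        by (rule tendsto_eventually)
    qed
  qed (use I in auto)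
  then have "(\<lambda>n. u 0 + (LINT y|leb_I. (if y \<le> s n then Dr u y else 0)))
      \<longlonglongrightarrow> u 0 + (LINT y|leb_I. (if y \<le> b then Dr u y else 0))"
    by (intro tendsto_intros)
  moreover have "(\<lambda>n. u 0 + (LINT y|leb_I. (if y \<le> s n then Dr u y else 0))) = (\<lambda>n. u (s n))"
    by (rule ext) (rule abs_cont_eq[OF u s, symmetric])
  moreover have "u 0 + (LINT y|leb_I. (if y \<le> b then Dr u y else 0)) = u b"
    by (rule abs_cont_eq[OF u b, symmetric])
  ultimately show ?thesis by (simp only:)
qed

text \<open>Positivity of \<open>r\<close> is given in the open interval only; continuity carries
  the weak inequality to end points, which may lie on the axis.\<close>

lemma abs_cont_nonneg:
  assumes u: "abs_cont u" and pos: "\<And>\<rho>. \<rho> \<in> {0<..<1} \<Longrightarrow> 0 < u \<rho>" and b: "b \<in> {0..1}"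
  shows "0 \<le> u b"
proof -
  have "closure {0<..<1::real} = {0..1}" by simp
  moreover have "continuous_on {0..1} u"
    unfolding continuous_on_sequentially using abs_cont_tendsto[OF u] by (auto simp: o_def)
  ultimately show ?thesis
    using continuous_ge_on_closure[of "{0<..<1}" u b 0] b pos by (auto intro: less_imp_le)
qed

lemma is_interval_Icc_subset: "is_interval J \<Longrightarrow> a \<in> J \<Longrightarrow> b \<in> J \<Longrightarrow> {a..b} \<subseteq> (J :: real set)"
  by (meson atLeastAtMost_iff mem_is_interval_1_I subsetI)

text \<open>The constants in \<open>regular_in_time\<close> are local in time, so a compact window
  is fixed first. The null sets must then be collected into a single one that serves all its
  times.\<close>

lemma solution_window:
  assumes "surface_energy \<gamma> \<gamma>'" and \<eta>: "0 < \<eta>" and J: "is_interval J" "0 \<in> J" "J \<subseteq> {0..}"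
    and sol: "solution \<epsilon> \<eta> \<sigma> \<gamma> \<gamma>' S q J X0 X \<mu> \<mu>S \<kappa>"
    and a: "a \<in> J" and b: "b \<in> J" and ab: "a < b"
  obtains c C \<Omega> where "film_window \<gamma> \<gamma>' \<epsilon> \<eta> \<sigma> S q X (Dt J X) \<mu> \<mu>S (Dt J \<mu>S) \<kappa> a b c C \<Omega>"
proof -
  interpret surface_energy \<gamma> \<gamma>' by fact
  have abJ: "{a..b} \<subseteq> J" by (rule is_interval_Icc_subset[OF J(1) a b])
  have ab0: "{a..b} \<subseteq> {0..b}" using a J(3) by auto
  have reg: "regular_in_time J X \<mu>S" using sol by (simp add: solution_def)
  with b obtain c C where c: "0 < c" and cC: "\<forall>t\<in>{0..b}.
        (AE \<rho> in leb_I. c \<le> speed (X t) \<rho>) \<and>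
        normsq (X t) (X t) \<le> C \<and> normsq (X t) (Dr (X t)) \<le> C \<and>
        normsq (X t) (Dt J X t) \<le> C \<and> normsq (X t) (Dr (Dt J X t)) \<le> C \<and>
        normsq (X t) (\<mu>S t) \<le> C \<and> normsq (X t) (Dr (\<mu>S t)) \<le> C \<and>
        normsq (X t) (Dt J \<mu>S t) \<le> C" unfolding regular_in_time_def by meson
  have speed: "AE \<rho> in leb_I. c \<le> speed (X t) \<rho>" if "t \<in> {a..b}" for t using cC that ab0 by blast
  have dX: "((\<lambda>\<tau>. X \<tau> \<rho>) has_vector_derivative Dt J X t \<rho>) (at t within {a..b})"
    if "t \<in> {a..b}" "\<rho> \<in> {0..1}" for t \<rho>
  proof -
    have "(\<lambda>\<tau>. X \<tau> \<rho>) differentiable (at t within J)"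
      using reg that abJ by (auto simp: regular_in_time_def)
    then have "((\<lambda>\<tau>. X \<tau> \<rho>) has_vector_derivative Dt J X t \<rho>) (at t within J)"
      unfolding Dt_def by (simp add: vector_derivative_works[symmetric])
    then show ?thesis using abJ by (rule has_vector_derivative_within_subset)
  qed
  have A1: "AE \<rho> in leb_I. \<forall>t\<in>J. ((\<lambda>\<tau>. Dr (X \<tau>) \<rho>) has_vector_derivative Dr (Dt J X t) \<rho>) (at t within J)"
    and A2: "AE \<rho> in leb_I. \<forall>t\<in>J. (\<lambda>\<tau>. \<mu>S \<tau> \<rho>) differentiable (at t within J)"
    using reg by (auto simp: regular_in_time_def)
  \<comment> \<open>The null set for the lower speed bound depends on time, so only rational times
    are collected. Continuity in time of \<open>Dr (X \<tau>) \<rho>\<close> then extends the bound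
    to the whole window.\<close>
  have "countable ({a<..<b} \<inter> \<rat>)" using countable_rat by (rule countable_Int2)
  then have A3: "AE \<rho> in leb_I. \<forall>t\<in>{a<..<b} \<inter> \<rat>. c \<le> speed (X t) \<rho>"
    using speed by (subst AE_ball_countable) auto
  have "AE \<rho> in leb_I.
      (\<forall>t\<in>J. ((\<lambda>\<tau>. Dr (X \<tau>) \<rho>) has_vector_derivative Dr (Dt J X t) \<rho>) (at t within J))
      \<and> (\<forall>t\<in>J. (\<lambda>\<tau>. \<mu>S \<tau> \<rho>) differentiable (at t within J))
      \<and> (\<forall>t\<in>{a<..<b} \<inter> \<rat>. c \<le> speed (X t) \<rho>)"
    using A1 A2 A3 by eventually_elim blast
  then obtain N where N: "N \<in> null_sets leb_I" and good: "\<And>\<rho>. \<rho> \<in> space leb_I - N \<Longrightarrow>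
      (\<forall>t\<in>J. ((\<lambda>\<tau>. Dr (X \<tau>) \<rho>) has_vector_derivative Dr (Dt J X t) \<rho>) (at t within J))
      \<and> (\<forall>t\<in>J. (\<lambda>\<tau>. \<mu>S \<tau> \<rho>) differentiable (at t within J))
      \<and> (\<forall>t\<in>{a<..<b} \<inter> \<rat>. c \<le> speed (X t) \<rho>)"
    by (rule AE_E3) blast
  define \<Omega> where "\<Omega> = space leb_I - N"
  have dDX: "((\<lambda>\<tau>. Dr (X \<tau>) \<rho>) has_vector_derivative Dr (Dt J X t) \<rho>) (at t within {a..b})"
    if "t \<in> {a..b}" "\<rho> \<in> \<Omega>" for t \<rho>
    using good[of \<rho>] that abJ unfolding \<Omega>_def by (blast intro: has_vector_derivative_within_subset)
  have dh: "((\<lambda>\<tau>. \<mu>S \<tau> \<rho>) has_vector_derivative Dt J \<mu>S t \<rho>) (at t within {a..b})"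
    if "t \<in> {a..b}" "\<rho> \<in> \<Omega>" for t \<rho>
  proof -
    have "(\<lambda>\<tau>. \<mu>S \<tau> \<rho>) differentiable (at t within J)" using good[of \<rho>] that abJ unfolding \<Omega>_def by blast
    then have "((\<lambda>\<tau>. \<mu>S \<tau> \<rho>) has_vector_derivative Dt J \<mu>S t \<rho>) (at t within J)"
      unfolding Dt_def by (simp add: vector_derivative_works[symmetric])
    then show ?thesis using abJ by (rule has_vector_derivative_within_subset)
  qed
  have speed_\<Omega>: "0 < speed (X t) \<rho>" if "t \<in> {a..b}" "\<rho> \<in> \<Omega>" for t \<rho>
  proof -
    have cl: "closure ({a<..<b} \<inter> \<rat>) = {a..b}"
      using closure_open_Int_superset[of "{a<..<b}" "\<rat> :: real set"] ab
      by (simp add: Rats_closure_real)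
    have "continuous_on {a..b} (\<lambda>\<tau>. Dr (X \<tau>) \<rho>)"
      using dDX[OF _ that(2)] has_vector_derivative_continuous
      by (fastforce simp: continuous_on_eq_continuous_within)
    then have "continuous_on (closure ({a<..<b} \<inter> \<rat>)) (\<lambda>\<tau>. speed (X \<tau>) \<rho>)"
      unfolding cl speed_def by (intro continuous_intros)
    then have "c \<le> speed (X t) \<rho>"
      by (rule continuous_ge_on_closure) (use that good[of \<rho>] in \<open>auto simp: cl \<Omega>_def\<close>)
    then show ?thesis using c by linarith
  qed
  have state: "film_state (X t) c \<gamma> \<gamma>' \<epsilon> \<eta> \<sigma> S q (Dt J X t) (\<mu> t) (\<mu>S t) (Dt J \<mu>S t) (\<kappa> t)"
    if t: "t \<in> {a..b}" for t
  proof -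
    have tJ: "t \<in> J" using t abJ by blast
    have r: "(\<lambda>\<rho>. X s \<rho> $ 1) \<in> H1 (X s)" and z: "(\<lambda>\<rho>. X s \<rho> $ 2) \<in> H1 (X s)"
      and z1: "X s 1 $ 2 = 0" and z0: "0 < X s 0 $ 1 \<Longrightarrow> X s 0 $ 2 = 0"
      and rpos: "\<And>\<rho>. \<rho> \<in> {0<..<1} \<Longrightarrow> 0 < X s \<rho> $ 1" if "s \<in> J" for s
      using sol that by (auto simp: solution_def H1_r_def H1_z_def)
    \<comment> \<open>The derivative of a function vanishing near \<open>t\<close> is 0, also at the
      ends of the window, where one-sided derivatives are unique because
      \<open>a < b\<close>.\<close>
    have zero: "d = 0" if "((\<lambda>\<tau>. f \<tau>) has_real_derivative d) (at t within {a..b})"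
      "\<forall>\<^sub>F \<tau> in at t within {a..b}. f \<tau> = 0" "f t = 0" for f :: "real \<Rightarrow> real" and d
    proof -
      have "((\<lambda>\<tau>. 0) has_real_derivative d) (at t within {a..b})"
        using has_field_derivative_cong_eventually[OF that(2), of d] that(1,3) by simp
      then show ?thesis
        using vector_derivative_unique_within_closed_interval[of a b t "\<lambda>\<tau>. 0 :: real" d 0] ab t
        by (simp add: has_real_derivative_iff_has_vector_derivative)
    qed
    have v1: "Dt J X t 1 $ 2 = 0"
    proof (rule zero[OF has_real_derivative_vec_nth[OF dX[OF t]]])
      show "\<forall>\<^sub>F \<tau> in at t within {a..b}. X \<tau> 1 $ 2 = 0"
        unfolding eventually_at_filter using z1 abJ by (intro always_eventually) auto
    qed (use z1 tJ in auto)
    \<comment> \<open>\<open>z\<close> is known to vanish at the inner end only while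
      \<open>r\<close> is positive there; by continuity in time this persists near
      \<open>t\<close>.\<close>
    have v0: "Dt J X t 0 $ 2 = 0" if "0 < X t 0 $ 1"
    proof (rule zero[OF has_real_derivative_vec_nth[OF dX[OF t]]])
      have "((\<lambda>\<tau>. X \<tau> 0 $ 1) \<longlongrightarrow> X t 0 $ 1) (at t within {a..b})"
        using DERIV_continuous[OF has_real_derivative_vec_nth[OF dX[OF t, of 0], of 1]]
        by (simp add: continuous_within)
      then have "\<forall>\<^sub>F \<tau> in at t within {a..b}. 0 < X \<tau> 0 $ 1" using that by (rule order_tendstoD)
      then show "\<forall>\<^sub>F \<tau> in at t within {a..b}. X \<tau> 0 $ 2 = 0"
        unfolding eventually_at_filter by eventually_elim (use z0 abJ in auto)
    qed (use z0 that tJ in auto)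
    show ?thesis
    proof (unfold_locales)
      show "0 \<le> X t \<rho> $ 1" if "\<rho> \<in> {0..1}" for \<rho>
        by (rule abs_cont_nonneg[of "\<lambda>\<rho>. X t \<rho> $ 1"]) (use r[OF tJ] rpos[OF tJ] that in \<open>auto simp: H1_def\<close>)
      show "(\<lambda>\<rho>. Dt J X t \<rho> $ 1) \<in> H1 (X t)" "(\<lambda>\<rho>. Dt J X t \<rho> $ 2) \<in> H1 (X t)" "Dt J \<mu>S t \<in> L2 (X t)"
        using reg tJ by (auto simp: regular_in_time_def)
      show "\<mu> t \<in> H1 (X t)" "\<mu>S t \<in> H1_0 (X t)" "\<kappa> t \<in> L2 (X t)"
        "V1 (X t) (Dt J X t) (\<mu> t)" "V2 \<epsilon> \<eta> \<sigma> \<gamma> \<gamma>' S q (X t) (Dt J X t) (\<mu> t) (\<mu>S t) (\<kappa> t)"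
        "V3 (X t) (Dt J X t) (\<mu>S t) (Dt J \<mu>S t) (\<kappa> t)"
        using sol tJ by (auto simp: solution_def)
    qed (use c \<eta> speed[OF t] r[OF tJ] z[OF tJ] z1[OF tJ] z0[OF tJ] v0 v1 in auto)
  qed
  have "film_window \<gamma> \<gamma>' \<epsilon> \<eta> \<sigma> S q X (Dt J X) \<mu> \<mu>S (Dt J \<mu>S) \<kappa> a b c C \<Omega>"
  proof (intro film_window.intro film_window_axioms.intro)
    show "\<Omega> \<in> sets leb_I" using N by (auto simp: \<Omega>_def)
    show "AE \<rho> in leb_I. \<rho> \<in> \<Omega>"
      using AE_not_in[OF N] AE_space by eventually_elim (simp add: \<Omega>_def)
  qed (use assms(1) ab state dX dDX dh speed_\<Omega> cC ab0 in blast)+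
  then show thesis by (rule that)
qed

theorem theorem4p1:
  fixes \<epsilon> \<eta> \<sigma> :: real and q :: nat
    and \<gamma> \<gamma>' \<gamma>'' S :: "real \<Rightarrow> real"
    and J :: "real set"
    and X0 :: "real \<Rightarrow> real^2"
    and X :: "real \<Rightarrow> real \<Rightarrow> real^2"
    and \<mu> \<mu>S \<kappa> :: "real \<Rightarrow> real \<Rightarrow> real"
  assumes "0 < \<epsilon>" and "0 < \<eta>" and "q \<in> {0, 1}"
    and even: "\<And>\<theta>. \<theta> \<in> {0..pi} \<Longrightarrow> \<gamma> \<theta> = \<gamma> (- \<theta>)"
    and "\<And>\<theta>. \<theta> \<in> {0..pi} \<Longrightarrow> (\<gamma> has_real_derivative \<gamma>' \<theta>) (at \<theta> within {0..pi})"
    and "\<And>\<theta>. \<theta> \<in> {0..pi} \<Longrightarrow> (\<gamma>' has_real_derivative \<gamma>'' \<theta>) (at \<theta> within {0..pi})"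
    and "continuous_on {0..pi} \<gamma>''"
    and "\<And>\<theta>. \<theta> \<in> {-pi<..<0} \<Longrightarrow> (\<gamma> has_real_derivative \<gamma>' \<theta>) (at \<theta>)"
    and "is_interval J" and "0 \<in> J" and "J \<subseteq> {0..}"
    and "solution \<epsilon> \<eta> \<sigma> \<gamma> \<gamma>' S q J X0 X \<mu> \<mu>S \<kappa>"
  shows "(\<forall>t\<in>J. vol (X t) = vol (X 0)) \<and>
         (\<forall>t1\<in>J. \<forall>t2\<in>J. t1 \<le> t2 \<longrightarrow>
            energy \<epsilon> \<sigma> \<gamma> (X t2) (\<mu>S t2) \<le> energy \<epsilon> \<sigma> \<gamma> (X t1) (\<mu>S t1) \<and>
            energy \<epsilon> \<sigma> \<gamma> (X t1) (\<mu>S t1) \<le> energy \<epsilon> \<sigma> \<gamma> (X 0) (\<mu>S 0))"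
proof -
  have "continuous_on {0..pi} \<gamma>'"
    using assms(6) by (meson DERIV_continuous continuous_on_eq_continuous_within)
  then have "surface_energy \<gamma> \<gamma>'" using assms(4,5,8) by unfold_locales
  note window = solution_window[OF this assms(2,9-12)]
  have energy: "energy \<epsilon> \<sigma> \<gamma> (X b) (\<mu>S b) \<le> energy \<epsilon> \<sigma> \<gamma> (X a) (\<mu>S a)"
    and vol: "vol (X b) = vol (X a)" if J: "a \<in> J" "b \<in> J" "a \<le> b" for a b
  proof -
    have "energy \<epsilon> \<sigma> \<gamma> (X b) (\<mu>S b) \<le> energy \<epsilon> \<sigma> \<gamma> (X a) (\<mu>S a) \<and> vol (X b) = vol (X a)"
    proof (cases "a = b")
      case False
      then have "a < b" using J(3) by simp
      then obtain c C \<Omega> where W: "film_window \<gamma> \<gamma>' \<epsilon> \<eta> \<sigma> S q X (Dt J X) \<mu> \<mu>S (Dt J \<mu>S) \<kappa> a b c C \<Omega>"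
        using window[OF J(1,2)] by blast
      show ?thesis using film_window.energy_decreasing[OF W] film_window.volume_constant[OF W] by simp
    qed simp
    then show "energy \<epsilon> \<sigma> \<gamma> (X b) (\<mu>S b) \<le> energy \<epsilon> \<sigma> \<gamma> (X a) (\<mu>S a)" "vol (X b) = vol (X a)" by auto
  qed
  have nonneg: "0 \<le> t" if "t \<in> J" for t using that assms(11) by auto
  show ?thesis using energy vol nonneg assms(10) by blast
qed

end
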